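(* There is a data structure maintaining information about a longest strictly increasing subsequence of a dynamic list $L$ of numbers, supporting the operations Append$(i)$ (append the number $i$ at the end of $L$) and ExtractMin (remove from $L$ all occurrences of its current minimum value), with the following guarantee. Suppose the list starts empty and finishes empty, that in total $\ell$ elements are appended, that the appended elements arrive in $d$ batches, each batch being a run of consecutive Append operations whose values form a decreasing sequence, and that ExtractMin is executed $e$ times in total. Then the overall running time is $O\big(e\,\lambda\,(1+\log(\min\{\lambda,\ell/\lambda\})) + \ell + d\lambda\big)$, where $\lambda\geq 1$ is the largest length of a longest strictly increasing subsequence of $L$ over the whole execution. Moreover, at any time the length of a longest strictly increasing subsequence of the current list can be obtained in $O(1)$ time.
   Context: A subsequence of a list $(x_1,\dots,x_m)$ is obtained by selecting entries at indices $p_1<\dots<p_k$; it is strictly increasing if $x_{p_1}<\dots<x_{p_k}$. *)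

theory Defs
  imports Complex_Main "HOL-Library.Sublist"
begin

section \<open>The dynamic list\<close>

datatype operation = Append real | ExtractMin

fun apply_op :: "operation \<Rightarrow> real list \<Rightarrow> real list" where
  "apply_op (Append x) L = L @ [x]"
| "apply_op ExtractMin L = filter (\<lambda>y. y \<noteq> Min (set L)) L"

definition contents :: "operation list \<Rightarrow> real list" where
  "contents ops = fold apply_op ops []"

text \<open>\<^const>\<open>ExtractMin\<close> presupposes a current minimum, i.e. a nonempty list.\<close>

definition legal :: "operation list \<Rightarrow> bool" where
  "legal ops \<longleftrightarrow> (\<forall>us vs. ops = us @ ExtractMin # vs \<longrightarrow> contents us \<noteq> [])"

definition lis_length :: "real list \<Rightarrow> nat" where
  "lis_length L = Max {length s | s. subseq s L \<and> sorted_wrt (<) s}"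

definition max_lis :: "operation list \<Rightarrow> nat" where
  "max_lis ops = Max {lis_length (contents (take k ops)) | k. k \<le> length ops}"

text \<open>
  \<^term>\<open>batched ops d\<close>: the appends in \<^term>\<open>ops\<close> can be cut into \<^term>\<open>d\<close> runs of
  consecutive appends with weakly decreasing values.  The cut need not be the coarsest one,
  and strictly decreasing runs are a special case.
\<close>

inductive batched :: "operation list \<Rightarrow> nat \<Rightarrow> bool" where
  "batched [] 0"
| "batched ops d \<Longrightarrow> batched (ExtractMin # ops) d"
| "batched ops d \<Longrightarrow> xs \<noteq> [] \<Longrightarrow> sorted_wrt (\<ge>) xs \<Longrightarrow> batched (map Append xs @ ops) (Suc d)"

section \<open>The machine model\<close>

text \<open>
  A unit-cost RAM, programmed by structured commands and recursive procedures.  A memory cell or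
  register holds either a natural number, which may be used as an address, or an element of the
  maintained list (a key).  Keys can only be copied and compared with each other; the only
  arithmetic is addition and truncated subtraction of natural numbers.  Each procedure activation
  has its own registers and all activations share the memory.  A command that applies an
  operation to values of the wrong kind, or calls a missing procedure, has no execution.
\<close>

datatype val = Num nat | Key real

type_synonym reg = nat
type_synonym regs = "reg \<Rightarrow> val"
type_synonym mem = "nat \<Rightarrow> val"

datatype cond = Less reg reg | Equal reg reg

datatype com =
    Skip
  | Const reg nat
  | Move reg reg
  | Add reg reg reg
  | Sub reg reg reg
  | Load reg reg
  | Store reg reg
  | Seq com com
  | Cond cond com com
  | While cond com
  | Call reg nat "reg list"

fun less_val :: "val \<Rightarrow> val \<Rightarrow> bool option" where
  "less_val (Num m) (Num n) = Some (m < n)"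
| "less_val (Key x) (Key y) = Some (x < y)"
| "less_val _ _ = None"

fun equal_val :: "val \<Rightarrow> val \<Rightarrow> bool option" where
  "equal_val (Num m) (Num n) = Some (m = n)"
| "equal_val (Key x) (Key y) = Some (x = y)"
| "equal_val _ _ = None"

fun holds :: "cond \<Rightarrow> regs \<Rightarrow> bool option" where
  "holds (Less x y) R = less_val (R x) (R y)"
| "holds (Equal x y) R = equal_val (R x) (R y)"

definition zero_regs :: regs where
  "zero_regs = (\<lambda>_. Num 0)"

definition zero_mem :: mem where
  "zero_mem = (\<lambda>_. Num 0)"

text \<open>A procedure finds its arguments in registers 0, 1, ... and leaves its result in register 0.\<close>

definition frame :: "regs \<Rightarrow> reg list \<Rightarrow> regs" where
  "frame R ys = (\<lambda>i. if i < length ys then R (ys ! i) else Num 0)"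

text \<open>
  \<^term>\<open>exec P c (R, M) t (R', M')\<close>: with procedure table \<^term>\<open>P\<close>, command \<^term>\<open>c\<close> started in
  registers \<^term>\<open>R\<close> and memory \<^term>\<open>M\<close> terminates after \<^term>\<open>t\<close> steps in \<^term>\<open>(R', M')\<close>.
\<close>

inductive exec :: "com list \<Rightarrow> com \<Rightarrow> regs \<times> mem \<Rightarrow> nat \<Rightarrow> regs \<times> mem \<Rightarrow> bool"
  for P :: "com list" where
  Skip: "exec P Skip (R, M) 1 (R, M)"
| Const: "exec P (Const x n) (R, M) 1 (R(x := Num n), M)"
| Move: "exec P (Move x y) (R, M) 1 (R(x := R y), M)"
| Add: "R y = Num m \<Longrightarrow> R z = Num n \<Longrightarrow> exec P (Add x y z) (R, M) 1 (R(x := Num (m + n)), M)"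
| Sub: "R y = Num m \<Longrightarrow> R z = Num n \<Longrightarrow> exec P (Sub x y z) (R, M) 1 (R(x := Num (m - n)), M)"
| Load: "R y = Num a \<Longrightarrow> exec P (Load x y) (R, M) 1 (R(x := M a), M)"
| Store: "R x = Num a \<Longrightarrow> exec P (Store x y) (R, M) 1 (R, M(a := R y))"
| Seq: "exec P c1 s t1 s' \<Longrightarrow> exec P c2 s' t2 s'' \<Longrightarrow> exec P (Seq c1 c2) s (t1 + t2) s''"
| CondTrue: "holds b R = Some True \<Longrightarrow> exec P c1 (R, M) t s' \<Longrightarrow>
    exec P (Cond b c1 c2) (R, M) (1 + t) s'"
| CondFalse: "holds b R = Some False \<Longrightarrow> exec P c2 (R, M) t s' \<Longrightarrow>
    exec P (Cond b c1 c2) (R, M) (1 + t) s'"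
| WhileTrue: "holds b R = Some True \<Longrightarrow> exec P c (R, M) t1 s' \<Longrightarrow>
    exec P (While b c) s' t2 s'' \<Longrightarrow> exec P (While b c) (R, M) (1 + t1 + t2) s''"
| WhileFalse: "holds b R = Some False \<Longrightarrow> exec P (While b c) (R, M) 1 (R, M)"
| Call: "p < length P \<Longrightarrow> exec P (P ! p) (frame R ys, M) t (R', M') \<Longrightarrow>
    exec P (Call x p ys) (R, M) (1 + length ys + t) (R(x := R' 0), M')"

inductive_cases exec_elims:
  "exec P Skip s t s'"
  "exec P (Const x n) s t s'"
  "exec P (Move x y) s t s'"
  "exec P (Add x y z) s t s'"
  "exec P (Sub x y z) s t s'"
  "exec P (Load x y) s t s'"
  "exec P (Store x y) s t s'"
  "exec P (Seq c1 c2) s t s'"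
  "exec P (Cond b c1 c2) s t s'"
  "exec P (Call x p ys) s t s'"

inductive_cases exec_WhileE: "exec P (While b c) s t s'"

lemma exec_deterministic:
  "exec P c s t s' \<Longrightarrow> exec P c s u s'' \<Longrightarrow> u = t \<and> s'' = s'"
proof (induction arbitrary: u s'' rule: exec.induct)
  case (Seq c1 s t1 s1 c2 t2 s2)
  from Seq.prems obtain u1 u2 r where
    "u = u1 + u2" "exec P c1 s u1 r" "exec P c2 r u2 s''" by (elim exec_elims)
  then show ?case using Seq.IH by metis
next
  case (WhileTrue b R c M t1 s1 t2 s2)
  from WhileTrue.prems WhileTrue.hyps(1) obtain u1 u2 r where
    "u = 1 + u1 + u2" "exec P c (R, M) u1 r" "exec P (While b c) r u2 s''"
    by - (erule exec_WhileE; auto)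
  then show ?case using WhileTrue.IH by metis
next
  case (WhileFalse b R c M)
  then show ?case by - (erule exec_WhileE; auto)
next
  case (Call p R ys M t R' M' x)
  from Call.prems obtain v Q N where
    "u = 1 + length ys + v" "s'' = (R(x := Q 0), N)" "exec P (P ! p) (frame R ys, M) v (Q, N)"
    by (elim exec_elims) auto
  with Call.IH show ?case by blast
next
  case (CondTrue b R c1 M t s1 c2)
  from CondTrue.prems CondTrue.hyps(1) obtain v where
    "u = 1 + v" "exec P c1 (R, M) v s''"
    by (elim exec_elims) simp_all
  with CondTrue.IH show ?case by simp
next
  case (CondFalse b R c2 M t s1 c1)
  from CondFalse.prems CondFalse.hyps(1) obtain v where
    "u = 1 + v" "exec P c2 (R, M) v s''"
    by (elim exec_elims) simp_all
  with CondFalse.IH show ?case by simp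
qed (elim exec_elims; simp)+

section \<open>Data structures\<close>

record lis_structure =
  procs :: "com list"
  init_code :: com
  append_code :: com
  extract_code :: com
  length_code :: com

text \<open>
  \<^term>\<open>run D ops t M\<close>: starting from the zeroed memory, initialising the structure and then
  performing \<^term>\<open>ops\<close> takes \<^term>\<open>t\<close> steps in total and ends with memory \<^term>\<open>M\<close>.
  Only the memory is kept from one operation to the next.
\<close>

inductive run :: "lis_structure \<Rightarrow> operation list \<Rightarrow> nat \<Rightarrow> mem \<Rightarrow> bool"
  for D :: lis_structure where
  Init: "exec (procs D) (init_code D) (zero_regs, zero_mem) t (R, M) \<Longrightarrow> run D [] t M"
| Append: "run D ops t M \<Longrightarrow>
    exec (procs D) (append_code D) (zero_regs(0 := Key x), M) u (R, M') \<Longrightarrow>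
    run D (ops @ [Append x]) (t + u) M'"
| ExtractMin: "run D ops t M \<Longrightarrow>
    exec (procs D) (extract_code D) (zero_regs, M) u (R, M') \<Longrightarrow>
    run D (ops @ [ExtractMin]) (t + u) M'"

inductive_cases run_NilE: "run D [] t M"
inductive_cases run_snocE: "run D (ops @ [p]) t M"

lemma run_deterministic:
  "run D ops t M \<Longrightarrow> run D ops u M' \<Longrightarrow> u = t \<and> M' = M"
proof (induction arbitrary: u M' rule: run.induct)
  case (Init t R M)
  from Init.prems obtain Q where
    "exec (procs D) (init_code D) (zero_regs, zero_mem) u (Q, M')"
    by (elim run_NilE) auto
  from exec_deterministic[OF Init.hyps this] show ?case by simp
next
  case (Append ops t M x v R M1)
  from Append.prems obtain t' M2 v' Q where *: "run D ops t' M2" "u = t' + v'"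
    "exec (procs D) (append_code D) (zero_regs(0 := Key x), M2) v' (Q, M')"
    by (elim run_snocE) auto
  with Append.IH have "t' = t" "M2 = M" by auto
  with exec_deterministic[OF Append.hyps(2)] * show ?case by blast
next
  case (ExtractMin ops t M v R M1)
  from ExtractMin.prems obtain t' M2 v' Q where *: "run D ops t' M2" "u = t' + v'"
    "exec (procs D) (extract_code D) (zero_regs, M2) v' (Q, M')"
    by (elim run_snocE) auto
  with ExtractMin.IH have "t' = t" "M2 = M" by auto
  with exec_deterministic[OF ExtractMin.hyps(2)] * show ?case by blast
qed

end

theory Submission imports Defs begin

text \<open>
  The list is kept as a greedy cover: lists \<open>C\<^sub>1, C\<^sub>2,
      \<dots>\<close> that are weakly decreasing and such that every
  element of \<open>C\<^sub>i\<^sub>+\<^sub>1\<close> is preceded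
      by a smaller element of \<open>C\<^sub>i\<close>; their number is the length of a longest
  increasing subsequence.  An append goes to the first list whose last element is not smaller, which
  is found by scanning from the right,
      so that a whole batch costs its size plus the number of lists.
  Removing the minimum cuts a suffix off \<open>C\<^sub>1\<close>; the elements of
      \<open>C\<^sub>i\<^sub>+\<^sub>1\<close> that lose their support form a
  suffix, which replaces the suffix cut off \<open>C\<^sub>i\<close>.

  Each list is a stack of blocks, which are AVL trees with at most \<open>B\<close> leaves,
      where \<open>B\<close> is the largest
  number of lists so far.  A cut pops whole blocks,
      splits one block in time \<open>O(log (min B |C\<^sub>i|))\<close> and
  merges a bounded number of neighbouring small blocks.  Two neighbouring blocks together have more
  than \<open>B\<close> elements at the time they become neighbours.  Give an element the weight
      \<open>1 / i\<close> if it was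
  first put into \<open>C\<^sub>i\<close>: then neighbouring blocks weigh at least 1,
      so the number of popped blocks is at
  most twice the weight moved plus 2, and since elements only move to lists of smaller index, the
  weight moved by one element is at most 1 in total.  The logarithms of one extraction sum up to
  \<open>O(\<lambda> (1 + log (min \<lambda> (\<ell> / \<lambda>))))\<close> by concavity.
\<close>

section \<open>Leaf-oriented AVL trees\<close>

text \<open>An append can afford only constant time beyond its scan, so it must not touch a tree.
  Every list keeps a buffer of new elements, turned into full blocks in linear time when an
  extraction reaches the list. The final maximal length is unknown during the run, so
  \<open>B\<close> grows. An invariant comparing the sizes of neighbouring blocks with
  \<open>B\<close> would break at every growth. The weight of two neighbours does not mention
  \<open>B\<close>; sizes are compared only when two blocks meet, and then every element weighs at
  least \<open>1 / B\<close>. The potential \<open>pot\<close> sums list index times weight: an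
  append adds exactly 1, and a move by one list releases exactly the weight that pays for the popped
  blocks. Removing the minimum is an instance of the general cut once an empty dummy list of index 0
  is put in front; the copies of the minimum move there and are forgotten. On the machine, allocated
  records never change, so trees may share structure and only framing has to be proved. Heap, table
  of halves and list headers are unbounded regions kept apart by residues modulo 4.\<close>

text \<open>The field \<open>lv\<close> is the index of the list into which the element was first
    put.  It is not
  stored in memory and only serves the analysis.\<close>

datatype elem = Elem (key: real) (pos: nat) (lv: nat)

datatype tree = Lf elem | Nd tree tree

fun leaves :: "tree \<Rightarrow> elem list" where
  "leaves (Lf x) = [x]"
| "leaves (Nd l r) = leaves l @ leaves r"

abbreviation sz :: "tree \<Rightarrow> nat" where "sz t \<equiv> length (leaves t)"

fun ht :: "tree \<Rightarrow> nat" where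
  "ht (Lf x) = 0"
| "ht (Nd l r) = 1 + max (ht l) (ht r)"

fun avl :: "tree \<Rightarrow> bool" where
  "avl (Lf x) = True"
| "avl (Nd l r) \<longleftrightarrow> avl l \<and> avl r \<and> ht l \<le> ht r + 1 \<and>
    ht r \<le> ht l + 1"

fun tfirst :: "tree \<Rightarrow> elem" where
  "tfirst (Lf x) = x"
| "tfirst (Nd l r) = tfirst l"

fun tlast :: "tree \<Rightarrow> elem" where
  "tlast (Lf x) = x"
| "tlast (Nd l r) = tlast r"

lemma leaves_nonempty [simp]: "leaves t \<noteq> []"
  by (induction t) auto

lemma sz_pos: "0 < sz t"
  by simp

lemma tfirst_eq_hd: "tfirst t = hd (leaves t)"
  by (induction t) auto

lemma tlast_eq_last: "tlast t = last (leaves t)"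
  by (induction t) auto

lemma tlast_in_leaves: "tlast t \<in> set (leaves t)"
  by (simp add: tlast_eq_last)

text \<open>Squaring avoids the Fibonacci recurrence. With \<open>m\<close> the smaller height of
  the two subtrees, each of \<open>sz l ^ 2\<close>, \<open>sz r ^ 2\<close> and
  \<open>sz l * sz r\<close> is at least \<open>2 ^ m\<close>; the expanded square of the sum
  contains four such terms, which pay for the at most two levels above \<open>m\<close>.\<close>

lemma avl_sz_ge: "avl t \<Longrightarrow> 2 ^ ht t \<le> sz t ^ 2"
proof (induction t)
  case (Nd l r)
  let ?m = "min (ht l) (ht r)"
  have lr: "2 ^ ?m \<le> sz l ^ 2" "2 ^ ?m \<le> sz r ^ 2"
    using Nd by (auto intro: order_trans[rotated] power_increasing)
  have "(2::nat) ^ ?m \<le> sz l * sz r"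
  proof -
    have "(2 ^ ?m)\<^sup>2 \<le> (sz l * sz r)\<^sup>2"
      using mult_mono[OF lr] by (simp add: power2_eq_square algebra_simps)
    thus ?thesis by (rule power2_le_imp_le) simp
  qed
  hence "4 * 2 ^ ?m \<le> (sz l + sz r)\<^sup>2"
    using lr by (simp add: power2_eq_square algebra_simps)
  moreover have "ht (Nd l r) \<le> ?m + 2" using Nd.prems by auto
  hence "(2::nat) ^ ht (Nd l r) \<le> 2 ^ (?m + 2)" by (rule power_increasing) simp
  ultimately show ?case by simp
qed simp

lemma avl_ht_le_log: "avl t \<Longrightarrow> real (ht t) \<le> 2 * log 2 (real (sz t))"
proof -
  assume "avl t"
  from avl_sz_ge[OF this] have "real (2 ^ ht t) \<le> real (sz t ^ 2)" by (simp only: of_nat_le_iff)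
  hence "log 2 (2 ^ ht t) \<le> log 2 (real (sz t) ^ 2)" by (subst log_le_cancel_iff) simp_all
  thus ?thesis by (simp add: log_nat_power)
qed

text \<open>Rotations for a right subtree that is two levels too high. A left grandchild that is a
  leaf has height 0 and so never calls for the double rotation; the equation for a leaf on the right
  makes the function total.\<close>

fun bal_right :: "tree \<Rightarrow> tree \<Rightarrow> tree" where
  "bal_right l (Nd (Nd x y) rr) =
     (if ht (Nd x y) \<le> ht rr then Nd (Nd l (Nd x y)) rr else Nd (Nd l x) (Nd y rr))"
| "bal_right l (Nd (Lf x) rr) = Nd (Nd l (Lf x)) rr"
| "bal_right l (Lf x) = Nd l (Lf x)"

fun bal_left :: "tree \<Rightarrow> tree \<Rightarrow> tree" where
  "bal_left (Nd ll (Nd x y)) r =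
     (if ht (Nd x y) \<le> ht ll then Nd ll (Nd (Nd x y) r) else Nd (Nd ll x) (Nd y r))"
| "bal_left (Nd ll (Lf x)) r = Nd ll (Nd (Lf x) r)"
| "bal_left (Lf x) r = Nd (Lf x) r"

definition bal :: "tree \<Rightarrow> tree \<Rightarrow> tree" where
  "bal l r = (if ht l + 1 < ht r then bal_right l r
              else if ht r + 1 < ht l then bal_left l r else Nd l r)"

lemma leaves_bal [simp]: "leaves (bal l r) = leaves l @ leaves r"
proof -
  have "leaves (bal_right l r) = leaves l @ leaves r"
    by (induction l r rule: bal_right.induct) auto
  moreover have "leaves (bal_left l r) = leaves l @ leaves r"
    by (induction l r rule: bal_left.induct) auto
  ultimately show ?thesis by (simp add: bal_def)
qed

text \<open>The subtrees of \<open>r\<close> may be equally high; then the single rotation yields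
  height \<open>ht r + 1\<close>, in the other cases the height is that of \<open>r\<close>.\<close>

lemma bal_right_avl:
  assumes "avl l" "avl r" "ht r = ht l + 2"
  shows "avl (bal_right l r) \<and> ht r \<le> ht (bal_right l r) \<and>
      ht (bal_right l r) \<le> ht r + 1"
proof -
  obtain rl rr where r: "r = Nd rl rr" using assms(3) by (cases r) auto
  show ?thesis
  proof (cases "ht rl \<le> ht rr")
    case True
    hence "bal_right l r = Nd (Nd l rl) rr" using r by (cases rl) simp_all
    thus ?thesis using True assms r by auto
  next
    case False
    then obtain x y where rl: "rl = Nd x y" by (cases rl) auto
    have "bal_right l r = Nd (Nd l x) (Nd y rr)" using False r rl by simp
    moreover have "ht rl = ht l + 1" "ht rr = ht l" using False assms r by auto
    moreover have "ht x \<le> ht l" "ht y \<le> ht l" "ht l \<le> ht x + 1" "ht l \<le> ht y + 1"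
      using calculation(2) assms r rl by auto
    ultimately show ?thesis using assms r rl by auto
  qed
qed

lemma bal_left_avl:
  assumes "avl l" "avl r" "ht l = ht r + 2"
  shows "avl (bal_left l r) \<and> ht l \<le> ht (bal_left l r) \<and>
      ht (bal_left l r) \<le> ht l + 1"
proof -
  obtain ll lr where l: "l = Nd ll lr" using assms(3) by (cases l) auto
  show ?thesis
  proof (cases "ht lr \<le> ht ll")
    case True
    hence "bal_left l r = Nd ll (Nd lr r)" using l by (cases lr) simp_all
    thus ?thesis using True assms l by auto
  next
    case False
    then obtain x y where lr: "lr = Nd x y" by (cases lr) auto
    have "bal_left l r = Nd (Nd ll x) (Nd y r)" using False l lr by simp
    moreover have "ht lr = ht r + 1" "ht ll = ht r" using False assms l by auto
    moreover have "ht x \<le> ht r" "ht y \<le> ht r" "ht r \<le> ht x + 1" "ht r \<le> ht y + 1"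
      using calculation(2) assms l lr by auto
    ultimately show ?thesis using assms l lr by auto
  qed
qed

text \<open>A rotation may leave the larger height as it was, but a plain node always gains a level;
  \<open>join_avl\<close> needs the exact height in the second case for its lower bound.\<close>

lemma bal_avl:
  assumes "avl l" "avl r" "ht r \<le> ht l + 2" "ht l \<le> ht r + 2"
  shows "avl (bal l r)" "max (ht l) (ht r) \<le> ht (bal l r)"
      "ht (bal l r) \<le> max (ht l) (ht r) + 1"
    "ht r \<le> ht l + 1 \<Longrightarrow> ht l \<le> ht r + 1 \<Longrightarrow> ht (bal l r) =
        max (ht l) (ht r) + 1"
proof -
  consider "ht r = ht l + 2" | "ht l = ht r + 2" | "ht r \<le> ht l + 1" "ht l \<le> ht r + 1"
    using assms(3,4) by linarith
  hence "avl (bal l r) \<and> max (ht l) (ht r) \<le> ht (bal l r) \<and>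
      ht (bal l r) \<le> max (ht l) (ht r) + 1 \<and>
    (ht r \<le> ht l + 1 \<longrightarrow> ht l \<le> ht r + 1 \<longrightarrow> ht (bal l r) =
        max (ht l) (ht r) + 1)"
  proof cases
    case 1
    thus ?thesis using bal_right_avl[OF assms(1,2)] by (simp add: bal_def)
  next
    case 2
    thus ?thesis using bal_left_avl[OF assms(1,2)] by (simp add: bal_def)
  next
    case 3
    thus ?thesis using assms(1,2) by (auto simp: bal_def)
  qed
  thus "avl (bal l r)" "max (ht l) (ht r) \<le> ht (bal l r)"
      "ht (bal l r) \<le> max (ht l) (ht r) + 1"
    "ht r \<le> ht l + 1 \<Longrightarrow> ht l \<le> ht r + 1 \<Longrightarrow> ht (bal l r) =
        max (ht l) (ht r) + 1"
    by simp_all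
qed

text \<open>Descends along the inner spine of the higher tree. As the trees are leaf-oriented, no
  separating element is required. A tree that is higher by two is a node, so the \<open>Lf\<close>
  branches are never reached.\<close>

function join :: "tree \<Rightarrow> tree \<Rightarrow> tree" where
  "join l r =
     (if ht r + 1 < ht l then (case l of Nd a b \<Rightarrow> bal a (join b r) | Lf x
         \<Rightarrow> Nd l r)
      else if ht l + 1 < ht r then (case r of Nd a b \<Rightarrow> bal (join l a) b | Lf x
          \<Rightarrow> Nd l r)
      else Nd l r)"
  by pat_completeness auto
termination by (relation "measure (\<lambda>(l, r). size l + size r)") auto

declare join.simps [simp del]

lemma leaves_join [simp]: "leaves (join l r) = leaves l @ leaves r"
proof (induction l r rule: join.induct)
  case (1 l r)
  show ?case
    by (subst join.simps) (use 1 in \<open>cases l; cases r; simp\<close>)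
qed

lemma join_avl:
  "avl l \<Longrightarrow> avl r \<Longrightarrow>
     avl (join l r) \<and> max (ht l) (ht r) \<le> ht (join l r) \<and>
         ht (join l r) \<le> max (ht l) (ht r) + 1"
proof (induction l r rule: join.induct)
  case (1 l r)
  consider "ht r + 1 < ht l" | "ht l + 1 < ht r" | "ht l \<le> ht r + 1" "ht r \<le> ht l + 1"
    by linarith
  then show ?case
  proof cases
    case 1
    then obtain a b where l: "l = Nd a b" by (cases l) auto
    have IH: "avl (join b r)" "max (ht b) (ht r) \<le> ht (join b r)"
      "ht (join b r) \<le> max (ht b) (ht r) + 1"
      using "1.IH"(1)[OF 1 l] "1.prems" l by auto
    have j: "join l r = bal a (join b r)" using 1 l by (subst join.simps) simp
    have "ht (join b r) \<le> ht a + 2" "ht a \<le> ht (join b r) + 2"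
      using IH 1 l "1.prems" by auto
    note B = bal_avl[OF _ IH(1) this]
    have a: "avl a" "ht a \<le> ht b + 1" "ht b \<le> ht a + 1" "ht l = 1 + max (ht a) (ht b)"
      using "1.prems" l by auto
    \<comment> \<open>Without a rotation the height is exactly one above the higher child. A
      rotation is possible only if \<open>join b r\<close> is two levels above \<open>a\<close>, and
      then \<open>b\<close> was already the higher child of \<open>l\<close>.\<close>
    have "ht l \<le> ht (bal a (join b r)) \<and> ht (bal a (join b r)) \<le> ht l + 1"
    proof (cases "ht (join b r) \<le> ht a + 1 \<and> ht a \<le> ht (join b r) + 1")
      case True
      hence "ht (bal a (join b r)) = max (ht a) (ht (join b r)) + 1" using B(4) a(1) by blast
      thus ?thesis using IH 1 a by linarith
    next
      case False
      thus ?thesis using B(2,3)[OF a(1)] IH 1 a by linarith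
    qed
    thus ?thesis unfolding j using B(1)[OF a(1)] 1 by simp
  next
    case 2
    then obtain a b where r: "r = Nd a b" by (cases r) auto
    have n: "\<not> ht r + 1 < ht l" using 2 by simp
    have IH: "avl (join l a)" "max (ht l) (ht a) \<le> ht (join l a)"
      "ht (join l a) \<le> max (ht l) (ht a) + 1"
      using "1.IH"(2)[OF n 2 r] "1.prems" r by auto
    have j: "join l r = bal (join l a) b" using 2 r by (subst join.simps) simp
    have "ht b \<le> ht (join l a) + 2" "ht (join l a) \<le> ht b + 2"
      using IH 2 r "1.prems" by auto
    note B = bal_avl[OF IH(1) _ this]
    have a: "avl b" "ht a \<le> ht b + 1" "ht b \<le> ht a + 1" "ht r = 1 + max (ht a) (ht b)"
      using "1.prems" r by auto
    have "ht r \<le> ht (bal (join l a) b) \<and> ht (bal (join l a) b) \<le> ht r + 1"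
    proof (cases "ht (join l a) \<le> ht b + 1 \<and> ht b \<le> ht (join l a) + 1")
      case True
      hence "ht (bal (join l a) b) = max (ht (join l a)) (ht b) + 1" using B(4) a(1) by blast
      thus ?thesis using IH 2 a by linarith
    next
      case False
      thus ?thesis using B(2,3)[OF a(1)] IH 2 a by linarith
    qed
    thus ?thesis unfolding j using B(1)[OF a(1)] 2 by simp
  next
    case 3
    have "join l r = Nd l r" using 3 by (subst join.simps) simp
    thus ?thesis using 3 "1.prems" by auto
  qed
qed

text \<open>Intended for a predicate that holds on a suffix of the leaves containing the last one.
  The right part is then nonempty, and only the left part is optional.\<close>

fun split :: "(elem \<Rightarrow> bool) \<Rightarrow> tree \<Rightarrow> tree option \<times>
    tree" where
  "split Q (Lf x) = (None, Lf x)"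
| "split Q (Nd l r) =
     (if Q (tlast l) then (fst (split Q l), join (snd (split Q l)) r)
      else (Some (case fst (split Q r) of None \<Rightarrow> l | Some a \<Rightarrow> join l a),
          snd (split Q r)))"

fun oleaves :: "tree option \<Rightarrow> elem list" where
  "oleaves None = []"
| "oleaves (Some t) = leaves t"

lemma split_leaves:
  assumes "sorted_wrt (\<lambda>x y. Q x \<longrightarrow> Q y) (leaves t)" "Q (tlast t)"
  shows "oleaves (fst (split Q t)) = filter (\<lambda>x. \<not> Q x) (leaves t) \<and>
         leaves (snd (split Q t)) = filter Q (leaves t)"
  using assms
proof (induction t)
  case (Nd l r)
  show ?case
  proof (cases "Q (tlast l)")
    case True
    have "\<forall>y\<in>set (leaves r). Q y"
      using Nd.prems(1) True tlast_in_leaves[of l] by (auto simp: sorted_wrt_append)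
    thus ?thesis using Nd True by (auto simp: sorted_wrt_append filter_empty_conv)
  next
    case False
    have "\<forall>y\<in>set (leaves l). \<not> Q y"
    proof
      fix y assume y: "y \<in> set (leaves l)"
      have "leaves l = butlast (leaves l) @ [tlast l]" by (simp add: tlast_eq_last)
      hence "sorted_wrt (\<lambda>x y. Q x \<longrightarrow> Q y) (butlast (leaves l) @ [tlast l])"
        "y \<in> set (butlast (leaves l) @ [tlast l])"
        using Nd.prems(1) y by (auto simp: sorted_wrt_append)
      thus "\<not> Q y" using False by (auto simp: sorted_wrt_append)
    qed
    hence f: "filter (\<lambda>x. \<not> Q x) (leaves l) = leaves l" "filter Q (leaves l) = []"
      by (auto simp: filter_id_conv filter_empty_conv)
    have "oleaves (fst (split Q r)) = filter (\<lambda>x. \<not> Q x) (leaves r) \<and>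
         leaves (snd (split Q r)) = filter Q (leaves r)"
      using Nd by (auto simp: sorted_wrt_append)
    thus ?thesis using False f by (auto split: option.split)
  qed
qed simp

lemma split_avl:
  "avl t \<Longrightarrow> avl (snd (split Q t)) \<and> ht (snd (split Q t)) \<le> ht t \<and>
     (\<forall>a. fst (split Q t) = Some a \<longrightarrow> avl a \<and> ht a \<le> ht t)"
proof (induction t)
  case (Nd l r)
  have A: "avl (join l a) \<and> ht (join l a) \<le> ht (Nd l r)" if "avl a" "ht a \<le> ht r" for a
    using join_avl[of l a] that Nd.prems by auto
  have B: "avl (join b r) \<and> ht (join b r) \<le> ht (Nd l r)" if "avl b" "ht b \<le> ht l" for b
    using join_avl[of b r] that Nd.prems by auto
  have lr: "avl l" "avl r" "ht l \<le> ht (Nd l r)" "ht r \<le> ht (Nd l r)"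
    using Nd.prems by auto
  show ?case
  proof (cases "Q (tlast l)")
    case True
    have "ht a \<le> ht (Nd l r)" if "fst (split Q l) = Some a" for a
      using Nd.IH(1)[OF lr(1)] that lr(3) by (meson order_trans)
    thus ?thesis using True Nd.IH(1)[OF lr(1)] B[of "snd (split Q l)"] by (simp del: ht.simps)
  next
    case False
    have "ht (snd (split Q r)) \<le> ht (Nd l r)"
      using Nd.IH(2)[OF lr(2)] lr(4) by (meson order_trans)
    thus ?thesis using False Nd.IH(2)[OF lr(2)] A lr
      by (cases "fst (split Q r)") (simp_all del: ht.simps)
  qed
qed simp

text \<open>The absolute difference of the heights plus one; truncated subtraction makes one of the
  differences vanish.\<close>

fun join_cost :: "tree \<Rightarrow> tree \<Rightarrow> nat" where
  "join_cost l r = (ht l - ht r) + (ht r - ht l) + 1"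

fun split_cost :: "(elem \<Rightarrow> bool) \<Rightarrow> tree \<Rightarrow> nat" where
  "split_cost Q (Lf x) = 1"
| "split_cost Q (Nd l r) = 1 +
     (if Q (tlast l) then split_cost Q l + join_cost (snd (split Q l)) r
      else split_cost Q r + (case fst (split Q r) of None \<Rightarrow> 0 | Some a \<Rightarrow>
          join_cost l a))"

fun oht :: "tree option \<Rightarrow> nat" where
  "oht None = 0"
| "oht (Some t) = ht t"

text \<open>The joins along a search path telescope: each join costs about the growth in height of
  the part it is applied to.\<close>

lemma split_cost_le':
  "avl t \<Longrightarrow> split_cost Q t \<le> 1 + 3 * ht t + oht (fst (split Q t)) + ht (snd
      (split Q t))"
proof (induction t)
  case (Nd l r)
  show ?case
  proof (cases "Q (tlast l)")
    case True
    let ?b = "snd (split Q l)"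
    \<comment> \<open>As \<open>?b\<close> is at most one level higher than \<open>r\<close>, adding
      the cost of the join to \<open>ht ?b\<close> exceeds the larger of the two heights by at most
      2. Together with the visit of the node this uses up the three units that one level
      provides.\<close>
    have "avl ?b" "ht ?b \<le> ht l" using split_avl[of l Q] Nd.prems by auto
    moreover from this have "max (ht ?b) (ht r) \<le> ht (join ?b r)"
      using join_avl[of ?b r] Nd.prems by auto
    ultimately show ?thesis using Nd True by (auto simp: max_def split: if_splits)
  next
    case False
    show ?thesis
    proof (cases "fst (split Q r)")
      case None
      thus ?thesis using Nd False by (auto simp: max_def split: if_splits)
    next
      case (Some a)
      have "avl a" "ht a \<le> ht r" using split_avl[of r Q] Nd.prems Some by auto
      moreover from this have "max (ht l) (ht a) \<le> ht (join l a)"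
        using join_avl[of l a] Nd.prems by auto
      ultimately show ?thesis using Nd False Some by (auto simp: max_def split: if_splits)
    qed
  qed
qed simp

lemma split_cost_le: "avl t \<Longrightarrow> split_cost Q t \<le> 1 + 5 * ht t"
  using split_cost_le'[of t Q] split_avl[of t Q] by (cases "fst (split Q t)") auto

section \<open>Stacks of blocks\<close>

definition W :: "elem list \<Rightarrow> real" where
  "W xs = (\<Sum>x\<leftarrow>xs. 1 / real (lv x))"

lemma W_simps [simp]: "W [] = 0" "W (x # xs) = 1 / real (lv x) + W xs" "W (xs @ ys) = W xs + W ys"
  by (simp_all add: W_def)

lemma W_nonneg: "0 \<le> W xs"
  by (induction xs) auto

lemma W_filter: "W (filter Q xs) + W (filter (\<lambda>x. \<not> Q x) xs) = W xs"
  by (induction xs) auto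

lemma W_ge:
  assumes "\<forall>x\<in>set xs. 1 \<le> lv x \<and> lv x \<le> B"
  shows "real (length xs) / real B \<le> W xs"
  using assms
proof (induction xs)
  case (Cons x xs)
  have "1 / real B \<le> 1 / real (lv x)" using Cons.prems by (intro divide_left_mono) auto
  thus ?case using Cons by (simp add: add_divide_distrib)
qed simp

definition tree_ok :: "nat \<Rightarrow> tree \<Rightarrow> bool" where
  "tree_ok B t \<longleftrightarrow> avl t \<and> sz t \<le> B \<and>
      (\<forall>x\<in>set (leaves t). 1 \<le> lv x \<and> lv x \<le> B)"

text \<open>Stated by weight and not by size, so that it is independent of \<open>B\<close>: it
  survives a growing \<open>B\<close> and also any merge that enlarges one of the blocks.\<close>

definition heavy :: "tree \<Rightarrow> tree \<Rightarrow> bool" where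
  "heavy b c \<longleftrightarrow> 1 \<le> W (leaves b) + W (leaves c)"

lemma heavy_sym: "heavy b c \<longleftrightarrow> heavy c b"
  by (simp add: heavy_def add.commute)

lemma successively_heavy_flip [simp]:
  "successively (\<lambda>x y. heavy y x) ts \<longleftrightarrow> successively heavy ts"
  using heavy_sym by (intro successively_cong) auto

text \<open>Each leaf has \<open>lv\<close> at most \<open>B\<close> and therefore weighs at least
  \<open>1 / B\<close>.\<close>

lemma heavyI_size:
  assumes "tree_ok B b" "tree_ok B c" "B < sz b + sz c"
  shows "heavy b c"
proof -
  have "0 < B" using assms(1) sz_pos[of b] unfolding tree_ok_def by linarith
  have "1 \<le> real (sz b + sz c) / real B" using assms(3) \<open>0 < B\<close> by simp
  also have "\<dots> \<le> W (leaves b @ leaves c)"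
    using W_ge[of "leaves b @ leaves c" B] assms(1,2) by (auto simp: tree_ok_def)
  finally show ?thesis by (simp add: heavy_def)
qed

text \<open>A stack lists its blocks from the end of the represented list to its front.\<close>

definition stk_ok :: "nat \<Rightarrow> tree list \<Rightarrow> bool" where
  "stk_ok B bs \<longleftrightarrow> (\<forall>b\<in>set bs. tree_ok B b) \<and>
      successively heavy bs"

definition els :: "tree list \<Rightarrow> elem list" where
  "els bs = concat (map leaves (rev bs))"

lemma els_simps [simp]: "els [] = []" "els (b # bs) = els bs @ leaves b"
  by (simp_all add: els_def)

lemma els_append: "els (as @ bs) = els bs @ els as"
  by (simp add: els_def)

lemma els_Nil_iff [simp]: "els bs = [] \<longleftrightarrow> bs = []"
  by (cases bs) auto

lemma last_els: "bs \<noteq> [] \<Longrightarrow> last (els bs) = tlast (hd bs)"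
  by (cases bs) (auto simp: tlast_eq_last)

lemma stk_ok_Nil [simp]: "stk_ok B []"
  by (simp add: stk_ok_def)

lemma stk_ok_Cons:
  "stk_ok B (b # bs) \<longleftrightarrow> tree_ok B b \<and> stk_ok B bs \<and>
      (bs = [] \<or> heavy b (hd bs))"
  by (cases bs) (auto simp: stk_ok_def)

lemma tree_ok_mono: "tree_ok B t \<Longrightarrow> B \<le> B' \<Longrightarrow> tree_ok B' t"
  by (fastforce simp: tree_ok_def)

lemma stk_ok_mono: "stk_ok B bs \<Longrightarrow> B \<le> B' \<Longrightarrow> stk_ok B' bs"
  by (auto simp: stk_ok_def intro: tree_ok_mono)

fun mh :: "tree list \<Rightarrow> nat" where
  "mh [] = 0"
| "mh (b # bs) = max (ht b) (mh bs)"

lemma mh_append [simp]: "mh (as @ bs) = max (mh as) (mh bs)"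
  by (induction as) auto

lemma mh_rev [simp]: "mh (rev bs) = mh bs"
  by (induction bs) auto

text \<open>The factor 2 is the one of \<open>avl_ht_le_log\<close>; \<open>max 1\<close> makes the
  bound 0 for an empty list.\<close>

definition ht_bound :: "nat \<Rightarrow> nat \<Rightarrow> real" where
  "ht_bound B n = 2 * log 2 (real (max 1 (min B n)))"

lemma ht_bound_mono: "n \<le> n' \<Longrightarrow> ht_bound B n \<le> ht_bound B n'"
  by (auto simp: ht_bound_def)

lemma ht_bound_nonneg: "0 \<le> ht_bound B n"
  by (auto simp: ht_bound_def)

lemma mh_le_ht_bound: "stk_ok B bs \<Longrightarrow>
    real (mh bs) \<le> ht_bound B (length (els bs))"
proof (induction bs)
  case Nil
  show ?case by (simp add: ht_bound_nonneg)
next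
  case (Cons b bs)
  have b: "avl b" "sz b \<le> B" using Cons.prems by (auto simp: stk_ok_Cons tree_ok_def)
  have "real (ht b) \<le> 2 * log 2 (real (sz b))" using avl_ht_le_log[OF b(1)] .
  also have "\<dots> \<le> ht_bound B (length (els (b # bs)))"
    using b(2) sz_pos[of b] by (auto simp: ht_bound_def)
  finally have "real (ht b) \<le> ht_bound B (length (els (b # bs)))" .
  moreover have "real (mh bs) \<le> ht_bound B (length (els (b # bs)))"
    using Cons order_trans[OF _ ht_bound_mono[of "length (els bs)" "length (els (b # bs))" B]]
    by (auto simp: stk_ok_Cons)
  ultimately show ?case by simp
qed

definition pushm :: "nat \<Rightarrow> tree \<Rightarrow> tree list \<Rightarrow> tree list" where
  "pushm B b bs = (case bs of [] \<Rightarrow> [b] |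
     c # cs \<Rightarrow> if B < sz c + sz b then b # c # cs else join c b # cs)"

lemma pushm_not_Nil [simp]: "pushm B b bs \<noteq> []"
  by (auto simp: pushm_def split: list.split)

lemma els_pushm [simp]: "els (pushm B b bs) = els bs @ leaves b"
  by (auto simp: pushm_def split: list.split)

text \<open>A merge never makes the top block lighter, so a block that is heavy together with
  \<open>b\<close> is also heavy on top of the resulting stack.\<close>

lemma pushm_hd_W: "W (leaves b) \<le> W (leaves (hd (pushm B b bs)))"
  by (auto simp: pushm_def W_nonneg split: list.split)

text \<open>Either both blocks together exceed \<open>B\<close> leaves and are heavy by size, or
  they fit into one block, which weighs at least as much as \<open>c\<close> and hence stays heavy
  with the block below.\<close>

lemma pushm_ok:
  assumes "stk_ok B bs" "tree_ok B b"
  shows "stk_ok B (pushm B b bs)"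
proof (cases bs)
  case Nil
  thus ?thesis using assms by (simp add: pushm_def stk_ok_Cons)
next
  case (Cons c cs)
  have c: "tree_ok B c" "stk_ok B cs" "cs = [] \<or> heavy c (hd cs)"
    using assms(1) Cons by (auto simp: stk_ok_Cons)
  show ?thesis
  proof (cases "B < sz c + sz b")
    case True
    hence "heavy b c" using heavyI_size[OF assms(2) c(1)] by simp
    thus ?thesis using True Cons assms by (simp add: pushm_def stk_ok_Cons)
  next
    case False
    have "tree_ok B (join c b)"
      using c(1) assms(2) False join_avl[of c b] by (auto simp: tree_ok_def)
    moreover have "cs = [] \<or> heavy (join c b) (hd cs)"
      using c(3) W_nonneg[of "leaves b"] by (auto simp: heavy_def)
    ultimately show ?thesis using False Cons c(2) by (simp add: pushm_def stk_ok_Cons)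
  qed
qed

text \<open>Moves a sequence of blocks, given front first,
    onto a stack.  Only the two pairs of blocks
  that become adjacent can be light, so only the first two pushes have to merge.\<close>

fun transfer :: "nat \<Rightarrow> tree list \<Rightarrow> tree list \<Rightarrow> tree list" where
  "transfer B [] X = X"
| "transfer B [b] X = pushm B b X"
| "transfer B (b # c # us) X = rev us @ pushm B c (pushm B b X)"

lemma transfer_Nil_iff: "transfer B ts X = [] \<longleftrightarrow> ts = [] \<and> X = []"
  by (induction B ts X rule: transfer.induct) auto

lemma els_transfer [simp]: "els (transfer B ts X) = els X @ concat (map leaves ts)"
  by (induction B ts X rule: transfer.induct) (auto simp: els_append els_def[of "rev _"])

lemma transfer_ok:
  assumes "stk_ok B X" "\<forall>t\<in>set ts. tree_ok B t" "successively heavy (tl ts)"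
  shows "stk_ok B (transfer B ts X)"
  using assms
proof (induction B ts X rule: transfer.induct)
  case (3 B b c us X)
  let ?Y = "pushm B c (pushm B b X)"
  have Y: "stk_ok B ?Y" using 3 by (auto intro!: pushm_ok)
  have "us = [] \<or> heavy (hd us) (hd ?Y)"
    using 3(3) pushm_hd_W[of c B "pushm B b X"]
    by (cases us) (auto simp: heavy_def)
  hence "successively heavy (rev us @ ?Y)"
    using Y 3(3) by (cases us) (auto simp: successively_append_iff stk_ok_def last_rev simp del:
        rev.simps)
  thus ?case using Y 3(2) by (auto simp: stk_ok_def)
qed (auto intro: pushm_ok)

text \<open>Buffers are stored newest first, so the first half becomes the right subtree; this is
  also the order in which the machine consumes the buffer.\<close>

function bld :: "elem list \<Rightarrow> tree" where
  "bld ps = (if length ps \<le> 1 then Lf (hd ps)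
     else Nd (bld (drop (length ps div 2) ps)) (bld (take (length ps div 2) ps)))"
  by pat_completeness auto
termination by (relation "measure length") auto

declare bld.simps [simp del]

lemma leaves_bld: "ps \<noteq> [] \<Longrightarrow> leaves (bld ps) = rev ps"
proof (induction ps rule: bld.induct)
  case (1 ps)
  show ?case
  proof (cases "length ps \<le> 1")
    case True
    with 1(3) obtain x where "ps = [x]" by (cases ps) auto
    thus ?thesis by (simp add: bld.simps)
  next
    case False
    let ?k = "length ps div 2"
    have ne: "drop ?k ps \<noteq> []" "take ?k ps \<noteq> []" using False by auto
    have "leaves (bld ps) = rev (drop ?k ps) @ rev (take ?k ps)"
      using 1(1,2)[OF False] ne False by (subst bld.simps) simp
    also have "\<dots> = rev ps" by (metis append_take_drop_id rev_append)
    finally show ?thesis .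
  qed
qed

text \<open>With \<open>ht_bld_gt\<close> this determines the height as the logarithm of the length,
  rounded up.\<close>

lemma ht_bld_le: "length ps \<le> 2 ^ h \<Longrightarrow> ht (bld ps) \<le> h"
proof (induction ps arbitrary: h rule: bld.induct)
  case (1 ps)
  show ?case
  proof (cases "length ps \<le> 1")
    case True
    thus ?thesis by (simp add: bld.simps)
  next
    case False
    then obtain h' where h: "h = Suc h'" using 1(3) by (cases h) auto
    have "ht (bld (drop (length ps div 2) ps)) \<le> h'"
        "ht (bld (take (length ps div 2) ps)) \<le> h'"
      using 1(1,2)[OF False, of h'] 1(3) h by auto
    thus ?thesis using False h by (subst bld.simps) simp
  qed
qed

lemma ht_bld_gt: "2 ^ h < length ps \<Longrightarrow> h < ht (bld ps)"
proof (induction ps arbitrary: h rule: bld.induct)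
  case (1 ps)
  have n: "\<not> length ps \<le> 1" using 1(3) one_le_power[of "2::nat" h] by linarith
  show ?case
  proof (cases h)
    case 0
    thus ?thesis using n by (subst bld.simps) simp
  next
    case (Suc h')
    have "h' < ht (bld (drop (length ps div 2) ps))"
      using 1(1)[OF n, of h'] 1(3) Suc by auto
    thus ?thesis using n Suc by (subst bld.simps) auto
  qed
qed

text \<open>The halves differ in length by at most one and
  \<open>2 ^ h + 1 \<le> 2 ^ (h + 1)\<close>, so their rounded logarithms differ by at most
  one.\<close>

lemma avl_bld: "avl (bld ps)"
proof (induction ps rule: bld.induct)
  case (1 ps)
  show ?case
  proof (cases "length ps \<le> 1")
    case True
    thus ?thesis by (simp add: bld.simps)
  next
    case False
    let ?l = "drop (length ps div 2) ps" and ?r = "take (length ps div 2) ps"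
    have len: "length ?r \<le> length ?l" "length ?l \<le> length ?r + 1" "length ?r \<ge> 1"
      using False by auto
    have "length ?r \<le> 2 ^ ht (bld ?r)" using ht_bld_gt[of "ht (bld ?r)" ?r]
        by (meson less_irrefl not_le)
    moreover have "(1::nat) \<le> 2 ^ ht (bld ?r)" by simp
    ultimately have "length ?l \<le> 2 ^ (ht (bld ?r) + 1)" using len by simp
    hence "ht (bld ?l) \<le> ht (bld ?r) + 1" by (rule ht_bld_le)
    moreover have "length ?l \<le> 2 ^ ht (bld ?l)"
      using ht_bld_gt[of "ht (bld ?l)" ?l] by (meson less_irrefl not_le)
    hence "ht (bld ?r) \<le> ht (bld ?l)" using len by (intro ht_bld_le) linarith
    ultimately show ?thesis using 1(1,2)[OF False] False by (subst bld.simps) simp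
  qed
qed

text \<open>The accumulator reverses the order: the oldest elements end up in the head of the
  result, the only block that can be short, and \<open>transfer\<close> tolerates lightness exactly
  there. The test for \<open>B = 0\<close> ensures termination.\<close>

function chunks :: "nat \<Rightarrow> elem list \<Rightarrow> tree list \<Rightarrow> tree list"
    where
  "chunks B ps ts = (if ps = [] \<or> B = 0 then ts
     else chunks B (drop (min B (length ps)) ps) (bld (take (min B (length ps)) ps) # ts))"
  by pat_completeness auto
termination by (relation "measure (\<lambda>(B, ps, ts). length ps)") auto

declare chunks.simps [simp del]

lemma chunks_leaves:
  "0 < B \<Longrightarrow> concat (map leaves (chunks B ps ts)) = rev ps @ concat (map leaves ts)"
proof (induction B ps ts rule: chunks.induct)
  case (1 B ps ts)
  show ?case
  proof (cases "ps = []")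
    case True
    thus ?thesis by (subst chunks.simps) simp
  next
    case False
    let ?k = "min B (length ps)"
    have t: "take ?k ps \<noteq> []" using False 1(2) by simp
    have "rev ps = rev (drop ?k ps) @ rev (take ?k ps)" by (metis append_take_drop_id rev_append)
    thus ?thesis using 1 False leaves_bld[OF t] by (subst chunks.simps) simp
  qed
qed

lemma chunks_length: "0 < B \<Longrightarrow> length (chunks B ps ts) \<le> length ps + length ts"
proof (induction B ps ts rule: chunks.induct)
  case (1 B ps ts)
  show ?case
  proof (cases "ps = []")
    case True
    thus ?thesis by (subst chunks.simps) simp
  next
    case False
    let ?k = "min B (length ps)"
    have "length (chunks B ps ts) \<le> length (drop ?k ps) + Suc (length ts)"
      using 1 False by (subst chunks.simps) simp
    also have "\<dots> \<le> length ps + length ts" using False 1(2) by (cases ps) auto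
    finally show ?thesis .
  qed
qed

lemma chunks_ok:
  assumes "0 < B" "\<forall>x\<in>set ps. 1 \<le> lv x \<and> lv x \<le> B"
    "\<forall>t\<in>set ts. tree_ok B t \<and> sz t = B"
  shows "(\<forall>t\<in>set (chunks B ps ts). tree_ok B t) \<and>
      (\<forall>t\<in>set (tl (chunks B ps ts)). sz t = B)"
  using assms
proof (induction B ps ts rule: chunks.induct)
  case (1 B ps ts)
  show ?case
  proof (cases "ps = []")
    case True
    hence "chunks B ps ts = ts" by (subst chunks.simps) simp
    thus ?thesis using 1 by (cases ts) auto
  next
    case False
    let ?k = "min B (length ps)" and ?t = "bld (take (min B (length ps)) ps)"
    have l: "leaves ?t = rev (take ?k ps)" using False 1(2) by (intro leaves_bld) simp
    have t: "tree_ok B ?t" using l 1(3) avl_bld by (auto simp: tree_ok_def dest: in_set_takeD)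
    have c: "chunks B ps ts = chunks B (drop ?k ps) (?t # ts)"
      using False 1(2) by (subst chunks.simps) simp
    show ?thesis
    proof (cases "B \<le> length ps")
      case True
      hence "sz ?t = B" using l by simp
      thus ?thesis unfolding c using 1 False t by (auto dest: in_set_dropD)
    next
      case f: False
      hence "chunks B (drop ?k ps) (?t # ts) = ?t # ts" by (subst chunks.simps) simp
      thus ?thesis unfolding c using t 1 by simp
    qed
  qed
qed

section \<open>Lists with a buffer of pending appends\<close>

type_synonym lst = "tree list \<times> elem list"

text \<open>The second component is the buffer, newest element first, so that an append is a single
  cons.\<close>

definition elems :: "lst \<Rightarrow> elem list" where
  "elems C = els (fst C) @ rev (snd C)"

definition lst_ok :: "nat \<Rightarrow> lst \<Rightarrow> bool" where
  "lst_ok B C \<longleftrightarrow> stk_ok B (fst C) \<and>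
      (\<forall>x\<in>set (snd C). 1 \<le> lv x \<and> lv x \<le> B)"

lemma lst_ok_mono: "lst_ok B C \<Longrightarrow> B \<le> B' \<Longrightarrow> lst_ok B' C"
  by (fastforce simp: lst_ok_def intro: stk_ok_mono)

definition flush :: "nat \<Rightarrow> lst \<Rightarrow> tree list" where
  "flush B C = transfer B (chunks B (snd C) []) (fst C)"

lemma els_flush: "0 < B \<Longrightarrow> els (flush B C) = elems C"
  by (simp add: flush_def elems_def chunks_leaves)

lemma flush_ok:
  assumes "lst_ok B C" "0 < B"
  shows "stk_ok B (flush B C)"
proof -
  let ?ts = "chunks B (snd C) []"
  have c: "\<forall>t\<in>set ?ts. tree_ok B t" "\<forall>t\<in>set (tl ?ts). sz t = B"
    using chunks_ok[of B "snd C" "[]"] assms by (auto simp: lst_ok_def)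
  have "heavy b c" if "b \<in> set (tl ?ts)" "c \<in> set (tl ?ts)" for b c
  proof (rule heavyI_size)
    show "tree_ok B b" "tree_ok B c" using c(1) that by (auto dest: list.set_sel(2)[rotated])
    show "B < sz b + sz c" using c(2) that assms(2) by simp
  qed
  hence "successively heavy (tl ?ts)" by (auto simp: successively_conv_nth)
  thus ?thesis unfolding flush_def using c(1) assms(1)
      by (intro transfer_ok) (auto simp: lst_ok_def)
qed

lemma mh_pushm: "(\<forall>c\<in>set bs. avl c) \<Longrightarrow>
    avl b \<Longrightarrow> max (ht b) (mh bs) \<le> mh (pushm B b bs)"
  using join_avl[of "hd bs" b] by (cases bs) (auto simp: pushm_def)

text \<open>Joins do not lower the maximal height. The cost of a flush, incurred in the heights of
  its inputs, can thus be charged to the height of its result.\<close>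

lemma mh_transfer:
  "(\<forall>c\<in>set X. avl c) \<Longrightarrow>
      (\<forall>c\<in>set ts. avl c) \<Longrightarrow>
      max (mh ts) (mh X) \<le> mh (transfer B ts X)"
proof (induction B ts X rule: transfer.induct)
  case (3 B b c us X)
  have a: "\<forall>c\<in>set (pushm B b X). avl c"
    using 3 join_avl[of "hd X" b] by (cases X) (auto simp: pushm_def)
  show ?case using mh_pushm[of X b B] mh_pushm[OF a, of c B] 3
      by (auto simp: max_def split: if_splits)
next
  case (2 B b X)
  thus ?case using mh_pushm[of X b B] by auto
qed auto

text \<open>Here \<open>p\<close> is the position of the first element removed from the preceding
  list and \<open>vo\<close> the last element kept there. An element before \<open>p\<close> has its
  supporter among the kept ones. Behind \<open>p\<close> all kept elements come earlier, and the
  last of them has the smallest key, so comparing with it alone decides whether support is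
  left.\<close>

definition cutp :: "nat \<Rightarrow> elem option \<Rightarrow> elem \<Rightarrow> bool" where
  "cutp p vo x \<longleftrightarrow> p < pos x \<and>
      (case vo of None \<Rightarrow> True | Some v \<Rightarrow> key x \<le> key v)"

definition dec :: "elem list \<Rightarrow> bool" where
  "dec xs \<longleftrightarrow> sorted_wrt (\<lambda>x y. pos x < pos y \<and>
      key y \<le> key x) xs"

text \<open>Along a decreasing list positions grow and keys fall, and both changes favour
  \<open>cutp\<close>; the elements to be cut therefore form a suffix.\<close>

lemma dec_cutp: "dec xs \<Longrightarrow> sorted_wrt (\<lambda>x y. cutp p vo x \<longrightarrow>
    cutp p vo y) xs"
  unfolding dec_def by (erule sorted_wrt_mono_rel[rotated]) (auto simp: cutp_def split:
      option.split)

text \<open>A block is popped when its last leaf is to be cut. Only the deepest popped block can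
  contain elements of both kinds; it is the one that is split, and its right part heads the
  result.\<close>

definition cut :: "nat \<Rightarrow> (elem \<Rightarrow> bool) \<Rightarrow> tree list
    \<Rightarrow> tree list \<times> tree list" where
  "cut B Q bs = (let T = rev (takeWhile (\<lambda>b. Q (tlast b)) bs);
                     rest = dropWhile (\<lambda>b. Q (tlast b)) bs
     in if T = [] then (bs, [])
        else (case fst (split Q (hd T)) of None \<Rightarrow> rest | Some l \<Rightarrow> pushm B
            l rest,
              snd (split Q (hd T)) # tl T))"

text \<open>Disjoint pairs of neighbours weigh at least 1 each, and at most one block remains
  unpaired.\<close>

lemma heavy_length:
  assumes "successively heavy ts"
  shows "real (length ts) \<le> 1 + 2 * W (concat (map leaves ts))"
  using assms
proof (induction ts rule: induct_list012)
  case (3 x y zs)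
  have "real (length zs) \<le> 1 + 2 * W (concat (map leaves zs))"
    using 3 by (auto simp: successively_Cons)
  moreover have "1 \<le> W (leaves x) + W (leaves y)" using 3(3) by (simp add: heavy_def)
  ultimately show ?case by simp
qed (auto simp: W_nonneg)

lemma cut_ok:
  assumes "stk_ok B bs" "sorted_wrt (\<lambda>x y. Q x \<longrightarrow>
      Q y) (els bs)" "cut B Q bs = (P, T)"
  shows "stk_ok B P" "\<forall>t\<in>set T. tree_ok B t" "successively heavy (tl T)"
    "els P = filter (\<lambda>x. \<not> Q x) (els bs)" "concat (map leaves T) = filter Q (els bs)"
    "real (length T) \<le> 2 + 2 * W (filter Q (els bs))"
proof -
  define T0 where "T0 = takeWhile (\<lambda>b. Q (tlast b)) bs"
  define rest where "rest = dropWhile (\<lambda>b. Q (tlast b)) bs"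
  have bs: "bs = T0 @ rest" by (simp add: T0_def rest_def)
  have ok: "stk_ok B rest" "\<forall>b\<in>set T0. tree_ok B b" "successively heavy T0"
    using assms(1) unfolding bs by (auto simp: stk_ok_def successively_append_iff)
  have el: "els bs = els rest @ els T0" by (simp add: bs els_append)
  have rest: "\<forall>x\<in>set (els rest). \<not> Q x"
  proof (cases rest)
    case (Cons b cs)
    have "\<not> Q (tlast b)" using Cons hd_dropWhile[of "\<lambda>b. Q (tlast b)" bs]
        by (simp add: rest_def)
    moreover have "els rest = butlast (els rest) @ [tlast b]"
      using last_els[of rest] Cons by (metis append_butlast_last_id els_Nil_iff list.discI
          list.sel(1))
    moreover have "sorted_wrt (\<lambda>x y. Q x \<longrightarrow> Q y) (els rest)"
      using assms(2) unfolding el sorted_wrt_append by blast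
    ultimately show ?thesis
      by (metis (no_types, lifting) Un_iff list.set_intros(1) set_ConsD set_append
          sorted_wrt_append empty_iff list.set(1))
  qed simp
  have "stk_ok B P \<and> (\<forall>t\<in>set T. tree_ok B t) \<and>
      successively heavy (tl T) \<and>
    els P = filter (\<lambda>x. \<not> Q x) (els bs) \<and>
        concat (map leaves T) = filter Q (els bs)"
  proof (cases "T0 = []")
    case True
    hence "P = bs" "T = []" using assms(3) by (auto simp: cut_def T0_def[symmetric])
    moreover have "bs = rest" using bs True by simp
    ultimately show ?thesis using rest ok
        by (auto simp: filter_empty_conv intro!: filter_True[symmetric])
  next
    case False
    then obtain ts b where T0: "T0 = ts @ [b]" by (metis append_butlast_last_id)
    have P: "P = (case fst (split Q b) of None \<Rightarrow> rest | Some l \<Rightarrow> pushm B l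
        rest)"
      and T: "T = snd (split Q b) # rev ts"
      using assms(3) by (auto simp: cut_def T0_def[symmetric] rest_def[symmetric] T0)
    have el': "els bs = els rest @ leaves b @ els ts" by (simp add: el T0 els_append)
    have b: "tree_ok B b" using ok(2) T0 by simp
    have Qb: "Q (tlast b)" using T0 set_takeWhileD[of b "\<lambda>b. Q (tlast b)" bs]
        by (simp add: T0_def)
    have s: "sorted_wrt (\<lambda>x y. Q x \<longrightarrow> Q y) (leaves b)"
      using assms(2) unfolding el' sorted_wrt_append by blast
    have ts: "\<forall>x\<in>set (els ts). Q x"
      using assms(2) Qb tlast_in_leaves[of b] unfolding el' sorted_wrt_append by blast
    note sp = split_leaves[OF s Qb]
    note sa = split_avl[of b Q]
    have R: "tree_ok B (snd (split Q b))"
      using b sp sa by (auto simp: tree_ok_def intro: order_trans[OF length_filter_le])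
    have L: "tree_ok B l \<and> leaves l = filter (\<lambda>x. \<not> Q x) (leaves b)" if
        "fst (split Q b) = Some l" for l
      using b sp sa that by (auto simp: tree_ok_def intro: order_trans[OF length_filter_le])
    have "els P = els rest @ oleaves (fst (split Q b))"
      unfolding P by (cases "fst (split Q b)") auto
    hence "els P = filter (\<lambda>x. \<not> Q x) (els bs)"
      using rest ts sp by (simp add: el' filter_id_conv[THEN iffD2])
    moreover have "concat (map leaves T) = filter Q (els bs)"
      using rest ts sp by (simp add: T el' filter_id_conv[THEN iffD2] els_def[of ts])
    moreover have "stk_ok B P" unfolding P using ok(1) L
        by (auto intro!: pushm_ok split: option.split)
    moreover have "successively heavy (rev ts)"
      using ok(3) T0 by (simp add: successively_append_iff)
    ultimately show ?thesis using R ok(2) T0 by (auto simp: T)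
  qed
  thus 1: "stk_ok B P" "\<forall>t\<in>set T. tree_ok B t" "successively heavy (tl T)"
    "els P = filter (\<lambda>x. \<not> Q x) (els bs)"
        "concat (map leaves T) = filter Q (els bs)" by auto
  \<comment> \<open>The head of \<open>T\<close> comes from the split and may be light, so pairs are
    counted in the tail; the head accounts for the second unit of the additive 2.\<close>
  have "real (length (tl T)) \<le> 1 + 2 * W (concat (map leaves (tl T)))"
    using heavy_length[OF 1(3)] .
  thus "real (length T) \<le> 2 + 2 * W (filter Q (els bs))"
    unfolding 1(5)[symmetric]
    by (cases T) (auto intro: order_trans simp: W_nonneg add_increasing)
qed

section \<open>Extracting the minimum\<close>

text \<open>The cascade ends at the first list that loses nothing, because the lists behind it keep
  their support; that list has nevertheless been flushed. The arguments of the next round are the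
  first element cut from the current list and the last one kept in it.\<close>

fun ext :: "nat \<Rightarrow> tree list \<Rightarrow> lst list \<Rightarrow> nat \<Rightarrow>
    elem option \<Rightarrow> lst list" where
  "ext B X [] p vo = [(X, [])]"
| "ext B X (C # Cs) p vo = (let bs = flush B C; P = fst (cut B (cutp p vo) bs); T = snd (cut B
    (cutp p vo) bs) in
     if T = [] then (X, []) # (bs, []) # Cs
     else (transfer B T X, []) #
       ext B P Cs (pos (tfirst (hd T))) (if P = [] then None else Some (tlast (hd P))))"

text \<open>An abstract step count; \<open>wp_ext\<close> bounds the machine time by 10000 times
  this number.\<close>

fun ext_cost :: "nat \<Rightarrow> tree list \<Rightarrow> lst list \<Rightarrow> nat
    \<Rightarrow> elem option \<Rightarrow> nat" where
  "ext_cost B X [] p vo = 1"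
| "ext_cost B X (C # Cs) p vo = (let bs = flush B C; P = fst (cut B (cutp p vo) bs); T = snd (cut
    B (cutp p vo) bs) in
     1 + length (snd C) + mh bs +
     (if T = [] then 0
      else length T + mh X +
        ext_cost B P Cs (pos (tfirst (hd T))) (if P = [] then None else Some (tlast (hd P)))))"

text \<open>\<open>X\<close> is what remains of the list preceding \<open>Cs\<close>.  The suffix
    of each list that has lost its
  support moves to the end of the preceding list.\<close>

fun shift :: "elem list \<Rightarrow> elem list list \<Rightarrow> nat \<Rightarrow> elem option
    \<Rightarrow> elem list list" where
  "shift X [] p vo = [X]"
| "shift X (C # Cs) p vo = (let S = filter (cutp p vo) C; P = filter (\<lambda>x. \<not> cutp p vo
    x) C in
     if S = [] then X # C # Cs
     else (X @ S) # shift P Cs (pos (hd S)) (if P = [] then None else Some (last P)))"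

text \<open>Moving an element from one list to the preceding one lowers its factor by 1 and so
  releases exactly its weight. An element in the list into which it was first put contributes
  exactly 1.\<close>

fun pot :: "nat \<Rightarrow> elem list list \<Rightarrow> real" where
  "pot k [] = 0"
| "pot k (C # Cs) = real k * W C + pot (k + 1) Cs"

lemma pot_nonneg: "0 \<le> pot k Cs"
  by (induction Cs arbitrary: k) (auto simp: W_nonneg)

definition pending :: "lst list \<Rightarrow> nat" where
  "pending Cs = (\<Sum>C\<leftarrow>Cs. length (snd C))"

lemma pending_simps [simp]: "pending [] = 0" "pending (C # Cs) = length (snd C) + pending Cs"
  "pending (As @ Cs) = pending As + pending Cs"
  by (simp_all add: pending_def)

text \<open>Translates one round from blocks to elements: what \<open>ext\<close> reads off the
  extreme leaves of its trees is what \<open>shift\<close> reads off the plain lists.\<close>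

lemma ext_step:
  assumes "0 < B" "lst_ok B C" "dec (elems C)" "cut B (cutp p vo) (flush B C) = (P, T)"
  shows "stk_ok B P" "\<forall>t\<in>set T. tree_ok B t" "successively heavy (tl T)"
    "els P = filter (\<lambda>x. \<not> cutp p vo x) (elems C)"
        "concat (map leaves T) = filter (cutp p vo) (elems C)"
    "real (length T) \<le> 2 + 2 * W (filter (cutp p vo) (elems C))"
    "T = [] \<longleftrightarrow> filter (cutp p vo) (elems C) = []"
    "T \<noteq> [] \<Longrightarrow> tfirst (hd T) = hd (filter (cutp p vo) (elems C))"
    "(if P = [] then None else Some (tlast (hd P))) =
     (if filter (\<lambda>x. \<not> cutp p vo x) (elems C) = [] then None
      else Some (last (filter (\<lambda>x. \<not> cutp p vo x) (elems C))))"
proof -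
  have e: "els (flush B C) = elems C" using els_flush[OF assms(1)] .
  have "sorted_wrt (\<lambda>x y. cutp p vo x \<longrightarrow> cutp p vo y) (els (flush B C))"
    unfolding e using dec_cutp[OF assms(3)] .
  note c = cut_ok[OF flush_ok[OF assms(2,1)] this assms(4), unfolded e]
  show "stk_ok B P" "\<forall>t\<in>set T. tree_ok B t" "successively heavy (tl T)"
    and P: "els P = filter (\<lambda>x. \<not> cutp p vo x) (elems C)"
    and T: "concat (map leaves T) = filter (cutp p vo) (elems C)"
    and "real (length T) \<le> 2 + 2 * W (filter (cutp p vo) (elems C))"
    using c by auto
  show "T = [] \<longleftrightarrow> filter (cutp p vo) (elems C) = []"
    unfolding T[symmetric] by (cases T) auto
  show "tfirst (hd T) = hd (filter (cutp p vo) (elems C))" if "T \<noteq> []"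
    unfolding T[symmetric] using that by (cases T) (auto simp: tfirst_eq_hd)
  show "(if P = [] then None else Some (tlast (hd P))) =
     (if filter (\<lambda>x. \<not> cutp p vo x) (elems C) = [] then None
      else Some (last (filter (\<lambda>x. \<not> cutp p vo x) (elems C))))"
    unfolding P[symmetric] using last_els[of P] by auto
qed

lemma elems_Nil_pending [simp]: "elems (X, []) = els X"
  by (simp add: elems_def)

lemma ext_correct:
  assumes "0 < B" "\<forall>C\<in>set Cs. lst_ok B C \<and> dec (elems C)" "stk_ok B X"
  shows "map elems (ext B X Cs p vo) = shift (els X) (map elems Cs) p vo \<and>
    (\<forall>C\<in>set (ext B X Cs p vo). lst_ok B C)"
  using assms
proof (induction Cs arbitrary: X p vo)
  case Nil
  thus ?case by (simp add: lst_ok_def)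
next
  case (Cons C Cs)
  obtain P T where c: "cut B (cutp p vo) (flush B C) = (P, T)" by fastforce
  have C: "lst_ok B C" "dec (elems C)" using Cons.prems by auto
  note s = ext_step[OF Cons.prems(1) C c]
  show ?case
  proof (cases "T = []")
    case True
    thus ?thesis using c s(7) Cons.prems els_flush[OF Cons.prems(1),
        of C] flush_ok[OF C(1) Cons.prems(1)]
      by (auto simp: Let_def lst_ok_def)
  next
    case False
    let ?p = "pos (tfirst (hd T))" and ?v = "if P = [] then None else Some (tlast (hd P))"
    have IH: "map elems (ext B P Cs ?p ?v) = shift (els P) (map elems Cs) ?p ?v \<and>
      (\<forall>C\<in>set (ext B P Cs ?p ?v). lst_ok B C)"
      using Cons.prems s(1) by (intro Cons.IH) auto
    have "ext B X (C # Cs) p vo = (transfer B T X, []) # ext B P Cs ?p ?v"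
      using False c by (simp add: Let_def)
    moreover have "shift (els X) (map elems (C # Cs)) p vo =
        (els X @ concat (map leaves T)) # shift (els P) (map elems Cs) ?p ?v"
      using False s(4,5) s(7) s(8)[OF False] s(9) by (simp add: Let_def)
    moreover have "lst_ok B (transfer B T X, [])"
      using transfer_ok[OF Cons.prems(3) s(2,3)] by (simp add: lst_ok_def)
    ultimately show ?thesis using IH by simp
  qed
qed

lemma length_els_le: "els P = filter Q (elems C) \<Longrightarrow>
    length (els P) \<le> length (elems C)"
  by simp

text \<open>For each list, 3 is the unit of the round plus the additive 2 in the number of popped
  blocks. The height is paid twice: for the flushed stack, and for its remainder, which is the
  receiving stack of the next round. The weight term in the number of blocks is covered by the drop
  of \<open>pot\<close>, the flushed buffer by the drop of \<open>pending\<close>.\<close>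

lemma ext_cost_le:
  assumes "0 < B" "\<forall>C\<in>set Cs. lst_ok B C \<and> dec (elems C)" "stk_ok B X"
  shows "real (ext_cost B X Cs p vo) + real (pending (ext B X Cs p vo)) \<le>
    1 + ht_bound B (length (els X)) + (\<Sum>C\<leftarrow>Cs. 3 + 2 * ht_bound B (length (elems
        C))) + real (pending Cs)
    + 2 * (pot k (els X # map elems Cs) - pot k (map elems (ext B X Cs p vo)))"
  using assms
proof (induction Cs arbitrary: X p vo k)
  case Nil
  thus ?case by (simp add: ht_bound_nonneg)
next
  case (Cons C Cs)
  obtain P T where c: "cut B (cutp p vo) (flush B C) = (P, T)" by fastforce
  have C: "lst_ok B C" "dec (elems C)" using Cons.prems by auto
  note s = ext_step[OF Cons.prems(1) C c]
  have mh: "real (mh (flush B C)) \<le> ht_bound B (length (elems C))"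
    using mh_le_ht_bound[OF flush_ok[OF C(1) Cons.prems(1)]] els_flush[OF Cons.prems(1), of C]
        by simp
  have mhX: "real (mh X) \<le> ht_bound B (length (els X))" using mh_le_ht_bound Cons.prems by blast
  show ?case
  proof (cases "T = []")
    case True
    have "ext B X (C # Cs) p vo = (X, []) # (flush B C, []) # Cs"
      "ext_cost B X (C # Cs) p vo = 1 + length (snd C) + mh (flush B C)"
      using True c by (simp_all add: Let_def)
    moreover have "0 \<le> (\<Sum>C\<leftarrow>Cs. 3 + 2 * ht_bound B (length (elems C)))"
      by (rule sum_list_nonneg) (auto simp: ht_bound_nonneg intro!: add_nonneg_nonneg
          mult_nonneg_nonneg)
    ultimately show ?thesis
      using mh ht_bound_nonneg[of B "length (els X)"] ht_bound_nonneg[of B "length (elems C)"]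
        els_flush[OF Cons.prems(1), of C] by simp
  next
    case False
    let ?p = "pos (tfirst (hd T))" and ?v = "if P = [] then None else Some (tlast (hd P))"
    let ?S = "filter (cutp p vo) (elems C)"
    have IH: "real (ext_cost B P Cs ?p ?v) + real (pending (ext B P Cs ?p ?v)) \<le>
      1 + ht_bound B (length (els P)) + (\<Sum>C\<leftarrow>Cs. 3 + 2 * ht_bound B (length (elems
          C))) + real (pending Cs)
      + 2 * (pot (k + 1) (els P # map elems Cs) - pot (k + 1) (map elems (ext B P Cs ?p ?v)))"
      using Cons.prems s(1) by (intro Cons.IH) auto
    have e: "ext B X (C # Cs) p vo = (transfer B T X, []) # ext B P Cs ?p ?v"
      "ext_cost B X (C # Cs) p vo = 1 + length (snd C) + mh (flush B C) + (length T + mh X +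
          ext_cost B P Cs ?p ?v)"
      using False c by (simp_all add: Let_def)
    have "ht_bound B (length (els P)) \<le> ht_bound B (length (elems C))"
      using length_els_le[OF s(4)] by (rule ht_bound_mono)
    moreover have "W (elems C) = W ?S + W (els P)"
        using W_filter[of "cutp p vo" "elems C"] s(4) by simp
    hence "pot k (els X # map elems (C # Cs)) - pot k (map elems (ext B X (C # Cs) p vo)) =
       W ?S + (pot (k + 1) (els P # map elems Cs) - pot (k + 1) (map elems (ext B P Cs ?p ?v)))"
      unfolding e(1) using s(5) by (simp add: algebra_simps)
    ultimately show ?thesis unfolding e(2) using IH s(6) mh mhX
      by (simp add: e(1) del: ext.simps pot.simps)
  qed
qed

section \<open>Covers by decreasing lists and increasing subsequences\<close>

definition before :: "elem \<Rightarrow> elem \<Rightarrow> bool" where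
  "before x y \<longleftrightarrow> pos x < pos y \<and> key x < key y"

definition supports :: "elem list \<Rightarrow> elem list \<Rightarrow> bool" where
  "supports C D \<longleftrightarrow> (\<forall>y\<in>set D. \<exists>x\<in>set C. before x y)"

lemma supports_Nil [simp]: "supports C []"
  by (simp add: supports_def)

lemma dec_filter: "dec xs \<Longrightarrow> dec (filter Q xs)"
  by (simp add: dec_def sorted_wrt_filter)

lemma dec_append:
  "dec (xs @ ys) \<longleftrightarrow> dec xs \<and> dec ys \<and>
      (\<forall>x\<in>set xs. \<forall>y\<in>set ys. pos x < pos y \<and> key y \<le> key x)"
  by (auto simp: dec_def sorted_wrt_append)

lemma dec_last:
  assumes "dec xs" "x \<in> set xs"
  shows "key (last xs) \<le> key x \<and> pos x \<le> pos (last xs)"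
proof -
  have "xs = butlast xs @ [last xs]" using assms(2) by (cases xs) auto
  then obtain ys where ys: "xs = ys @ [last xs]" by blast
  hence "dec (ys @ [last xs])" "x \<in> set (ys @ [last xs])" using assms by simp_all
  thus ?thesis by (fastforce simp: dec_append)
qed

lemma dec_hd: "dec xs \<Longrightarrow> x \<in> set xs \<Longrightarrow> pos (hd xs) \<le> pos x"
  by (cases xs) (auto simp: dec_def)

lemma filter_suffix:
  assumes "sorted_wrt (\<lambda>x y. Q x \<longrightarrow> Q y) xs"
  shows "xs = filter (\<lambda>x. \<not> Q x) xs @ filter Q xs"
  using assms
proof (induction xs)
  case (Cons x xs)
  show ?case
  proof (cases "Q x")
    case True
    hence "\<forall>y\<in>set xs. Q y" using Cons.prems by auto
    thus ?thesis using True by (simp add: filter_empty_conv filter_id_conv[THEN iffD2])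
  next
    case False
    thus ?thesis using Cons by auto
  qed
qed simp

text \<open>\<open>S\<close> is the part that has just been cut off from the list \<open>X @
    S\<close> preceding \<open>Cs\<close>.
  Kept elements are supported by kept ones, and moved elements by moved ones.\<close>

lemma shift_correct:
  assumes "dec (X @ S)" "S \<noteq> []" "\<forall>C\<in>set Cs. dec C \<and>
      C \<noteq> []" "successively supports ((X @ S) # Cs)"
    "p = pos (hd S)" "vo = (if X = [] then None else Some (last X))"
  shows "\<exists>S' Rs. shift X Cs p vo = (X @ S') # Rs \<and> supports S S' \<and>
    (\<forall>C\<in>set ((X @ S') # Rs). dec C) \<and> successively supports ((X @ S') # Rs) \<and>
    (\<forall>C\<in>set (butlast ((X @ S') # Rs)). C \<noteq> []) \<and>
        length Rs = length Cs \<and>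
    \<Union>(set ` set ((X @ S') # Rs)) = set X \<union> \<Union>(set ` set Cs) \<and>
    length (concat ((X @ S') # Rs)) = length X + length (concat Cs)"
  using assms
proof (induction Cs arbitrary: X S p vo)
  case Nil
  thus ?case by (intro exI[of _ "[]"]) (auto simp: supports_def dec_append)
next
  case (Cons C Cs)
  let ?Q = "cutp p vo"
  let ?S = "filter ?Q C" and ?P = "filter (\<lambda>x. \<not> ?Q x) C"
  have C: "dec C" "C \<noteq> []" "supports (X @ S) C" using Cons.prems by auto
  have CPS: "C = ?P @ ?S" using filter_suffix[OF dec_cutp[OF C(1)]] .
  have X: "dec X" "dec S" "\<forall>x\<in>set X. \<forall>y\<in>set S. pos x < pos y \<and> key y
      \<le> key x"
    using Cons.prems(1) by (auto simp: dec_append)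
  have hdS: "hd S \<in> set S" using Cons.prems(2) by simp
  have kept: "supports X ?P"
  proof -
    have "\<exists>x\<in>set X. before x y" if y: "y \<in> set C" "\<not> ?Q y" for y
    proof -
      from C(3) y(1) obtain x where x: "x \<in> set (X @ S)" "before x y"
          unfolding supports_def by blast
      show ?thesis
      proof (cases "x \<in> set X")
        \<comment> \<open>A supporter in the removed part \<open>S\<close> puts \<open>y\<close>
          behind position \<open>p\<close>. As \<open>y\<close> is not cut, its key then exceeds
          that of the last element of \<open>X\<close>, which takes over the support.\<close>
        case False
        hence "pos (hd S) \<le> pos x" using x(1) dec_hd[OF X(2)] by simp
        hence gt: "p < pos y" using x(2) Cons.prems(5) by (simp add: before_def)
        hence "X \<noteq> []" "key (last X) < key y" using y(2) Cons.prems(6)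
          by (auto simp: cutp_def split: if_splits)
        moreover from this have "pos (last X) < pos y" using X(3) hdS gt Cons.prems(5)
          by (meson last_in_set order_less_trans)
        ultimately show ?thesis by (auto simp: before_def intro!: bexI[of _ "last X"])
      qed (use x in blast)
    qed
    thus ?thesis by (auto simp: supports_def)
  qed
  have moved: "supports S ?S"
  proof -
    have "\<exists>x\<in>set S. before x y" if y: "y \<in> set C" "?Q y" for y
    proof -
      from C(3) y(1) obtain x where x: "x \<in> set (X @ S)" "before x y"
          unfolding supports_def by blast
      \<comment> \<open>The last element of \<open>X\<close> has the smallest key of
        \<open>X\<close>, and the key of a moved element does not exceed it.\<close>
      have "x \<notin> set X"
      proof
        assume "x \<in> set X"
        hence "key (last X) \<le> key x" "X \<noteq> []" using dec_last[OF X(1)] by auto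
        thus False using x(2) y(2) Cons.prems(6) by (auto simp: cutp_def before_def)
      qed
      thus ?thesis using x by auto
    qed
    thus ?thesis by (auto simp: supports_def)
  qed
  show ?case
  proof (cases "?S = []")
    case True
    hence P: "?P = C" using CPS by simp
    \<comment> \<open>When nothing moves, the nonempty list \<open>C\<close> is supported by
      \<open>X\<close> alone; this gives the nonemptiness claimed for all lists but the
      last.\<close>
    have "X \<noteq> []" using kept C(2) unfolding P by (cases C) (auto simp: supports_def)
    moreover have "successively supports (X # C # Cs)" using kept Cons.prems(4) unfolding P by simp
    moreover have "C \<noteq> []" "\<forall>D\<in>set Cs. D \<noteq> []" using Cons.prems by auto
    ultimately show ?thesis using True X(1) Cons.prems
      by (intro exI[of _ "[]"] exI[of _ "C # Cs"]) (auto dest: in_set_butlastD)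
  next
    case False
    have succ: "successively supports ((?P @ ?S) # Cs)" using Cons.prems(4) CPS by simp
    have dPS: "dec (?P @ ?S)" using C(1) CPS by simp
    have "\<forall>C\<in>set Cs. dec C \<and> C \<noteq> []" using Cons.prems by simp
    from Cons.IH[OF dPS False this succ refl refl] obtain S' Rs where IH:
      "shift ?P Cs (pos (hd ?S)) (if ?P = [] then None else Some (last ?P)) = (?P @ S') # Rs"
      "supports ?S S'" "\<forall>C\<in>set ((?P @ S') # Rs). dec C"
          "successively supports ((?P @ S') # Rs)"
      "\<forall>C\<in>set (butlast ((?P @ S') # Rs)). C \<noteq> []" "length Rs = length Cs"
      "\<Union>(set ` set ((?P @ S') # Rs)) = set ?P \<union> \<Union>(set ` set Cs)"
      "length (concat ((?P @ S') # Rs)) = length ?P + length (concat Cs)"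
      by (elim exE conjE) (rule that; assumption)
    have sh: "shift X (C # Cs) p vo = (X @ ?S) # (?P @ S') # Rs" using False IH(1)
        by (simp add: Let_def)
    have "supports (X @ ?S) (?P @ S')" using kept IH(2) unfolding supports_def by auto
    moreover have "dec (X @ ?S)"
    proof -
      have "pos x < pos y \<and> key y \<le> key x" if x: "x \<in> set X"
          and y: "y \<in> set ?S" for x y
      proof -
        have "pos x < p" using X(3) x hdS Cons.prems(5) by auto
        moreover have "key (last X) \<le> key x" using dec_last[OF X(1) x] by simp
        moreover have "p < pos y" "key y \<le> key (last X)"
          using y x Cons.prems(6) by (auto simp: cutp_def split: if_splits)
        ultimately show ?thesis by linarith
      qed
      thus ?thesis using X(1) dec_filter[OF C(1)] by (auto simp: dec_append)
    qed
    moreover have "set C = set ?P \<union> set ?S" by auto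
    moreover have "length C = length ?P + length ?S" by (metis CPS length_append)
    moreover define P0 S0 where "P0 = ?P" and "S0 = ?S"
    note d = P0_def[symmetric] S0_def[symmetric]
    ultimately show ?thesis unfolding sh using moved IH(3-8) False unfolding d
      by (intro exI[of _ S0] exI[of _ "(P0 @ S') # Rs"]) auto
  qed
qed

definition cover :: "elem list \<Rightarrow> elem list list \<Rightarrow> bool" where
  "cover L Cs \<longleftrightarrow> sorted_wrt (\<lambda>x y. pos x < pos y) L \<and>
      set L = \<Union>(set ` set Cs) \<and>
     (\<forall>C\<in>set Cs. dec C \<and> C \<noteq> []) \<and> successively supports Cs"

text \<open>Strictly increasing positions force the order of the elements in both lists.\<close>

lemma subseq_of_sorted_subset:
  assumes "sorted_wrt (\<lambda>x y. pos x < pos y) u"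
      "sorted_wrt (\<lambda>x y. pos x < pos y) L" "set u \<subseteq> set L"
  shows "subseq u L"
  using assms
proof (induction L arbitrary: u)
  case (Cons a L)
  show ?case
  proof (cases u)
    case (Cons b v)
    have v: "sorted_wrt (\<lambda>x y. pos x < pos y) v" "\<forall>y\<in>set v. pos b < pos y"
      using Cons.prems Cons by auto
    show ?thesis
    proof (cases "b = a")
      case True
      have "set v \<subseteq> set L" using v(2) Cons.prems(3) Cons True by auto
      thus ?thesis using Cons.IH[OF v(1)] Cons.prems Cons True by simp
    next
      case False
      hence "b \<in> set L" using Cons.prems(3) Cons by simp
      hence "pos a < pos b" using Cons.prems(2) by simp
      hence "a \<notin> set u" using v(2) Cons by auto
      hence "set u \<subseteq> set L" using Cons.prems(3) by auto
      thus ?thesis using Cons.IH[of u] Cons.prems by auto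
    qed
  qed simp
qed simp

lemma set_subseq: "subseq u L \<Longrightarrow> set u \<subseteq> set L"
  by (auto simp: subseq_conv_nths dest: in_set_nthsD)

lemma subseq_sorted_wrt: "subseq u L \<Longrightarrow>
    sorted_wrt R L \<Longrightarrow> sorted_wrt R u"
  by (induction rule: list_emb.induct) (auto dest: set_subseq)

lemma sorted_wrt_conj:
  "sorted_wrt P xs \<Longrightarrow> sorted_wrt Q xs \<Longrightarrow>
      sorted_wrt (\<lambda>x y. P x y \<and> Q x y) xs"
  by (induction xs) auto

lemma sorted_wrt_total:
  "sorted_wrt P xs \<Longrightarrow> x \<in> set xs \<Longrightarrow>
      y \<in> set xs \<Longrightarrow> x = y \<or> P x y \<or> P y x"
  by (induction xs) auto

text \<open>Following supporters backwards from list \<open>k\<close> to the first list yields one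
  element per list.\<close>

lemma supports_chain:
  assumes "successively supports Cs" "\<forall>C\<in>set Cs. C \<noteq> []" "k < length Cs"
      "y \<in> set (Cs ! k)"
  shows "\<exists>u. length u = Suc k \<and> sorted_wrt before u \<and>
      set u \<subseteq> \<Union>(set ` set Cs) \<and> last u = y"
  using assms(3,4)
proof (induction k arbitrary: y)
  case 0
  thus ?case by (intro exI[of _ "[y]"]) auto
next
  case (Suc k)
  have "supports (Cs ! k) (Cs ! Suc k)" using assms(1) Suc.prems(1)
      by (auto simp: successively_conv_nth)
  then obtain x where x: "x \<in> set (Cs ! k)" "before x y" using Suc.prems(2)
      by (auto simp: supports_def)
  from Suc.IH[OF _ x(1)] Suc.prems(1) obtain u where
    u: "length u = Suc k" "sorted_wrt before u" "set u \<subseteq> \<Union>(set ` set Cs)"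
        "last u = x" by auto
  have "before z y" if "z \<in> set u" for z
  proof -
    obtain v where v: "u = v @ [x]" using u(1,4)
        by (metis append_butlast_last_id length_0_conv nat.discI)
    hence "z = x \<or> before z x" using that u(2) by (auto simp: sorted_wrt_append)
    thus ?thesis using x(2) by (auto simp: before_def)
  qed
  thus ?case using u Suc.prems by (intro exI[of _ "u @ [y]"]) (auto simp: sorted_wrt_append)
qed

lemma finite_lis: "finite {length s |s. subseq s L \<and> sorted_wrt (<) s}"
  by (rule finite_subset[of _ "{..length L}"]) (auto dest: list_emb_length)

text \<open>Duality of chains and antichains: an increasing subsequence meets each decreasing list
  at most once, and a chain of supporters ending in the last list meets every list.\<close>

lemma lis_length_cover:
  assumes "cover L Cs"
  shows "lis_length (map key L) = length Cs"
  unfolding lis_length_def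
proof (rule Max_eqI[OF finite_lis])
  note c = assms[unfolded cover_def]
  show "n \<le> length Cs" if "n \<in> {length s |s. subseq s (map key L) \<and>
      sorted_wrt (<) s}" for n
  proof -
    from that obtain s where s: "n = length s" "subseq s (map key L)" "sorted_wrt (<) s" by blast
    \<comment> \<open>The index set selecting the keys selects the corresponding elements as
      well.\<close>
    then obtain N where "s = nths (map key L) N" by (auto simp: subseq_conv_nths)
    then obtain u where u: "subseq u L" "s = map key u" by (auto simp: subseq_conv_nths nths_map)
    have setu: "set u \<subseteq> set L" using u(1) by (rule set_subseq)
    have sp: "sorted_wrt (\<lambda>x y. pos x < pos y) u"
      using c u(1) subseq_sorted_wrt by blast
    have sk: "sorted_wrt (\<lambda>x y. key x < key y) u" using s(3) u(2)
        by (simp add: sorted_wrt_map)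
    have sb: "sorted_wrt before u"
      using sorted_wrt_conj[OF sp sk] by (simp add: before_def[abs_def])
    have b: "before x y" if "x \<in> set u" "y \<in> set u" "pos x < pos y" for x y
      using sorted_wrt_total[OF sb that(1,2)] that(3) unfolding before_def by force
    have dpos: "distinct (map pos u)"
      using sp strict_sorted_iff[of "map pos u"] by (simp add: sorted_wrt_map)
    \<comment> \<open>Assigns to each element of the subsequence a list containing it. Two elements
      with the same list would have weakly decreasing keys, so the assignment is injective.\<close>
    define f where "f x = (SOME k. k < length Cs \<and> x \<in> set (Cs ! k))" for x
    have f: "f x < length Cs \<and> x \<in> set (Cs ! f x)" if "x \<in> set u" for x
    proof -
      have "x \<in> \<Union>(set ` set Cs)" using that setu c by blast
      then obtain C where "C \<in> set Cs" "x \<in> set C" by blast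
      hence "\<exists>k. k < length Cs \<and> x \<in> set (Cs ! k)" by (metis in_set_conv_nth)
      thus ?thesis unfolding f_def by (rule someI_ex)
    qed
    have "inj_on f (set u)"
    proof (rule inj_onI, rule ccontr)
      fix x y assume xy: "x \<in> set u" "y \<in> set u" "f x = f y" "x \<noteq> y"
      let ?C = "Cs ! f x"
      have C: "dec ?C" "x \<in> set ?C" "y \<in> set ?C" 
        using f[OF xy(1)] f[OF xy(2)] xy(3) c nth_mem[of "f x" Cs] by auto
      have "pos x \<noteq> pos y" using dpos xy by (auto simp: distinct_map inj_on_def)
      moreover have False if "pos a < pos b" "a \<in> set ?C" "b \<in> set ?C" "a \<in> set u"
          "b \<in> set u" for a b
      proof -
        have s: "sorted_wrt (\<lambda>x y. pos x < pos y \<and> key y \<le> key x) ?C"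
            using C(1) by (simp add: dec_def)
        hence "key b \<le> key a" using sorted_wrt_total[OF s that(2,3)] that(1) by force
        thus False using b[OF that(4,5,1)] by (simp add: before_def)
      qed
      ultimately show False using C xy(1,2) by (meson linorder_neqE_nat)
    qed
    hence "card (set u) \<le> card {..<length Cs}" using f by (intro card_inj_on_le[of f]) auto
    thus ?thesis using s(1) u(2) dpos by (simp add: distinct_card distinct_map)
  qed
  show "length Cs \<in> {length s |s. subseq s (map key L) \<and> sorted_wrt (<) s}"
  proof (cases "Cs = []")
    case True
    thus ?thesis by (auto intro!: exI[of _ "[]"])
  next
    case False
    define k where "k = length Cs - 1"
    have k: "k < length Cs" "Suc k = length Cs" using False by (auto simp: k_def)
    have "Cs ! k \<noteq> []" using c k(1) by auto
    hence "hd (Cs ! k) \<in> set (Cs ! k)" by simp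
    from supports_chain[OF _ _ k(1) this] c k(2) obtain u where
      u: "length u = length Cs" "sorted_wrt before u" "set u \<subseteq> set L" by metis
    have "subseq u L"
      using u c by (intro subseq_of_sorted_subset) (auto simp: before_def elim:
          sorted_wrt_mono_rel[rotated])
    hence "subseq (map key u) (map key L)" by (rule subseq_map)
    moreover have "sorted_wrt (<) (map key u)"
      using u(2) by (auto simp: before_def sorted_wrt_map elim: sorted_wrt_mono_rel[rotated])
    ultimately show ?thesis using u(1) by (metis (mono_tags, lifting) length_map mem_Collect_eq)
  qed
qed

section \<open>Greedy covers\<close>

lemma successively_supports_snoc:
  assumes "successively supports Cs" "i < length Cs" "0 < i \<Longrightarrow>
      supports (Cs ! (i - 1)) [x]"
  shows "successively supports (Cs[i := Cs ! i @ [x]])"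
  unfolding successively_conv_nth
proof (intro allI impI)
  fix k assume "Suc k < length (Cs[i := Cs ! i @ [x]])"
  hence k: "Suc k < length Cs" by simp
  have s: "supports (Cs ! k) (Cs ! Suc k)" using assms(1) k by (auto simp: successively_conv_nth)
  consider "k = i" | "Suc k = i" | "k \<noteq> i" "Suc k \<noteq> i" by blast
  thus "supports (Cs[i := Cs ! i @ [x]] ! k) (Cs[i := Cs ! i @ [x]] ! Suc k)"
  proof cases
    case 1
    thus ?thesis using s k by (auto simp: supports_def)
  next
    case 2
    thus ?thesis using s k assms(3) by (auto simp: supports_def)
  next
    case 3
    thus ?thesis using s k by simp
  qed
qed

text \<open>The end of list \<open>i - 1\<close> is an earlier and smaller element, hence a
  supporter of \<open>x\<close>. These two comparisons with neighbouring list ends are all that the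
  scan delivers.\<close>

lemma cover_append:
  assumes "cover L Cs" "\<forall>y\<in>set L. pos y < pos x" "i < length Cs"
    "key x \<le> key (last (Cs ! i))" "0 < i \<Longrightarrow> key (last (Cs ! (i - 1))) < key x"
  shows "cover (L @ [x]) (Cs[i := Cs ! i @ [x]])"
proof -
  note c = assms(1)[unfolded cover_def]
  have Ci: "Cs ! i \<in> set Cs" "dec (Cs ! i)" "set (Cs ! i) \<subseteq> set L"
    using c assms(3) nth_mem[OF assms(3)] by auto
  have "dec (Cs ! i @ [x])"
    using Ci assms(2,4) dec_last[OF Ci(2)] by (force simp: dec_append dec_def[of "[x]"])
  moreover have "successively supports (Cs[i := Cs ! i @ [x]])"
  proof (rule successively_supports_snoc)
    assume i: "0 < i"
    hence m: "Cs ! (i - 1) \<in> set Cs" using assms(3) by auto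
    hence "last (Cs ! (i - 1)) \<in> set (Cs ! (i - 1))" using c by auto
    moreover from this have "last (Cs ! (i - 1)) \<in> set L" using c m by blast
    ultimately show "supports (Cs ! (i - 1)) [x]"
      using assms(2,5) i by (auto simp: supports_def before_def)
  qed (use c assms in auto)
  moreover have "\<Union>(set ` set (Cs[i := Cs ! i @ [x]])) = insert x (\<Union>(set ` set Cs))"
  proof -
    have "Cs = take i Cs @ Cs ! i # drop (Suc i) Cs" using assms(3) by (rule id_take_nth_drop)
    hence "set Cs = set (take i Cs) \<union> {Cs ! i} \<union> set (drop (Suc i) Cs)"
      by (metis Un_insert_right list.simps(15) set_append sup_bot.right_neutral Un_insert_left)
    thus ?thesis using assms(3) by (auto simp: upd_conv_take_nth_drop)
  qed
  ultimately show ?thesis unfolding cover_def using c assms(2)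
    by (auto simp: sorted_wrt_append dest!: set_update_subset_insert[THEN subsetD])
qed

lemma cover_new:
  assumes "cover L Cs" "\<forall>y\<in>set L. pos y < pos x"
      "Cs \<noteq> [] \<Longrightarrow> key (last (last Cs)) < key x"
  shows "cover (L @ [x]) (Cs @ [[x]])"
proof -
  note c = assms(1)[unfolded cover_def]
  have "supports (last Cs) [x]" if "Cs \<noteq> []"
  proof -
    have "last (last Cs) \<in> set (last Cs)" using c that by auto
    moreover from this have "last (last Cs) \<in> set L" using c that last_in_set by blast
    ultimately show ?thesis using assms(2,3) that by (auto simp: supports_def before_def)
  qed
  thus ?thesis unfolding cover_def using c assms(2)
    by (auto simp: sorted_wrt_append successively_append_iff dec_def)
qed

text \<open>Every support is a strict increase of the key. Consequently all copies of the minimum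
  lie in the first list.\<close>

lemma supports_gt:
  "successively supports (C # Cs) \<Longrightarrow>
      \<forall>x\<in>set C. m \<le> key x \<Longrightarrow>
      D \<in> set Cs \<Longrightarrow> y \<in> set D \<Longrightarrow> m < key y"
proof (induction Cs arbitrary: C)
  case (Cons E Cs)
  have E: "\<forall>x\<in>set E. m < key x"
    using Cons.prems(1,2) by (fastforce simp: supports_def before_def)
  show ?case
  proof (cases "D = E")
    case True
    thus ?thesis using E Cons.prems by simp
  next
    case False
    thus ?thesis using Cons.IH[of E] E Cons.prems by (auto intro: less_imp_le)
  qed
qed simp

lemma cover_min:
  assumes "cover L (C # Cs)"
  shows "Min (set (map key L)) = key (last C)"
proof (rule Min_eqI)
  note c = assms[unfolded cover_def]
  have C: "\<forall>x\<in>set C. key (last C) \<le> key x" using c dec_last by auto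
  show "key (last C) \<le> y" if "y \<in> set (map key L)" for y
  proof -
    from that obtain x where x: "x \<in> set L" "y = key x" by auto
    thus ?thesis using c C supports_gt[of C Cs "key (last C)" _ x] by (auto intro: less_imp_le)
  qed
  have "last C \<in> set L" using c by auto
  thus "key (last C) \<in> set (map key L)" by auto
qed simp

text \<open>The general cascade applied with an empty list in front: the position bound 0 lies below
  all positions, so the first cut is decided by the key and removes exactly the copies of the
  minimum. They form the head of the result, which \<open>tl\<close> drops.\<close>

lemma cover_extract:
  assumes "cover L (C # Cs)" "\<forall>y\<in>set L. 0 < pos y"
    "R = tl (shift [] (C # Cs) 0 (Some (last C)))"
  shows "cover (filter (\<lambda>x. key x \<noteq> key (last C)) L) (if last R = [] then butlast R
      else R)"
    "length R = Suc (length Cs)" "length (concat R) \<le> length (concat (C # Cs))"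
    "shift [] (C # Cs) 0 (Some (last C)) \<noteq> []"
proof -
  note c = assms(1)[unfolded cover_def]
  let ?Q = "cutp 0 (Some (last C))"
  define S P where "S = filter ?Q C" and "P = filter (\<lambda>x. \<not> ?Q x) C"
  have C: "dec C" "C \<noteq> []" "set C \<subseteq> set L" using c by auto
  have "sorted_wrt (\<lambda>x y. ?Q x \<longrightarrow> ?Q y) C" using dec_cutp[OF C(1)] .
  hence CPS: "C = P @ S" unfolding S_def P_def by (rule filter_suffix)
  have "0 < pos (last C)" using C assms(2) last_in_set by blast
  hence "last C \<in> set S" using C by (simp add: S_def cutp_def)
  hence ne: "S \<noteq> []" by auto
  have succ: "successively supports ((P @ S) # Cs)" and d: "dec (P @ S)" using c C(1) CPS by auto
  have Cs: "\<forall>C\<in>set Cs. dec C \<and> C \<noteq> []" using c by auto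
  from shift_correct[OF d ne Cs succ refl refl] obtain S' Rs where sh:
    "shift P Cs (pos (hd S)) (if P = [] then None else Some (last P)) = (P @ S') # Rs"
    "\<forall>C\<in>set ((P @ S') # Rs). dec C" "successively supports ((P @ S') # Rs)"
    "\<forall>C\<in>set (butlast ((P @ S') # Rs)). C \<noteq> []" "length Rs = length Cs"
    "\<Union>(set ` set ((P @ S') # Rs)) = set P \<union> \<Union>(set ` set Cs)"
    "length (concat ((P @ S') # Rs)) = length P + length (concat Cs)"
    by (elim exE conjE) (rule that; assumption)
  have e: "shift [] (C # Cs) 0 (Some (last C)) =
      S # shift P Cs (pos (hd S)) (if P = [] then None else Some (last P))"
    using ne by (simp add: Let_def S_def P_def)
  have R: "R = (P @ S') # Rs" unfolding assms(3) e sh(1) by simp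
  show "length R = Suc (length Cs)" "shift [] (C # Cs) 0 (Some (last C)) \<noteq> []"
    using R sh(5) e by auto
  show "length (concat R) \<le> length (concat (C # Cs))"
    unfolding R sh(7) by (simp add: P_def)
  have P: "set P = {x \<in> set C. key x \<noteq> key (last C)}"
    using dec_last[OF C(1)] C(3) assms(2) by (fastforce simp: P_def cutp_def)
  have "key y \<noteq> key (last C)" if "D \<in> set Cs" "y \<in> set D" for D y
    using supports_gt[OF _ _ that, of C "key (last C)"] c dec_last[OF C(1)] by auto
  hence U: "\<Union>(set ` set R) = {x \<in> set L. key x \<noteq> key (last C)}"
    unfolding R sh(6) P using c by auto
  let ?R = "if last R = [] then butlast R else R"
  have Rne: "R \<noteq> []" using R by simp
  hence Rl: "R = butlast R @ [last R]" by simp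
  have setR: "set R = insert (last R) (set (butlast R))" using arg_cong[OF Rl, of set] by simp
  have "sorted_wrt (\<lambda>x y. pos x < pos y) (filter (\<lambda>x. key x \<noteq> key (last C))
      L)"
    using c by (simp add: sorted_wrt_filter)
  moreover have "\<Union>(set ` set ?R) = \<Union>(set ` set R)"
    using setR by (cases "last R = []") auto
  moreover have "\<forall>C\<in>set ?R. dec C \<and> C \<noteq> []"
  proof
    fix D assume D: "D \<in> set ?R"
    hence "D \<in> set R" by (auto split: if_splits dest: in_set_butlastD)
    \<comment> \<open>By \<open>shift_correct\<close> only the last list can have lost all its
      elements, and then it is dropped.\<close>
    moreover have "D \<noteq> []"
    proof (cases "last R = []")
      case True
      thus ?thesis using D sh(4) R by simp
    next
      case False
      have "D \<in> set (butlast R) \<or> D = last R" using \<open>D \<in> set R\<close> setR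
          by blast
      thus ?thesis using False sh(4) R by auto
    qed
    ultimately show "dec D \<and> D \<noteq> []" using sh(2) R by blast
  qed
  moreover have "successively supports ?R"
    using sh(3) Rl unfolding R[symmetric] by (metis successively_append_iff)
  ultimately show "cover (filter (\<lambda>x. key x \<noteq> key (last C)) L) ?R"
    unfolding cover_def U set_filter by (intro conjI) (simp_all only:)
qed

text \<open>Concavity enters through the linear estimate \<open>log 2 x \<le> 2 * x\<close> at
  \<open>x = n / a\<close>, where \<open>a = l / lam\<close>; the quotients \<open>n / a\<close> sum
  to at most \<open>lam\<close>. The other argument of the minimum comes from bounding every block
  size by \<open>lam\<close>.\<close>

lemma log_sum_le:
  assumes "\<forall>n\<in>set ns. 1 \<le> n" "real (sum_list ns) \<le> l"
      "real (length ns) \<le> lam"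
    "real B \<le> lam" "1 \<le> lam" "lam \<le> l"
  shows "(\<Sum>n\<leftarrow>ns. ht_bound B n) \<le> 4 * (lam * (1 + log 2 (min lam (l / lam))))"
proof -
  define a where "a = l / lam"
  have a: "1 \<le> a" "l / a = lam" using assms(5,6) by (auto simp: a_def)
  have ns: "ht_bound B n \<le> 2 * log 2 lam" "ht_bound B n \<le> 2 * (log 2 a + 2 * (real n / a))"
    if n: "n \<in> set ns" for n
  proof -
    have n1: "1 \<le> n" using assms(1) n by blast
    have "real (max 1 (min B n)) \<le> lam" using assms(4,5) n1 by (auto simp: max_def min_def)
    thus "ht_bound B n \<le> 2 * log 2 lam" unfolding ht_bound_def by simp
    have "ht_bound B n \<le> 2 * log 2 (real n)" using n1 unfolding ht_bound_def
        by (simp add: max_def min_def)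
    also have "log 2 (real n) = log 2 a + log 2 (real n / a)"
      using a(1) n1 by (simp add: log_divide)
    also have "log 2 (real n / a) \<le> 2 * (real n / a)"
    proof -
      have pos: "0 < real n / a" using a n1 by simp
      have "ln (real n / a) \<le> real n / a" using ln_le_minus_one[OF pos] by simp
      hence "log 2 (real n / a) \<le> (real n / a) / ln 2"
        unfolding log_def by (intro divide_right_mono) auto
      also have "\<dots> \<le> (real n / a) * 2"
      proof -
        \<comment> \<open>This is \<open>ln (1 + x) \<le> x\<close> at
          \<open>x = - 1 / 2\<close>.\<close>
        have "1 / 2 \<le> ln (2::real)" using ln_add_one_self_le_self2[of "-1/2"]
            by (simp add: ln_div)
        hence "1 / ln (2::real) \<le> 2" by (simp add: field_simps)
        thus ?thesis using mult_left_mono[of "1 / ln 2" 2 "real n / a"] pos by simp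
      qed
      finally show ?thesis by (simp add: mult.commute)
    qed
    finally show "ht_bound B n \<le> 2 * (log 2 a + 2 * (real n / a))" by simp
  qed
  have 1: "(\<Sum>n\<leftarrow>ns. ht_bound B n) \<le> 4 * (lam * (1 + log 2 lam))"
  proof -
    have "(\<Sum>n\<leftarrow>ns. ht_bound B n) \<le> (\<Sum>n\<leftarrow>ns. 2 * log 2 lam)"
      using ns(1) by (intro sum_list_mono) auto
    also have "\<dots> = real (length ns) * (2 * log 2 lam)" by (simp add: sum_list_triv)
    also have "\<dots> \<le> lam * (2 * log 2 lam)" using assms(3,5) by (intro mult_right_mono) auto
    also have "\<dots> \<le> lam * (4 * (1 + log 2 lam))" using assms(5)
        by (intro mult_left_mono) auto
    finally show ?thesis by (simp add: algebra_simps)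
  qed
  have 2: "(\<Sum>n\<leftarrow>ns. ht_bound B n) \<le> 4 * (lam * (1 + log 2 a))"
  proof -
    have "(\<Sum>n\<leftarrow>ns. ht_bound B n) \<le> (\<Sum>n\<leftarrow>ns. 2 * (log 2 a + 2 *
        (real n / a)))"
      using ns(2) by (intro sum_list_mono) auto
    also have "\<dots> = real (length ns) * (2 * log 2 a) + 4 * (real (sum_list ns) / a)"
      by (induction ns) (auto simp: algebra_simps add_divide_distrib)
    also have "\<dots> \<le> lam * (2 * log 2 a) + 4 * lam"
    proof -
      have "real (sum_list ns) / a \<le> lam" using assms(2) a
          by (metis divide_right_mono order_trans zero_le_one)
      moreover have "real (length ns) * (2 * log 2 a) \<le> lam * (2 * log 2 a)"
        using assms(3) a by (intro mult_right_mono) auto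
      ultimately show ?thesis by linarith
    qed
    also have "\<dots> \<le> lam * (4 * log 2 a) + 4 * lam"
      using assms(5) a by (simp add: mult_left_mono)
    finally show ?thesis by (simp add: algebra_simps)
  qed
  show ?thesis unfolding a_def[symmetric] using 1 2 by (cases "lam \<le> a") (auto simp: min_def)
qed

text \<open>The number of appends that do not continue a weakly decreasing run;
    \<open>prev\<close> is the value
  appended by the preceding operation, if that was an append.\<close>

fun starts_run :: "real option \<Rightarrow> real \<Rightarrow> bool" where
  "starts_run None x = True"
| "starts_run (Some y) x = (y < x)"

fun runs :: "real option \<Rightarrow> operation list \<Rightarrow> nat" where
  "runs prev [] = 0"
| "runs prev (ExtractMin # ops) = runs None ops"
| "runs prev (Append x # ops) = (if starts_run prev x then 1 else 0) + runs (Some x) ops"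

fun last_val :: "real option \<Rightarrow> operation list \<Rightarrow> real option" where
  "last_val prev [] = prev"
| "last_val prev (ExtractMin # ops) = last_val None ops"
| "last_val prev (Append x # ops) = last_val (Some x) ops"

lemma runs_append: "runs prev (us @ vs) = runs prev us + runs (last_val prev us) vs"
  by (induction prev us rule: runs.induct) auto

lemma last_val_append: "last_val prev (us @ vs) = last_val (last_val prev us) vs"
  by (induction prev us rule: last_val.induct) auto

lemma runs_map_Append:
  "sorted_wrt (\<ge>) (x # xs) \<Longrightarrow> runs (Some x) (map Append xs) = 0"
  by (induction xs arbitrary: x) auto

text \<open>Whatever precedes a batch, only its first append can start a run.\<close>

lemma batched_runs: "batched ops d \<Longrightarrow> runs prev ops \<le> d"
proof (induction arbitrary: prev rule: batched.induct)
  case (3 ops d xs)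
  then obtain x ys where xs: "xs = x # ys" by (cases xs) auto
  have "runs prev (map Append xs) \<le> 1" using 3 runs_map_Append[of x ys] xs by auto
  thus ?case using 3(4)[of "last_val prev (map Append xs)"] by (simp add: runs_append)
qed auto

section \<open>The program\<close>

declare add_2_eq_Suc [simp del] add_2_eq_Suc' [simp del]

text \<open>
  Memory layout.  Even addresses below 64 hold global variables: 0 the heap pointer, 2 the number
  of appends, 4 the block size bound, 6 the number of lists, 8 the address of the last list header,
  10 the header of the list used by the preceding append (0 after an extraction), 12 the value of
  that append, 14 the elements still to be consumed when a tree is built.  The heap consists of the
  even addresses from 64 on; fields of a record are two cells apart and 0 is the null pointer.  A
  tree record has the fields height, size, first leaf, last leaf, and then left and right child or,
  for a leaf, key and position.  The address \<open>4 * k + 1\<close> holds \<open>k div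
      2\<close>, as the machine cannot divide.
  The header of the \<open>i\<close>-th list starts at \<open>16 * i + 3\<close>; its fields
      (stack of blocks, pending elements,
  their number, last leaf) are four cells apart.  Register 50 is scratch.
\<close>

definition ld :: "reg \<Rightarrow> nat \<Rightarrow> com"
    where "ld x a = Seq (Const 50 a) (Load x 50)"
definition st :: "nat \<Rightarrow> reg \<Rightarrow> com"
    where "st a y = Seq (Const 50 a) (Store 50 y)"
definition ldf :: "reg \<Rightarrow> reg \<Rightarrow> nat \<Rightarrow> com" where
  "ldf x p c = Seq (Const 50 c) (Seq (Add 50 p 50) (Load x 50))"
definition stf :: "reg \<Rightarrow> nat \<Rightarrow> reg \<Rightarrow> com" where
  "stf p c y = Seq (Const 50 c) (Seq (Add 50 p 50) (Store 50 y))"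
definition addc :: "reg \<Rightarrow> reg \<Rightarrow> nat \<Rightarrow> com"
    where "addc x y c = Seq (Const 50 c) (Add x y 50)"
definition subc :: "reg \<Rightarrow> reg \<Rightarrow> nat \<Rightarrow> com"
    where "subc x y c = Seq (Const 50 c) (Sub x y 50)"
definition ifz :: "reg \<Rightarrow> com \<Rightarrow> com \<Rightarrow> com" where
  "ifz x c1 c2 = Seq (Const 50 0) (Cond (Equal x 50) c1 c2)"

fun seqs :: "com list \<Rightarrow> com" where
  "seqs [] = Skip"
| "seqs [c] = c"
| "seqs (c # d # cs) = Seq c (seqs (d # cs))"

definition c_mk :: com where
  "c_mk = seqs [ld 2 0, Load 3 0, Load 4 1, Cond (Less 3 4) (Move 3 4) Skip, addc 3 3 1,
     ldf 5 0 2, ldf 6 1 2, Add 5 5 6, ldf 6 0 4, ldf 7 1 6,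
     Store 2 3, stf 2 2 5, stf 2 4 6, stf 2 6 7, stf 2 8 0, stf 2 10 1,
     addc 3 2 12, st 0 3, Move 0 2]"

definition c_cons :: com where
  "c_cons = seqs [ld 2 0, Store 2 0, stf 2 2 1, addc 3 2 4, st 0 3, Move 0 2]"

definition c_bal :: com where
  "c_bal = seqs [Load 2 0, Load 3 1, addc 4 2 1, addc 5 3 1,
     Cond (Less 4 3)
       (seqs [ldf 6 1 8, ldf 7 1 10, Load 8 6, Load 9 7,
          Cond (Less 9 8)
            (seqs [ldf 10 6 8, ldf 11 6 10, Call 12 0 [0, 10], Call 13 0 [11, 7], Call 0 0 [12,
                13]])
            (seqs [Call 12 0 [0, 6], Call 0 0 [12, 7]])])
       (Cond (Less 5 2)
         (seqs [ldf 6 0 8, ldf 7 0 10, Load 8 6, Load 9 7,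
            Cond (Less 8 9)
              (seqs [ldf 10 7 8, ldf 11 7 10, Call 12 0 [6, 10], Call 13 0 [11, 1], Call 0 0 [12,
                  13]])
              (seqs [Call 12 0 [7, 1], Call 0 0 [6, 12]])])
         (Call 0 0 [0, 1]))]"

definition c_join :: com where
  "c_join = seqs [Load 2 0, Load 3 1, addc 4 2 1, addc 5 3 1,
     Cond (Less 5 2)
       (seqs [ldf 6 0 8, ldf 7 0 10, Call 8 3 [7, 1], Call 0 2 [6, 8]])
       (Cond (Less 4 3)
         (seqs [ldf 6 1 8, ldf 7 1 10, Call 8 3 [0, 6], Call 0 2 [8, 7]])
         (Call 0 0 [0, 1]))]"

definition c_test :: com where
  "c_test = seqs [ldf 3 0 10,
     Cond (Less 1 3)
       (ifz 2 (Const 0 1) (seqs [ldf 4 0 8, ldf 5 2 8, Cond (Less 5 4) (Const 0 0) (Const 0 1)]))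
       (Const 0 0)]"

definition c_split :: com where
  "c_split = seqs [Load 3 0, ifz 3 (seqs [Const 4 0, Call 0 1 [4, 0]])
     (seqs [ldf 4 0 8, ldf 5 0 10, ldf 6 4 6, Call 7 4 [6, 1, 2],
        ifz 7
          (seqs [Call 8 5 [5, 1, 2], Load 9 8, ldf 10 8 2,
             ifz 9 (Call 0 1 [4, 10]) (seqs [Call 11 3 [4, 9], Call 0 1 [11, 10]])])
          (seqs [Call 8 5 [4, 1, 2], Load 9 8, ldf 10 8 2, Call 11 3 [10, 5], Call 0 1 [9, 11]])])]"

definition c_build :: com where
  "c_build = seqs [Const 1 2,
     Cond (Less 0 1)
       (seqs [ld 2 14, ldf 3 2 2, st 14 3, Load 0 2])
       (seqs [Add 1 0 0, Add 1 1 1, addc 1 1 1, Load 2 1, Sub 3 0 2,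
          Call 4 6 [2], Call 5 6 [3], Call 0 0 [5, 4]])]"

definition c_pushm :: com where
  "c_pushm = ifz 0 (Call 0 1 [1, 0])
     (seqs [Load 2 0, ldf 3 2 2, ldf 4 1 2, Add 3 3 4, ld 4 4,
        Cond (Less 4 3) (Call 0 1 [1, 0])
          (seqs [Call 5 3 [2, 1], ldf 6 0 2, Call 0 1 [5, 6]])])"

definition c_revapp :: com where
  "c_revapp = ifz 0 (Move 0 1) (seqs [Load 2 0, ldf 3 0 2, Call 4 1 [2, 1], Call 0 8 [3, 4]])"

definition c_transfer :: com where
  "c_transfer = seqs [Load 2 1, ldf 3 1 2, Call 4 7 [0, 2],
     ifz 3 (Move 0 4) (seqs [Load 5 3, ldf 6 3 2, Call 7 7 [4, 5], Call 0 8 [6, 7]])]"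

definition c_walk :: com where
  "c_walk = ifz 0 (Call 0 1 [1, 0])
     (seqs [Load 4 0, ldf 5 4 6, Call 6 4 [5, 2, 3],
        ifz 6 (Call 0 1 [1, 0]) (seqs [Call 7 1 [4, 1], ldf 8 0 2, Call 0 10 [8, 7, 2, 3]])])"

definition c_chunks :: com where
  "c_chunks = ifz 0 (Move 0 1)
     (seqs [ld 2 4, Cond (Less 2 0) Skip (Move 2 0), Call 3 6 [2], Call 4 1 [3, 1], Sub 5 0 2,
        Call 0 11 [5, 4]])"

definition c_flush :: com where
  "c_flush = seqs [ldf 1 0 8, ifz 1 (Load 0 0)
     (seqs [ldf 2 0 4, st 14 2, Const 3 0, Call 4 11 [1, 3], Load 5 0, Call 6 9 [5, 4],
        Store 0 6, Const 7 0, stf 0 4 7, stf 0 8 7, Move 0 6])]"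

definition c_cut :: com where
  "c_cut = seqs [Const 5 0, Call 6 10 [0, 5, 1, 2], Load 7 6, ldf 8 6 2,
     ifz 7 (Call 0 1 [7, 0])
       (seqs [Load 9 7, ldf 10 7 2, Call 11 5 [9, 1, 2], Load 12 11, ldf 13 11 2, Call 15 1 [13,
           10],
          ifz 12 (Call 0 1 [15, 8]) (seqs [Call 8 7 [8, 12], Call 0 1 [15, 8]])])]"

definition c_ext :: com where
  "c_ext = seqs [ld 3 8, Cond (Less 3 0) Skip
     (seqs [Call 4 12 [0], Call 5 15 [4, 1, 2], Load 6 5, ldf 7 5 2,
        ifz 6 Skip
          (seqs [Load 8 6, ldf 8 8 4, ldf 1 8 10, ifz 7 (Const 2 0) (seqs [Load 9 7, ldf 2 9 6]),
             subc 10 0 16, Load 11 10, Call 12 9 [11, 6], Load 13 12, ldf 13 13 6,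
             Store 0 7, stf 0 12 2, Store 10 12, stf 10 12 13, addc 14 0 16, Call 15 13 [14, 1,
                 2]])])]"

text \<open>Address 19 is the header of the first list, where the scan stops without a
  comparison.\<close>

definition c_scan :: com where
  "c_scan = seqs [Const 2 19, Cond (Equal 0 2) Skip
     (seqs [subc 3 0 16, ldf 4 3 12, ldf 4 4 8, Cond (Less 4 1) Skip (Call 0 14 [3, 1])])]"

text \<open>The numbers in the \<open>Call\<close> commands are indices into this table.\<close>

definition prog :: "com list" where
  "prog = [c_mk, c_cons, c_bal, c_join, c_test, c_split, c_build, c_pushm, c_revapp, c_transfer,
     c_walk, c_chunks, c_flush, c_ext, c_scan, c_cut]"

lemma prog_nth [simp]:
  "prog ! 0 = c_mk" "prog ! Suc 0 = c_cons" "prog ! 2 = c_bal" "prog ! 3 = c_join"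
      "prog ! 4 = c_test"
  "prog ! 5 = c_split" "prog ! 6 = c_build" "prog ! 7 = c_pushm" "prog ! 8 = c_revapp"
  "prog ! 9 = c_transfer" "prog ! 10 = c_walk" "prog ! 11 = c_chunks" "prog ! 12 = c_flush"
  "prog ! 13 = c_ext" "prog ! 14 = c_scan" "prog ! 15 = c_cut"
  by (simp_all add: prog_def)

lemma length_prog [simp]: "length prog = 16"
  by (simp add: prog_def)

section \<open>Weakest preconditions with running time\<close>

definition wp :: "com \<Rightarrow> (nat \<Rightarrow> regs \<Rightarrow> mem \<Rightarrow> bool)
    \<Rightarrow> regs \<Rightarrow> mem \<Rightarrow> bool" where
  "wp c Q R M \<longleftrightarrow> (\<exists>t R' M'. exec prog c (R, M) t (R',
      M') \<and> Q t R' M')"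

text \<open>Symbolic execution should not enter the continuation before its state is known.\<close>

lemma wp_weak_cong [cong]: "c = c' \<Longrightarrow> R = R' \<Longrightarrow>
    M = M' \<Longrightarrow> wp c Q R M = wp c' Q R' M'"
  by simp

lemma wp_mono: "wp c P R M \<Longrightarrow> (\<And>t R' M'. P t R' M' \<Longrightarrow> Q t R'
    M') \<Longrightarrow> wp c Q R M"
  unfolding wp_def by blast

text \<open>Determinism turns the existential into an equation, so that symbolic execution becomes
  rewriting.\<close>

lemma wp_exec: "exec prog c (R, M) t (R', M') \<Longrightarrow> wp c Q R M = Q t R' M'"
  unfolding wp_def using exec_deterministic by blast

lemma wp_Skip [simp]: "wp Skip Q R M = Q 1 R M"
  by (rule wp_exec[OF exec.Skip])

lemma wp_Const [simp]: "wp (Const x n) Q R M = Q 1 (R(x := Num n)) M"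
  by (rule wp_exec[OF exec.Const])

lemma wp_Move [simp]: "wp (Move x y) Q R M = Q 1 (R(x := R y)) M"
  by (rule wp_exec[OF exec.Move])

lemma wp_execD: "wp c Q R M \<Longrightarrow> \<exists>t s'. exec prog c (R, M) t s'"
  unfolding wp_def by blast

lemma wp_Add [simp]:
  "wp (Add x y z) Q R M = (\<exists>m n. R y = Num m \<and> R z = Num n \<and>
      Q 1 (R(x := Num (m + n))) M)"
proof (cases "\<exists>m n. R y = Num m \<and> R z = Num n")
  case True
  then obtain m n where mn: "R y = Num m" "R z = Num n" by blast
  show ?thesis using wp_exec[OF exec.Add[where R = R and y = y and z = z and x = x
      and M = M, OF mn], of Q] mn by simp
next
  case False
  thus ?thesis by (auto dest!: wp_execD elim!: exec_elims)
qed

lemma wp_Sub [simp]: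
  "wp (Sub x y z) Q R M = (\<exists>m n. R y = Num m \<and> R z = Num n \<and>
      Q 1 (R(x := Num (m - n))) M)"
proof (cases "\<exists>m n. R y = Num m \<and> R z = Num n")
  case True
  then obtain m n where mn: "R y = Num m" "R z = Num n" by blast
  show ?thesis using wp_exec[OF exec.Sub[where R = R and y = y and z = z and x = x
      and M = M, OF mn], of Q] mn by simp
next
  case False
  thus ?thesis by (auto dest!: wp_execD elim!: exec_elims)
qed

lemma wp_Load [simp]: "wp (Load x y) Q R M = (\<exists>a. R y = Num a \<and> Q 1 (R(x := M a)) M)"
proof (cases "\<exists>a. R y = Num a")
  case True
  then obtain a where a: "R y = Num a" by blast
  show ?thesis using wp_exec[OF exec.Load[where R = R and y = y and x = x
      and M = M, OF a], of Q] a by simp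
next
  case False
  thus ?thesis by (auto dest!: wp_execD elim!: exec_elims)
qed

lemma wp_Store [simp]: "wp (Store x y) Q R M = (\<exists>a. R x = Num a \<and> Q 1 R (M(a := R y)))"
proof (cases "\<exists>a. R x = Num a")
  case True
  then obtain a where a: "R x = Num a" by blast
  show ?thesis using wp_exec[OF exec.Store[where R = R and y = y and x = x
      and M = M, OF a], of Q] a by simp
next
  case False
  thus ?thesis by (auto dest!: wp_execD elim!: exec_elims)
qed

lemma wp_Seq [simp]: "wp (Seq c d) Q R M = wp c (\<lambda>t. wp d (\<lambda>u. Q (t + u))) R M"
proof
  assume "wp (Seq c d) Q R M"
  then obtain t R' M' where e: "exec prog (Seq c d) (R, M) t (R', M')" and Q: "Q t R' M'"
    unfolding wp_def by blast
  from e obtain t1 s t2 where s: "t = t1 + t2" "exec prog c (R, M) t1 s" "exec prog d s t2 (R', M')"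
    by (rule exec_elims(8))
  obtain R1 M1 where "s = (R1, M1)" by fastforce
  thus "wp c (\<lambda>t. wp d (\<lambda>u. Q (t + u))) R M" unfolding wp_def using s Q by blast
next
  assume "wp c (\<lambda>t. wp d (\<lambda>u. Q (t + u))) R M"
  thus "wp (Seq c d) Q R M" unfolding wp_def by (blast intro: exec.Seq)
qed

lemma wp_Cond:
  "wp (Cond b c d) Q R M =
     (\<exists>v. holds b R = Some v \<and>
         (if v then wp c (\<lambda>t. Q (1 + t)) R M else wp d (\<lambda>t. Q (1 + t)) R M))"
proof
  assume "wp (Cond b c d) Q R M"
  then obtain t R' M' where e: "exec prog (Cond b c d) (R, M) t (R', M')" and Q: "Q t R' M'"
    unfolding wp_def by blast
  from e Q show "\<exists>v. holds b R = Some v \<and>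
      (if v then wp c (\<lambda>t. Q (1 + t)) R M else wp d (\<lambda>t. Q (1 + t)) R M)"
    unfolding wp_def by (elim exec_elims(9)) (auto 4 4)
next
  assume "\<exists>v. holds b R = Some v \<and>
      (if v then wp c (\<lambda>t. Q (1 + t)) R M else wp d (\<lambda>t. Q (1 + t)) R M)"
  then obtain v where v: "holds b R = Some v"
    "if v then wp c (\<lambda>t. Q (1 + t)) R M else wp d (\<lambda>t. Q (1 + t)) R M" by blast
  show "wp (Cond b c d) Q R M"
  proof (cases v)
    case True
    hence h: "holds b R = Some True" and "wp c (\<lambda>t. Q (1 + t)) R M" using v by simp_all
    then obtain t R' M' where e: "exec prog c (R, M) t (R', M')" and Q: "Q (1 + t) R' M'"
      unfolding wp_def by blast
    show ?thesis using wp_exec[OF exec.CondTrue[OF h e], of d Q] Q by (rule iffD2)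
  next
    case False
    hence h: "holds b R = Some False" and "wp d (\<lambda>t. Q (1 + t)) R M" using v by simp_all
    then obtain t R' M' where e: "exec prog d (R, M) t (R', M')" and Q: "Q (1 + t) R' M'"
      unfolding wp_def by blast
    show ?thesis using wp_exec[OF exec.CondFalse[OF h e], of c Q] Q by (rule iffD2)
  qed
qed

lemma wp_Cond_case [simp]:
  "wp (Cond b c d) Q R M = (case holds b R of None \<Rightarrow> False
     | Some v \<Rightarrow> if v then wp c (\<lambda>t. Q (1 + t)) R M else wp d (\<lambda>t. Q (1
         + t)) R M)"
  by (cases "holds b R") (simp_all add: wp_Cond)

lemma wp_Call [simp]:
  "wp (Call x p ys) Q R M = (p < length prog \<and>
     wp (prog ! p) (\<lambda>t R' M'. Q (1 + length ys + t) (R(x := R' 0)) M') (frame R ys) M)"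
proof
  assume "wp (Call x p ys) Q R M"
  then obtain t R' M' where e: "exec prog (Call x p ys) (R, M) t (R', M')" and Q: "Q t R' M'"
    unfolding wp_def by blast
  from e Q show "p < length prog \<and>
     wp (prog ! p) (\<lambda>t R' M'. Q (1 + length ys + t) (R(x := R' 0)) M') (frame R ys) M"
    unfolding wp_def by (elim exec_elims(10)) auto
next
  assume "p < length prog \<and>
     wp (prog ! p) (\<lambda>t R' M'. Q (1 + length ys + t) (R(x := R' 0)) M') (frame R ys) M"
  then obtain t R' M' where "p < length prog" "exec prog (prog ! p) (frame R ys, M) t (R', M')"
    "Q (1 + length ys + t) (R(x := R' 0)) M'" unfolding wp_def by blast
  thus "wp (Call x p ys) Q R M" unfolding wp_def using exec.Call by blast
qed

lemma frame_simps [simp]: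
  "frame R (y # ys) 0 = R y" "frame R (y # z # ys) (Suc 0) = R z" "frame R (y # z # w # ys) 2 = R w"
  "frame R (y # z # w # v # ys) 3 = R v"
  by (simp_all add: frame_def)

lemma wp_macros [simp]:
  "wp (ld x a) Q R M = Q 2 (R(50 := Num a, x := M a)) M"
  "wp (st a y) Q R M = Q 2 (R(50 := Num a)) (M(a := (R(50 := Num a)) y))"
  "p \<noteq> 50 \<Longrightarrow> wp (ldf x p c) Q R M = (\<exists>a. R p = Num a \<and>
      Q 3 (R(50 := Num (a + c), x := M (a + c))) M)"
  "p \<noteq> 50 \<Longrightarrow> y \<noteq> 50 \<Longrightarrow> wp (stf p c y) Q R M =
     (\<exists>a. R p = Num a \<and> Q 3 (R(50 := Num (a + c))) (M(a + c := R y)))"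
  "y \<noteq> 50 \<Longrightarrow> wp (addc x y c) Q R M =
     (\<exists>a. R y = Num a \<and> Q 2 (R(50 := Num c, x := Num (a + c))) M)"
  "y \<noteq> 50 \<Longrightarrow> wp (subc x y c) Q R M =
     (\<exists>a. R y = Num a \<and> Q 2 (R(50 := Num c, x := Num (a - c))) M)"
  "x \<noteq> 50 \<Longrightarrow> R x = Num a \<Longrightarrow> wp (ifz x c1 c2) Q R M =
     (if a = 0 then wp c1 (\<lambda>t. Q (1 + (1 + t))) (R(50 := Num 0)) M
      else wp c2 (\<lambda>t. Q (1 + (1 + t))) (R(50 := Num 0)) M)"
  unfolding ld_def st_def ldf_def stf_def addc_def subc_def ifz_def wp_Seq wp_Const wp_Load wp_Store
    wp_Add wp_Sub wp_Cond_case
  by (simp_all del: One_nat_def)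

section \<open>Heap discipline and representation predicates\<close>

definition hp :: "mem \<Rightarrow> nat" where
  "hp M = (case M 0 of Num n \<Rightarrow> n | _ \<Rightarrow> 0)"

definition heapok :: "mem \<Rightarrow> bool" where
  "heapok M \<longleftrightarrow> M 0 = Num (hp M) \<and> even (hp M) \<and> 64 \<le> hp M"

text \<open>The heap only grows, so freezing its allocated cells keeps every tree and linked list
  valid, shared or not; globals, headers and the table of halves may change.\<close>

definition pres :: "mem \<Rightarrow> mem \<Rightarrow> bool" where
  "pres M M' \<longleftrightarrow> heapok M' \<and> hp M \<le> hp M' \<and>
      (\<forall>a. even a \<and> 64 \<le> a \<and> a < hp M \<longrightarrow> M' a = M a)"

text \<open>Stronger than \<open>pres\<close>: of the cells outside the heap only the heap pointer
  may change. This describes the procedures that merely allocate.\<close>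

definition grows :: "mem \<Rightarrow> mem \<Rightarrow> bool" where
  "grows M M' \<longleftrightarrow> heapok M' \<and> hp M \<le> hp M' \<and>
      (\<forall>a. a \<noteq> 0 \<and> (odd a \<or> a < hp M) \<longrightarrow> M' a = M a)"

lemma growsD:
  assumes "grows M M'"
  shows "heapok M'" "hp M \<le> hp M'" "a \<noteq> 0 \<Longrightarrow>
      odd a \<or> a < hp M \<Longrightarrow> M' a = M a"
  using assms unfolding grows_def by blast+

lemma presD:
  assumes "pres M M'"
  shows "heapok M'" "hp M \<le> hp M'" "even a \<Longrightarrow>
      64 \<le> a \<Longrightarrow> a < hp M \<Longrightarrow> M' a = M a"
  using assms unfolding pres_def by blast+

lemma grows_pres: "grows M M' \<Longrightarrow> pres M M'"
  unfolding pres_def using growsD[of M M'] by simp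

lemma grows_refl: "heapok M \<Longrightarrow> grows M M"
  by (simp add: grows_def)

lemma grows_trans:
  assumes "grows M M'" "grows M' M''"
  shows "grows M M''"
  unfolding grows_def
proof (intro conjI allI impI)
  fix a assume a: "a \<noteq> 0 \<and> (odd a \<or> a < hp M)"
  hence "odd a \<or> a < hp M'" using growsD(2)[OF assms(1)] by linarith
  thus "M'' a = M a" using growsD(3)[OF assms(1), of a] growsD(3)[OF assms(2), of a] a by simp
qed (use growsD(1,2)[OF assms(1)] growsD(1,2)[OF assms(2)] in linarith)+

lemma grows_eq: "grows M M' \<Longrightarrow> heapok M \<Longrightarrow>
    a \<noteq> 0 \<Longrightarrow> odd a \<or> a < 64 \<Longrightarrow> M' a = M a"
  using growsD(3)[of M M' a] unfolding heapok_def by linarith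

lemma pres_refl: "heapok M \<Longrightarrow> pres M M"
  by (simp add: pres_def)

lemma pres_trans:
  assumes "pres M M'" "pres M' M''"
  shows "pres M M''"
  unfolding pres_def
proof (intro conjI allI impI)
  fix a assume a: "even a \<and> 64 \<le> a \<and> a < hp M"
  hence "a < hp M'" using presD(2)[OF assms(1)] by linarith
  thus "M'' a = M a" using presD(3)[OF assms(1), of a] presD(3)[OF assms(2), of a] a by simp
qed (use presD(1,2)[OF assms(1)] presD(1,2)[OF assms(2)] in linarith)+

lemma hp_upd: "0 < a \<Longrightarrow> hp (M(a := v)) = hp M"
  by (simp add: hp_def)

lemma pres_upd:
  assumes "pres M M'" "odd a \<or> 0 < a \<and> a < 64"
  shows "pres M (M'(a := v))"
  unfolding pres_def
proof (intro conjI allI impI)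
  have a: "0 < a" using assms(2) by (cases a) auto
  show "heapok (M'(a := v))" using presD(1)[OF assms(1)] a by (simp add: heapok_def hp_upd)
  show "hp M \<le> hp (M'(a := v))" using presD(2)[OF assms(1)] a by (simp add: hp_upd)
  fix b assume "even b \<and> 64 \<le> b \<and> b < hp M"
  moreover from this have "b \<noteq> a" using assms(2) by auto
  ultimately show "(M'(a := v)) b = M b" using presD(3)[OF assms(1)] by simp
qed

definition blk :: "mem \<Rightarrow> nat \<Rightarrow> nat \<Rightarrow> bool" where
  "blk M p n \<longleftrightarrow> even p \<and> 64 \<le> p \<and> p + 2 * n \<le> hp M"

definition leaf_at :: "mem \<Rightarrow> nat \<Rightarrow> elem \<Rightarrow> bool" where
  "leaf_at M p x \<longleftrightarrow> blk M p 6 \<and> M p = Num 0 \<and>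
      M (p + 2) = Num 1 \<and> M (p + 4) = Num p \<and>
     M (p + 6) = Num p \<and> M (p + 8) = Key (key x) \<and> M (p + 10) = Num (pos x)"

text \<open>The pointers to the two extreme leaves give \<open>tfirst\<close> and
  \<open>tlast\<close> in constant time, as the cost model of splitting and popping
  presupposes.\<close>

fun tree_at :: "mem \<Rightarrow> nat \<Rightarrow> tree \<Rightarrow> bool" where
  "tree_at M p (Lf x) = leaf_at M p x"
| "tree_at M p (Nd l r) \<longleftrightarrow> blk M p 6 \<and>
    M p = Num (ht (Nd l r)) \<and> M (p + 2) = Num (sz (Nd l r)) \<and>
     (\<exists>f. M (p + 4) = Num f \<and> leaf_at M f (tfirst l)) \<and>
         (\<exists>g. M (p + 6) = Num g \<and> leaf_at M g (tlast r)) \<and>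
     (\<exists>a. M (p + 8) = Num a \<and> tree_at M a l) \<and>
         (\<exists>b. M (p + 10) = Num b \<and> tree_at M b r)"

fun list_at :: "(mem \<Rightarrow> nat \<Rightarrow> 'a \<Rightarrow> bool) \<Rightarrow> mem
    \<Rightarrow> nat \<Rightarrow> 'a list \<Rightarrow> bool" where
  "list_at A M p [] \<longleftrightarrow> p = 0"
| "list_at A M p (x # xs) \<longleftrightarrow> blk M p 2 \<and>
    (\<exists>a. M p = Num a \<and> A M a x) \<and>
     (\<exists>q. M (p + 2) = Num q \<and> list_at A M q xs)"

lemma pres_eq: "pres M M' \<Longrightarrow> blk M p n \<Longrightarrow>
    even k \<Longrightarrow> k < 2 * n \<Longrightarrow> M' (p + k) = M (p + k)"
  by (auto simp: pres_def blk_def)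

lemma pres_eq0: "pres M M' \<Longrightarrow> blk M p n \<Longrightarrow>
    0 < n \<Longrightarrow> M' p = M p"
  using pres_eq[of M M' p n 0] by simp

lemma pres_blk: "pres M M' \<Longrightarrow> blk M p n \<Longrightarrow> blk M' p n"
  by (auto simp: pres_def blk_def)

lemma leaf_at_pres: "pres M M' \<Longrightarrow> leaf_at M p x \<Longrightarrow> leaf_at M' p x"
proof -
  assume p: "pres M M'" and l: "leaf_at M p x"
  have b: "blk M p 6" using l by (simp add: leaf_at_def)
  show ?thesis using l by (simp add: leaf_at_def pres_eq[OF p b] pres_eq0[OF p b] pres_blk[OF p b])
qed

lemma tree_at_pres: "pres M M' \<Longrightarrow> tree_at M p t \<Longrightarrow> tree_at M' p t"
proof (induction t arbitrary: p)
  case (Lf x)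
  thus ?case by (simp add: leaf_at_pres)
next
  case (Nd l r)
  have "blk M p 6" using Nd.prems by simp
  note e = pres_eq[OF Nd.prems(1) this] pres_eq0[OF Nd.prems(1) this] pres_blk[OF Nd.prems(1) this]
  show ?case using Nd leaf_at_pres[OF Nd.prems(1)] by (auto simp: e)
qed

lemma list_at_pres:
  assumes "pres M M'" "\<And>p x. A M p x \<Longrightarrow> A M' p x" "list_at A M p xs"
  shows "list_at A M' p xs"
  using assms(3)
proof (induction xs arbitrary: p)
  case (Cons x xs)
  have "blk M p 2" using Cons.prems by simp
  note e = pres_eq[OF assms(1) this] pres_eq0[OF assms(1) this] pres_blk[OF assms(1) this]
  show ?case using Cons assms(2) by (auto simp: e)
qed simp

lemma trees_at_pres: "pres M M' \<Longrightarrow>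
    list_at tree_at M p ts \<Longrightarrow> list_at tree_at M' p ts"
  by (rule list_at_pres[of M M' tree_at]) (auto intro: tree_at_pres)

lemma leaves_at_pres: "pres M M' \<Longrightarrow>
    list_at leaf_at M p xs \<Longrightarrow> list_at leaf_at M' p xs"
  by (rule list_at_pres[of M M' leaf_at]) (auto intro: leaf_at_pres)

lemmas pres_intros = tree_at_pres leaf_at_pres trees_at_pres leaves_at_pres

lemma tree_at_pos: "tree_at M p t \<Longrightarrow> 0 < p"
  by (cases t) (auto simp: blk_def leaf_at_def)

lemma leaf_at_pos: "leaf_at M p x \<Longrightarrow> 0 < p"
  by (auto simp: blk_def leaf_at_def)

lemma tree_at_fields:
  assumes "tree_at M p t"
  obtains f g where "blk M p 6" "M p = Num (ht t)" "M (p + 2) = Num (sz t)"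
    "M (p + 4) = Num f" "leaf_at M f (tfirst t)" "M (p + 6) = Num g" "leaf_at M g (tlast t)"
proof (cases t)
  case (Lf x)
  thus ?thesis using assms that[of p p] by (simp add: leaf_at_def)
next
  case (Nd l r)
  thus ?thesis using assms that by auto
qed

abbreviation rets :: "mem \<Rightarrow> (mem \<Rightarrow> nat \<Rightarrow> bool) \<Rightarrow>
    nat \<Rightarrow> nat \<Rightarrow> regs \<Rightarrow> mem \<Rightarrow> bool" where
  "rets M A n \<equiv> \<lambda>t R' M'. \<exists>s. R' 0 = Num s \<and> grows M M' \<and>
      A M' s \<and> t \<le> n"

lemma wp_mk:
  assumes "heapok M" "tree_at M p l" "tree_at M q r" "F 0 = Num p" "F (Suc 0) = Num q"
  shows "wp c_mk (rets M (\<lambda>M' s. tree_at M' s (Nd l r)) 60) F M"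
proof -
  obtain f g where l: "M p = Num (ht l)" "M (p + 2) = Num (sz l)"
    "M (p + 4) = Num f" "leaf_at M f (tfirst l)" "M (p + 6) = Num g"
    using tree_at_fields[OF assms(2)] by metis
  obtain f' g' where r: "M q = Num (ht r)" "M (q + 2) = Num (sz r)"
    "M (q + 4) = Num f'" "M (q + 6) = Num g'" "leaf_at M g' (tlast r)"
    using tree_at_fields[OF assms(3)] by metis
  define H where "H = hp M"
  have H: "M 0 = Num H" "64 \<le> H" "even H" using assms(1) by (auto simp: heapok_def H_def)
  define M' where "M' = M(H := Num (1 + max (ht l) (ht r)), H + 2 := Num (sz l + sz r),
      H + 4 := Num f,
     H + 6 := Num g', H + 8 := Num p, H + 10 := Num q, 0 := Num (H + 12))"
  have hp': "hp M' = H + 12" by (simp add: hp_def M'_def)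
  have g: "grows M M'" unfolding grows_def heapok_def hp' H_def[symmetric]
    using H by (auto simp: M'_def)
  note p = grows_pres[OF g]
  have t: "tree_at M' H (Nd l r)"
  proof -
    have "M' H = Num (ht (Nd l r))" "M' (H + 2) = Num (sz (Nd l r))" "M' (H + 4) = Num f"
      "M' (H + 6) = Num g'" "M' (H + 8) = Num p" "M' (H + 10) = Num q"
      using H(2) by (simp_all add: M'_def)
    moreover have "blk M' H 6" using H by (simp add: blk_def hp')
    ultimately show ?thesis
      using tree_at_pres[OF p assms(2)] tree_at_pres[OF p assms(3)] leaf_at_pres[OF p l(4)]
        leaf_at_pres[OF p r(5)] by simp
  qed
  have "wp c_mk (\<lambda>t R' N. t \<le> 60 \<and> R' 0 = Num H \<and> N = M') F M"
    unfolding c_mk_def using H(1) l(1-3) r(1,2,4) assms(4,5)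
    by (cases "ht l < ht r") (simp_all add: M'_def max_def)
  thus ?thesis by (rule wp_mono) (use g t in blast)
qed

section \<open>Correctness of the tree procedures\<close>

declare wp_Call [simp del] tree_at.simps [simp del] list_at.simps [simp del]

lemma tree_at_grows: "grows M M' \<Longrightarrow> tree_at M p t \<Longrightarrow> tree_at M' p t"
  using tree_at_pres grows_pres by blast

lemma leaf_at_grows: "grows M M' \<Longrightarrow> leaf_at M p t \<Longrightarrow> leaf_at M' p t"
  using leaf_at_pres grows_pres by blast

lemma trees_at_grows: "grows M M' \<Longrightarrow>
    list_at tree_at M p t \<Longrightarrow> list_at tree_at M' p t"
  using trees_at_pres grows_pres by blast

lemma leaves_at_grows: "grows M M' \<Longrightarrow>
    list_at leaf_at M p t \<Longrightarrow> list_at leaf_at M' p t"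
  using leaves_at_pres grows_pres by blast

lemmas gi = tree_at_grows leaf_at_grows trees_at_grows leaves_at_grows growsD(1)

lemma wp_Call_rets:
  assumes "wp c (rets M A n) (frame R ys) M" "p < length prog" "prog ! p = c" "k = 1 + length ys"
    "\<And>t s M'. grows M M' \<Longrightarrow> A M' s \<Longrightarrow>
        t \<le> n \<Longrightarrow> Q (k + t) (R(x := Num s)) M'"
  shows "wp (Call x p ys) Q R M"
proof -
  have "wp c (\<lambda>t R' M'. Q (1 + length ys + t) (R(x := R' 0)) M') (frame R ys) M"
    by (rule wp_mono[OF assms(1)]) (use assms(4,5) in auto)
  thus ?thesis unfolding wp_Call using assms(2,3) by simp
qed

lemma call_mk:
  assumes "R a = Num p" "R b = Num q" "heapok M" "tree_at M p l" "tree_at M q r"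
    "\<And>t s M'. grows M M' \<Longrightarrow> tree_at M' s (Nd l r) \<Longrightarrow> t \<le> 60
        \<Longrightarrow> Q (3 + t) (R(x := Num s)) M'"
  shows "wp (Call x 0 [a, b]) Q R M"
  by (rule wp_Call_rets[OF wp_mk[OF assms(3-5)], where k = 3]) (use assms(1,2,6) in auto)

text \<open>A cons cell also serves as the result of procedures that return two values.\<close>

definition pair_at :: "mem \<Rightarrow> nat \<Rightarrow> nat \<Rightarrow> nat \<Rightarrow>
    bool" where
  "pair_at M s a b \<longleftrightarrow> blk M s 2 \<and> M s = Num a \<and> M (s + 2) = Num b"

lemma pair_at_grows: "grows M M' \<Longrightarrow>
    pair_at M s a b \<Longrightarrow> pair_at M' s a b"
proof -
  assume g: "grows M M'" and p: "pair_at M s a b"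
  note p' = grows_pres[OF g]
  have b: "blk M s 2" using p by (simp add: pair_at_def)
  show ?thesis using p by (simp add: pair_at_def pres_eq[OF p' b] pres_eq0[OF p' b] pres_blk[OF p'
      b])
qed

lemma wp_cons:
  assumes "heapok M" "F 0 = Num a" "F (Suc 0) = Num b"
  shows "wp c_cons (rets M (\<lambda>M' s. pair_at M' s a b) 12) F M"
proof -
  define H where "H = hp M"
  have H: "M 0 = Num H" "64 \<le> H" "even H" using assms(1) by (auto simp: heapok_def H_def)
  define M' where "M' = M(H := Num a, H + 2 := Num b, 0 := Num (H + 4))"
  have hp': "hp M' = H + 4" by (simp add: hp_def M'_def)
  have g: "grows M M'" unfolding grows_def heapok_def hp' H_def[symmetric]
    using H by (auto simp: M'_def)
  have t: "pair_at M' H a b" using H by (simp add: pair_at_def blk_def hp') (simp add: M'_def)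
  have "wp c_cons (\<lambda>t R' N. t \<le> 12 \<and> R' 0 = Num H \<and> N = M') F M"
    unfolding c_cons_def using H(1) assms(2,3) by (simp add: M'_def)
  thus ?thesis by (rule wp_mono) (use g t in blast)
qed

lemma call_cons:
  assumes "R a = Num p" "R b = Num q" "heapok M"
    "\<And>t s M'. grows M M' \<Longrightarrow> pair_at M' s p q \<Longrightarrow> t \<le> 12
        \<Longrightarrow> Q (3 + t) (R(x := Num s)) M'"
  shows "wp (Call x (Suc 0) [a, b]) Q R M"
  by (rule wp_Call_rets[OF wp_cons[OF assms(3)], where k = 3]) (use assms(1,2,4) in auto)

lemma pair_list_at: "pair_at M s p q \<Longrightarrow>
    A M p x \<Longrightarrow> list_at A M q xs \<Longrightarrow> list_at A M s (x # xs)"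
  by (auto simp: pair_at_def list_at.simps)

lemma wp_bal:
  assumes h: "heapok M" and l: "tree_at M p l" and r: "tree_at M q r"
    and F: "F 0 = Num p" "F (Suc 0) = Num q"
  shows "wp c_bal (rets M (\<lambda>M' s. tree_at M' s (bal l r)) 250) F M"
proof -
  have hl: "M p = Num (ht l)" and hr: "M q = Num (ht r)"
    using tree_at_fields[OF l] tree_at_fields[OF r] by metis+
  consider (right) "ht l + 1 < ht r" | (left) "ht r + 1 < ht l" | (none)
      "\<not> ht l + 1 < ht r" "\<not> ht r + 1 < ht l"
    by blast
  thus ?thesis
  proof cases
    case right
    then obtain rl rr where R: "r = Nd rl rr" by (cases r) auto
    obtain a b where ab: "M (q + 8) = Num a" "tree_at M a rl" "M (q + 10) = Num b" "tree_at M b rr"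
      using r R by (auto simp: tree_at.simps)
    have hab: "M a = Num (ht rl)" "M b = Num (ht rr)"
      using tree_at_fields[OF ab(2)] tree_at_fields[OF ab(4)] by metis+
    show ?thesis
    proof (cases "ht rr < ht rl")
      case True
      then obtain x y where RL: "rl = Nd x y" by (cases rl) auto
      obtain c d where cd: "M (a + 8) = Num c" "tree_at M c x" "M (a + 10) = Num d" "tree_at M d y"
        using ab RL by (auto simp: tree_at.simps)
      have B: "bal l r = Nd (Nd l x) (Nd y rr)" using right True R RL by (simp add: bal_def)
      show ?thesis unfolding c_bal_def B
        using right True hl hr hab ab(1,3) cd(1,3) F
        apply simp?
        apply ((rule call_mk[OF _ _ h l cd(2)], simp, simp), simp?)
        apply (rule call_mk[where l = y
            and r = rr], simp, simp, blast intro: gi, use cd(4) in \<open>blast intro: gi\<close>,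
            use ab(4) in \<open>blast intro: gi\<close>)
        apply simp?
        apply (rule call_mk[where l = "Nd l x"
            and r = "Nd y rr"], simp, simp, blast intro: gi, blast intro: gi, blast intro: gi)
        apply (auto intro: grows_trans)
        done
    next
      case False
      have B: "bal l r = Nd (Nd l rl) rr" using right False R by (cases rl) (auto simp: bal_def)
      show ?thesis unfolding c_bal_def B
        using right False hl hr hab ab(1,3) F
        apply simp?
        apply ((rule call_mk[OF _ _ h l ab(2)], simp, simp), simp?)
        apply (rule call_mk[where l = "Nd l rl"
            and r = rr], simp, simp, blast intro: gi, blast intro: gi,
            use ab(4) in \<open>blast intro: gi\<close>)
        apply (auto intro: grows_trans)
        done
    qed
  next
    case left
    then obtain ll lr where R: "l = Nd ll lr" by (cases l) auto
    obtain a b where ab: "M (p + 8) = Num a" "tree_at M a ll" "M (p + 10) = Num b" "tree_at M b lr"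
      using l R by (auto simp: tree_at.simps)
    have hab: "M a = Num (ht ll)" "M b = Num (ht lr)"
      using tree_at_fields[OF ab(2)] tree_at_fields[OF ab(4)] by metis+
    show ?thesis
    proof (cases "ht ll < ht lr")
      case True
      then obtain x y where RL: "lr = Nd x y" by (cases lr) auto
      obtain c d where cd: "M (b + 8) = Num c" "tree_at M c x" "M (b + 10) = Num d" "tree_at M d y"
        using ab RL by (auto simp: tree_at.simps)
      have B: "bal l r = Nd (Nd ll x) (Nd y r)" using left True R RL by (simp add: bal_def)
      show ?thesis unfolding c_bal_def B
        using left True hl hr hab ab(1,3) cd(1,3) F
        apply simp?
        apply ((rule call_mk[OF _ _ h ab(2) cd(2)], simp, simp), simp?)
        apply (rule call_mk[where l = y
            and r = r], simp, simp, blast intro: gi, use cd(4) in \<open>blast intro: gi\<close>,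
            use r in \<open>blast intro: gi\<close>)
        apply simp?
        apply (rule call_mk[where l = "Nd ll x"
            and r = "Nd y r"], simp, simp, blast intro: gi, blast intro: gi, blast intro: gi)
        apply (auto intro: grows_trans)
        done
    next
      case False
      have B: "bal l r = Nd ll (Nd lr r)" using left False R by (cases lr) (auto simp: bal_def)
      show ?thesis unfolding c_bal_def B
        using left False hl hr hab ab(1,3) F
        apply simp?
        apply ((rule call_mk[OF _ _ h ab(4) r], simp, simp), simp?)
        apply (rule call_mk[where l = ll
            and r = "Nd lr r"], simp, simp, blast intro: gi,
            use ab(2) in \<open>blast intro: gi\<close>,
            blast intro: gi)
        apply (auto intro: grows_trans)
        done
    qed
  next
    case none
    have B: "bal l r = Nd l r" using none by (simp add: bal_def)
    show ?thesis unfolding c_bal_def B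
      using none hl hr F
      apply simp?
      apply ((rule call_mk[OF _ _ h l r], simp, simp), (auto intro: grows_trans))
      done
  qed
qed

lemma call_bal:
  assumes "R a = Num p" "R b = Num q" "heapok M" "tree_at M p l" "tree_at M q r"
    "\<And>t s M'. grows M M' \<Longrightarrow> tree_at M' s (bal l r) \<Longrightarrow> t \<le>
        250 \<Longrightarrow> Q (3 + t) (R(x := Num s)) M'"
  shows "wp (Call x 2 [a, b]) Q R M"
  by (rule wp_Call_rets[OF wp_bal[OF assms(3-5)], where k = 3]) (use assms(1,2,6) in auto)

lemma wp_join:
  "heapok M \<Longrightarrow> tree_at M p l \<Longrightarrow>
      tree_at M q r \<Longrightarrow> avl l \<Longrightarrow>
      avl r \<Longrightarrow> F 0 = Num p \<Longrightarrow> F (Suc 0) = Num q \<Longrightarrow>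
     wp c_join (rets M (\<lambda>M' s. tree_at M' s (join l r)) (300 * join_cost l r)) F M"
proof (induction l r arbitrary: M p q F rule: join.induct)
  case (1 l r)
  note h = "1.prems"(1) and l = "1.prems"(2) and r = "1.prems"(3) and F = "1.prems"(6,7)
  have hl: "M p = Num (ht l)" and hr: "M q = Num (ht r)"
    using tree_at_fields[OF l] tree_at_fields[OF r] by metis+
  consider (left) "ht r + 1 < ht l" | (right) "ht l + 1 < ht r" | (none)
      "\<not> ht l + 1 < ht r" "\<not> ht r + 1 < ht l"
    by blast
  thus ?case
  proof cases
    case left
    then obtain a b where L: "l = Nd a b" by (cases l) auto
    obtain u v where uv: "M (p + 8) = Num u" "tree_at M u a" "M (p + 10) = Num v" "tree_at M v b"
      using l L by (auto simp: tree_at.simps)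
    have av: "avl b" "ht r \<le> ht b" "ht b < ht l" using "1.prems" L left by auto
    have J: "join l r = bal a (join b r)" using left L by (subst join.simps) simp
    \<comment> \<open>One level of recursion lowers \<open>join_cost\<close> by at least 1, since
      \<open>b\<close> is lower than \<open>l\<close> but not lower than \<open>r\<close>; the 300
      units gained pay for one rebalancing and the calls.\<close>
    have c: "300 * join_cost b r + 300 \<le> 300 * join_cost l r" using av by simp
    note IH = "1.IH"(1)[OF left L h uv(4) r av(1) "1.prems"(5)]
    show ?thesis unfolding c_join_def J
      using left hl hr uv(1,3) F
      apply simp?
      apply ((rule wp_Call_rets[OF IH, where k = 3], simp, simp, simp, simp, simp), simp?)
      apply (rule call_bal[where l = a and r = "join b r"], simp, simp, blast intro: gi,
          use uv(2) in \<open>blast intro: gi\<close>, blast)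
      apply simp?
      apply (use c in \<open>auto intro: grows_trans\<close>)
      done
  next
    case right
    have nl: "\<not> ht r + 1 < ht l" using right by simp
    obtain a b where L: "r = Nd a b" using right by (cases r) auto
    obtain u v where uv: "M (q + 8) = Num u" "tree_at M u a" "M (q + 10) = Num v" "tree_at M v b"
      using r L by (auto simp: tree_at.simps)
    have av: "avl a" "ht l \<le> ht a" "ht a < ht r" using "1.prems" L right by auto
    have J: "join l r = bal (join l a) b" using right L by (subst join.simps) simp
    have c: "300 * join_cost l a + 300 \<le> 300 * join_cost l r" using av by simp
    note IH = "1.IH"(2)[OF nl right L h l uv(2) "1.prems"(4) av(1)]
    show ?thesis unfolding c_join_def J
      using right nl hl hr uv(1,3) F
      apply simp?
      apply ((rule wp_Call_rets[OF IH, where k = 3], simp, simp, simp, simp, simp), simp?)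
      apply (rule call_bal[where l = "join l a" and r = b], simp, simp, blast intro: gi, blast,
          use uv(4) in \<open>blast intro: gi\<close>)
      apply simp?
      apply (use c in \<open>auto intro: grows_trans\<close>)
      done
  next
    case none
    have J: "join l r = Nd l r" using none by (subst join.simps) simp
    show ?thesis unfolding c_join_def J
      using none hl hr F
      apply simp?
      apply ((rule call_mk[OF _ _ h l r], simp, simp), auto)
      done
  qed
qed

lemma call_join:
  assumes "R a = Num p" "R b = Num q" "heapok M" "tree_at M p l" "tree_at M q r" "avl l" "avl r"
    "\<And>t s M'. grows M M' \<Longrightarrow> tree_at M' s (join l r) \<Longrightarrow> t \<le>
        300 * join_cost l r \<Longrightarrow> Q (3 + t) (R(x := Num s)) M'"
  shows "wp (Call x 3 [a, b]) Q R M"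
  by (rule wp_Call_rets[OF wp_join[OF assms(3-7)], where k = 3]) (use assms(1,2,8) in auto)

definition oleaf_at :: "mem \<Rightarrow> nat \<Rightarrow> elem option \<Rightarrow> bool" where
  "oleaf_at M q vo = (case vo of None \<Rightarrow> q = 0 | Some v \<Rightarrow> leaf_at M q v)"

lemma oleaf_at_grows: "grows M M' \<Longrightarrow>
    oleaf_at M q vo \<Longrightarrow> oleaf_at M' q vo"
  by (cases vo) (auto simp: oleaf_at_def intro: leaf_at_grows)

lemma wp_test:
  assumes "heapok M" "leaf_at M a x" "oleaf_at M q vo"
    "F 0 = Num a" "F (Suc 0) = Num p" "F 2 = Num q"
  shows "wp c_test (rets M (\<lambda>M' s. M' = M \<and>
      s = (if cutp p vo x then 1 else 0)) 20) F M"
proof -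
  have a: "M (a + 10) = Num (pos x)" "M (a + 8) = Key (key x)" using assms(2)
      by (auto simp: leaf_at_def)
  show ?thesis
  proof (cases vo)
    case None
    hence "q = 0" using assms(3) by (simp add: oleaf_at_def)
    thus ?thesis unfolding c_test_def
      using assms(4-6) a None grows_refl[OF assms(1)] by (simp add: cutp_def)
  next
    case (Some v)
    hence v: "leaf_at M q v" using assms(3) by (simp add: oleaf_at_def)
    hence "M (q + 8) = Key (key v)" "0 < q" by (auto simp: leaf_at_def blk_def)
    thus ?thesis unfolding c_test_def
      using assms(4-6) a Some grows_refl[OF assms(1)] by (simp add: cutp_def)
  qed
qed

lemma call_test:
  assumes "R a = Num l" "R b = Num p" "R c = Num q" "heapok M" "leaf_at M l y" "oleaf_at M q vo"
    "\<And>t. t \<le> 20 \<Longrightarrow> Q (4 + t) (R(x := Num (if cutp p vo y then 1 else 0))) M"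
  shows "wp (Call x 4 [a, b, c]) Q R M"
  by (rule wp_Call_rets[OF wp_test[OF assms(4-6)], where k = 4]) (use assms(1-3,7) in auto)

definition otree_at :: "mem \<Rightarrow> nat \<Rightarrow> tree option \<Rightarrow> bool" where
  "otree_at M q vo = (case vo of None \<Rightarrow> q = 0 | Some v \<Rightarrow> tree_at M q v)"

lemma otree_at_grows: "grows M M' \<Longrightarrow>
    otree_at M q vo \<Longrightarrow> otree_at M' q vo"
  by (cases vo) (auto simp: otree_at_def intro: tree_at_grows)

definition split_at :: "mem \<Rightarrow> nat \<Rightarrow> tree option \<times> tree
    \<Rightarrow> bool" where
  "split_at M s x \<longleftrightarrow> (\<exists>a b. pair_at M s a b \<and>
      otree_at M a (fst x) \<and> tree_at M b (snd x))"

lemmas gi2 = gi oleaf_at_grows otree_at_grows pair_at_grows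

lemma wp_split:
  "heapok M \<Longrightarrow> tree_at M a t \<Longrightarrow>
      oleaf_at M q vo \<Longrightarrow> avl t \<Longrightarrow>
     F 0 = Num a \<Longrightarrow> F (Suc 0) = Num p \<Longrightarrow> F 2 = Num q \<Longrightarrow>
     wp c_split (rets M (\<lambda>M' s. split_at M' s (split (cutp p vo) t)) (400 * split_cost
         (cutp p vo) t)) F M"
proof (induction t arbitrary: M a F)
  case (Lf x)
  have "M a = Num 0" using Lf.prems(2) by (simp add: tree_at.simps leaf_at_def)
  thus ?case unfolding c_split_def using Lf.prems
    apply simp?
    apply (rule call_cons, simp, simp, assumption)
    apply (auto simp: split_at_def otree_at_def pair_at_def intro: gi)
    done
next
  case (Nd l r)
  note h = Nd.prems(1) and q = Nd.prems(3) and F = Nd.prems(5-7)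
  obtain u v where uv: "M a = Num (ht (Nd l r))" "M (a + 8) = Num u" "tree_at M u l"
      "M (a + 10) = Num v" "tree_at M v r"
    using Nd.prems(2) by (auto simp: tree_at.simps)
  obtain g where g: "M (u + 6) = Num g" "leaf_at M g (tlast l)" using tree_at_fields[OF uv(3)]
      by metis
  have av: "avl l" "avl r" using Nd.prems by auto
  show ?case
  proof (cases "cutp p vo (tlast l)")
    case True
    have avb: "avl (snd (split (cutp p vo) l))" using split_avl[OF av(1)] by blast
    show ?thesis unfolding c_split_def using F uv(1,2,4) g(1) True
      apply simp?
      apply ((rule call_test[OF _ _ _ h g(2) q], simp, simp, simp), simp?)
      apply (rule wp_Call_rets[OF Nd.IH(1)[OF h uv(3) q av(1)],
          where k = 4], simp, simp, simp, simp, simp, simp)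
      apply (clarsimp simp: split_at_def pair_at_def)
      apply (rule call_join[where l = "snd (split (cutp p vo) l)"
          and r = r], simp, simp, blast intro: gi, blast,
          use uv(5) in \<open>blast intro: gi\<close>, rule avb, rule av(2))
      apply simp?
      apply ((rule call_cons, simp, simp, blast intro: gi), (simp add: pair_at_def[symmetric]))
      apply ((intro conjI), (blast intro: grows_trans), (auto simp: pair_at_def intro: gi2))
      done
  next
    case False
    show ?thesis
    proof (cases "fst (split (cutp p vo) r)")
      case None
      show ?thesis unfolding c_split_def using F uv(1,2,4) g(1) False None
        apply simp?
        apply ((rule call_test[OF _ _ _ h g(2) q], simp, simp, simp), simp?)
        apply (rule wp_Call_rets[OF Nd.IH(2)[OF h uv(5) q av(2)],
            where k = 4], simp, simp, simp, simp, simp, simp)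
        apply (clarsimp simp: split_at_def pair_at_def otree_at_def)
        apply ((rule call_cons, simp, simp, blast intro: gi), (simp add: pair_at_def[symmetric]))
        apply ((intro conjI), (blast intro: grows_trans))
        apply (use uv(3) in \<open>auto simp: pair_at_def intro: gi2\<close>)
        done
    next
      case (Some b)
      have avb: "avl b" using split_avl[OF av(2)] Some by blast
      show ?thesis unfolding c_split_def using F uv(1,2,4) g(1) False Some
        apply simp?
        apply ((rule call_test[OF _ _ _ h g(2) q], simp, simp, simp), simp?)
        apply (rule wp_Call_rets[OF Nd.IH(2)[OF h uv(5) q av(2)],
            where k = 4], simp, simp, simp, simp, simp, simp)
        apply (clarsimp simp: split_at_def pair_at_def otree_at_def)
        apply ((frule tree_at_pos[of _ _ b]), simp?)
        apply (rule call_join[where l = l and r = b], simp, simp, blast intro: gi,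
            use uv(3) in \<open>blast intro: gi\<close>, blast, rule av(1), rule avb)
        apply simp?
        apply ((rule call_cons, simp, simp, blast intro: gi), (simp add: pair_at_def[symmetric]))
        apply ((intro conjI), (blast intro: grows_trans), (auto simp: pair_at_def intro: gi2))
        done
    qed
  qed
qed

lemma call_split:
  assumes "R a = Num l" "R b = Num p" "R c = Num q" "heapok M" "tree_at M l t" "oleaf_at M q vo"
      "avl t"
    "\<And>u s M'. grows M M' \<Longrightarrow> split_at M' s (split (cutp p vo) t)
        \<Longrightarrow>
       u \<le> 400 * split_cost (cutp p vo) t \<Longrightarrow> Q (4 + u) (R(x := Num s)) M'"
  shows "wp (Call x 5 [a, b, c]) Q R M"
  by (rule wp_Call_rets[OF wp_split[OF assms(4-7)], where k = 4]) (use assms(1-3,8) in auto)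

section \<open>Correctness of the stack procedures\<close>

text \<open>Lies between \<open>grows\<close> and \<open>pres\<close>: of the globals and odd
  addresses only those in \<open>X\<close> and the heap pointer may change.\<close>

definition gx :: "nat set \<Rightarrow> mem \<Rightarrow> mem \<Rightarrow> bool" where
  "gx X M M' \<longleftrightarrow> pres M M' \<and> (\<forall>a. a \<notin> X \<and>
      a \<noteq> 0 \<and> (odd a \<or> a < 64) \<longrightarrow> M' a = M a)"

lemma gxD:
  assumes "gx X M M'"
  shows "pres M M'" "heapok M'" "a \<notin> X \<Longrightarrow>
      a \<noteq> 0 \<Longrightarrow> odd a \<or> a < 64 \<Longrightarrow> M' a = M a"
  using assms presD(1) unfolding gx_def by blast+

lemma grows_gx: "grows M M' \<Longrightarrow> heapok M \<Longrightarrow> gx X M M'"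
  unfolding gx_def using grows_pres grows_eq by blast

lemma gx_refl: "heapok M \<Longrightarrow> gx X M M"
  unfolding gx_def using pres_refl by blast

lemma gx_trans: "gx X M M' \<Longrightarrow> gx X M' M'' \<Longrightarrow> gx X M M''"
  unfolding gx_def using pres_trans by metis

lemma gx_grows: "gx X M M' \<Longrightarrow> grows M' M'' \<Longrightarrow> gx X M M''"
  by (meson gx_trans grows_gx gxD(2))

lemma gx_mono: "gx X M M' \<Longrightarrow> X \<subseteq> Y \<Longrightarrow> gx Y M M'"
  unfolding gx_def by blast

lemma gx_upd: "gx X M M' \<Longrightarrow> a \<in> X \<Longrightarrow>
    odd a \<or> 0 < a \<and> a < 64 \<Longrightarrow> gx X M (M'(a := v))"
  unfolding gx_def using pres_upd by auto

lemma gx_at: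
  assumes "gx X M M'"
  shows "tree_at M p t \<Longrightarrow> tree_at M' p t"
      "leaf_at M p x \<Longrightarrow> leaf_at M' p x"
    "list_at tree_at M p ts \<Longrightarrow> list_at tree_at M' p ts"
        "list_at leaf_at M p xs \<Longrightarrow> list_at leaf_at M' p xs"
    "oleaf_at M q vo \<Longrightarrow> oleaf_at M' q vo"
  using pres_intros[OF gxD(1)[OF assms]] by (auto simp: oleaf_at_def split: option.splits)

abbreviation half_table :: "mem \<Rightarrow> nat \<Rightarrow> bool" where
  "half_table M n \<equiv> \<forall>k\<le>n. M (4 * k + 1) = Num (k div 2)"

lemma half_table_gx: "gx X M M' \<Longrightarrow>
    half_table M n \<Longrightarrow> \<forall>k. 4 * k + 1 \<notin> X \<Longrightarrow> half_table
    M' n"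
  using gxD(3)[of X M M'] by simp

text \<open>Cell 14 serves as a global iterator over the buffer. The surplus 80 strengthens the
  induction: the two recursive calls leave 160 units, of which 80 pay for the current node and 80
  are handed on.\<close>

lemma wp_build:
  "heapok M \<Longrightarrow> M 14 = Num pp \<Longrightarrow>
      list_at leaf_at M pp ps \<Longrightarrow> half_table M n \<Longrightarrow> 1 \<le> n
      \<Longrightarrow> n \<le> length ps \<Longrightarrow>
   F 0 = Num n \<Longrightarrow>
   wp c_build (\<lambda>t R' M'. \<exists>s pp'. R' 0 = Num s \<and> gx {14} M M' \<and>
       tree_at M' s (bld (take n ps)) \<and>
     M' 14 = Num pp' \<and> list_at leaf_at M' pp' (drop n ps) \<and> t + 80 \<le> 150 * n) F M"
proof (induction n arbitrary: M pp ps F rule: less_induct)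
  case (less n)
  note h = less.prems(1) and F = less.prems(7)
  show ?case
  proof (cases "n < 2")
    case True
    hence n: "n = 1" using less.prems by simp
    then obtain x xs where ps: "ps = x # xs" using less.prems(6) by (cases ps) auto
    obtain a q where aq: "M pp = Num a" "leaf_at M a x" "M (pp + 2) = Num q"
        "list_at leaf_at M q xs" "blk M pp 2"
      using less.prems(3) ps by (auto simp: list_at.simps)
    have g: "gx {14} M (M(14 := Num q))" using gx_refl[OF h] by (rule gx_upd) auto
    have "pp \<noteq> 14" using aq(5) by (simp add: blk_def)
    moreover have "bld (take n ps) = Lf x" using n ps by (simp add: bld.simps)
    ultimately show ?thesis unfolding c_build_def
      using F n aq(1,3) less.prems(2) gx_at(2)[OF g aq(2)] gx_at(4)[OF g aq(4)] g ps
      by (simp add: tree_at.simps)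
  next
    case False
    define k where "k = n div 2"
    have k: "k < n" "1 \<le> k" "n - k < n" "1 \<le> n - k" using False by (auto simp: k_def)
    \<comment> \<open>The program forms the table address \<open>4 * n + 1\<close> by doubling
      twice.\<close>
    have "n + n + (n + n) + 1 = 4 * n + 1" by simp
    hence tab: "M (n + n + (n + n) + 1) = Num k" using less.prems(4) by (simp only: k_def)
    have l: "length (take n ps) = n" using less.prems(6) by simp
    have B: "bld (take n ps) = Nd (bld (take (n - k) (drop k ps))) (bld (take k ps))"
      using False k l by (subst bld.simps) (simp add: k_def[symmetric] drop_take min_def)
    have hk: "half_table M k" using less.prems(4) k by simp
    note IH1 = less.IH[OF k(1) h less.prems(2,3) hk k(2)]
    show ?thesis unfolding c_build_def B
      using F False tab k
      apply (simp add: wp_Call)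
      apply ((rule wp_mono[OF IH1]), (use less.prems(6) in simp), simp, (elim exE conjE))
      apply (simp add: wp_Call)
      subgoal for t1 R1 M1 s1 pp1
        apply (rule wp_mono[OF less.IH[OF k(3), of M1 pp1 "drop k ps"]])
        apply ((blast intro: gxD), simp, simp)
        apply ((rule allI, rule impI, rule half_table_gx[of "{14}" M M1 "n", rule_format]), simp)
        apply ((use less.prems(4) in simp), (simp, presburger), simp, (rule k(4)))
        apply ((use less.prems(6) in simp), simp, (elim exE conjE), (simp))
        subgoal for t2 R2 M2 s2 pp2
          apply (rule call_mk[where l = "bld (take (n - k) (drop k ps))" and r = "bld (take k ps)"])
          apply (simp, simp, (blast intro: gxD), assumption, (blast intro: gx_at), simp)
          subgoal for t3 s3 M3
            apply (intro conjI)
            apply ((blast intro: gx_trans gx_grows), (rule exI[of _ pp2]), (intro conjI))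
            apply ((subst grows_eq[of M2 M3]), assumption, (blast intro: gxD), simp, simp, simp)
            apply ((rule leaves_at_grows, assumption), (simp add: add.commute), simp)
            done
          done
        done
      done
  qed
qed

lemma call_build:
  assumes "R a = Num n" "heapok M" "M 14 = Num pp" "list_at leaf_at M pp ps" "half_table M n"
      "1 \<le> n" "n \<le> length ps"
    "\<And>t s M' pp'. gx {14} M M' \<Longrightarrow>
        tree_at M' s (bld (take n ps)) \<Longrightarrow> M' 14 = Num pp' \<Longrightarrow>
      list_at leaf_at M' pp' (drop n ps) \<Longrightarrow>
          t + 80 \<le> 150 * n \<Longrightarrow> Q (2 + t) (R(x := Num s)) M'"
  shows "wp (Call x 6 [a]) Q R M"
  unfolding wp_Call using assms(1)
  apply simp
  apply ((rule wp_mono[OF wp_build[OF assms(2-7)]], simp), (elim exE conjE))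
  apply (use assms(8) in \<open>simp add: numeral_2_eq_2\<close>)
  done

lemma list_at_Cons:
  assumes "list_at A M p (x # xs)"
  obtains a q where "M p = Num a" "A M a x" "M (p + 2) = Num q" "list_at A M q xs" "0 < p"
  using assms by (auto simp: list_at.simps blk_def)

lemma wp_pushm:
  assumes h: "heapok M" and B: "M 4 = Num B" and bs: "list_at tree_at M p bs" and t: "tree_at M q t"
    and av: "\<forall>b\<in>set bs. avl b" "avl t" and F: "F 0 = Num p" "F (Suc 0) = Num q"
  shows "wp c_pushm (rets M (\<lambda>M' s. list_at tree_at M' s (pushm B t bs)) (300 * (mh bs +
      ht t + 1) + 60)) F M"
proof (cases bs)
  case Nil
  hence p: "p = 0" using bs by (simp add: list_at.simps)
  show ?thesis unfolding c_pushm_def using F p Nil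
    apply simp
    apply (rule call_cons, simp, simp, rule h)
    apply (use t in \<open>auto simp: pushm_def list_at.simps pair_at_def intro: gi\<close>)
    done
next
  case (Cons c cs)
  obtain a r where ar: "M p = Num a" "tree_at M a c" "M (p + 2) = Num r"
      "list_at tree_at M r cs" "0 < p"
    using bs Cons by (auto elim: list_at_Cons)
  have sz: "M (a + 2) = Num (sz c)" "M (q + 2) = Num (sz t)"
    using tree_at_fields[OF ar(2)] tree_at_fields[OF t] by metis+
  have bp: "blk M p 2" using bs Cons by (simp add: list_at.simps)
  show ?thesis
  proof (cases "B < sz c + sz t")
    case True
    show ?thesis unfolding c_pushm_def using F ar(1,3,5) sz B True Cons
      apply simp
      apply (rule call_cons, simp, simp, rule h)
      apply ((use t bs in \<open>simp add: pushm_def\<close>), (blast intro: pair_list_at gi))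
      done
  next
    case False
    have c: "join_cost c t \<le> mh bs + ht t + 1" using Cons by simp
    show ?thesis unfolding c_pushm_def using F ar(1,3,5) sz B False Cons
      apply simp
      apply (rule call_join[where l = c
          and r = t], simp, simp, rule h, rule ar(2), rule t, use av in simp, use av in simp)
      apply simp
      subgoal for u s M'
        apply (subst pres_eq[OF grows_pres[of M M'] bp])
        apply (assumption, simp, simp, simp, (rule call_cons, simp, simp, blast intro: gi))
        apply (use ar(4) c in \<open>auto simp: pushm_def intro: gi grows_trans intro!:
            pair_list_at\<close>)
        done
      done
  qed
qed

lemma call_pushm:
  assumes "R a = Num p" "R b = Num q" "heapok M" "M 4 = Num B" "list_at tree_at M p bs"
      "tree_at M q t"
    "\<forall>b\<in>set bs. avl b" "avl t"
    "\<And>u s M'. grows M M' \<Longrightarrow> list_at tree_at M' s (pushm B t bs)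
        \<Longrightarrow> u \<le> 300 * (mh bs + ht t + 1) + 60 \<Longrightarrow>
       Q (3 + u) (R(x := Num s)) M'"
  shows "wp (Call x 7 [a, b]) Q R M"
  by (rule wp_Call_rets[OF wp_pushm[OF assms(3-8)], where k = 3]) (use assms(1,2,9) in auto)

lemma wp_revapp:
  "heapok M \<Longrightarrow> list_at tree_at M p us \<Longrightarrow>
      list_at tree_at M q X \<Longrightarrow> F 0 = Num p \<Longrightarrow>
      F (Suc 0) = Num q \<Longrightarrow>
   wp c_revapp (rets M (\<lambda>M' s. list_at tree_at M' s (rev us @ X)) (40 * (length us + 1)))
       F M"
proof (induction us arbitrary: M p q X F)
  case Nil
  thus ?case unfolding c_revapp_def by (auto simp: list_at.simps intro: grows_refl)
next
  case (Cons b us)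
  note h = Cons.prems(1)
  obtain a r where ar: "M p = Num a" "tree_at M a b" "M (p + 2) = Num r"
      "list_at tree_at M r us" "0 < p"
    using Cons.prems(2) by (auto elim: list_at_Cons)
  show ?case unfolding c_revapp_def using Cons.prems(4,5) ar(1,3,5)
    apply simp
    apply ((rule call_cons, simp, simp, rule h), simp?)
    subgoal for t s M'
      apply (rule wp_Call_rets[OF Cons.IH[of M' r s "b # X"], where k = 3])
      apply ((blast intro: gi), (use ar(4) in \<open>blast intro: gi\<close>))
      apply (use ar(2) Cons.prems(3) in \<open>auto intro: gi intro!: pair_list_at\<close>)
      apply (blast intro: grows_trans)
      done
    done
qed

lemma call_revapp:
  assumes "R a = Num p" "R b = Num q" "heapok M" "list_at tree_at M p us" "list_at tree_at M q X"
    "\<And>u s M'. grows M M' \<Longrightarrow> list_at tree_at M' s (rev us @ X)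
        \<Longrightarrow> u \<le> 40 * (length us + 1) \<Longrightarrow>
       Q (3 + u) (R(x := Num s)) M'"
  shows "wp (Call x 8 [a, b]) Q R M"
  by (rule wp_Call_rets[OF wp_revapp[OF assms(3-5)], where k = 3]) (use assms(1,2,6) in auto)

lemma mh_pushm_le: "(\<forall>c\<in>set bs. avl c) \<Longrightarrow>
    avl b \<Longrightarrow> mh (pushm B b bs) \<le> max (ht b) (mh bs) + 1"
  using join_avl[of "hd bs" b] by (cases bs) (auto simp: pushm_def)

lemma avl_pushm: "(\<forall>c\<in>set bs. avl c) \<Longrightarrow>
    avl b \<Longrightarrow> \<forall>c\<in>set (pushm B b bs). avl c"
  using join_avl[of "hd bs" b] by (cases bs) (auto simp: pushm_def)

lemma wp_transfer:
  assumes h: "heapok M" and B: "M 4 = Num B" and X: "list_at tree_at M p X"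
      and ts: "list_at tree_at M q ts"
    and av: "\<forall>b\<in>set X. avl b" "\<forall>b\<in>set ts. avl b"
        and ne: "ts \<noteq> []" and F: "F 0 = Num p" "F (Suc 0) = Num q"
  shows "wp c_transfer (rets M (\<lambda>M' s. list_at tree_at M' s (transfer B ts X))
    (1000 * (mh X + mh ts + length ts + 1))) F M"
proof -
  obtain b us where bu: "ts = b # us" using ne by (cases ts) auto
  obtain a r where ar: "M q = Num a" "tree_at M a b" "M (q + 2) = Num r"
      "list_at tree_at M r us" "0 < q"
    using ts bu by (auto elim: list_at_Cons)
  have avb: "avl b" using av(2) bu by simp
  show ?thesis
  proof (cases us)
    case Nil
    hence r: "r = 0" using ar(4) by (simp add: list_at.simps)
    show ?thesis unfolding c_transfer_def using F ar(1,3) r bu Nil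
      apply simp
      apply ((rule call_pushm[OF _ _ h B X ar(2) av(1) avb], simp, simp), auto)
      done
  next
    case (Cons c vs)
    obtain d w where dw: "M r = Num d" "tree_at M d c" "M (r + 2) = Num w"
        "list_at tree_at M w vs" "0 < r"
      using ar(4) Cons by (auto elim: list_at_Cons)
    have br: "blk M r 2" using ar(4) Cons by (simp add: list_at.simps)
    have avc: "avl c" using av(2) bu Cons by simp
    have mh1: "mh (pushm B b X) \<le> max (ht b) (mh X) + 1" using mh_pushm_le[OF av(1) avb] .
    have tr: "transfer B ts X = rev vs @ pushm B c (pushm B b X)" using bu Cons by simp
    show ?thesis unfolding c_transfer_def tr using F ar(1,3) dw(5)
      apply simp
      apply ((rule call_pushm[OF _ _ h B X ar(2) av(1) avb], simp, simp), simp)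
      subgoal for u s M'
        apply (subst pres_eq[OF grows_pres[of M M'] br])
        apply (assumption, simp, simp, (subst pres_eq0[OF grows_pres[of M M'] br]), assumption)
        apply (simp, (simp add: dw(1,3)))
        apply ((rule call_pushm[where t = c and bs = "pushm B b X" and B = B]), simp, simp)
        apply ((blast intro: gi), (use grows_eq[OF _ h, of M' 4] B in simp), assumption)
        apply ((use dw(2) in \<open>blast intro: gi\<close>), (rule avl_pushm[OF av(1) avb]))
        apply ((rule avc), simp?)
        apply ((rule call_revapp[where us = vs and X = "pushm B c (pushm B b X)"]), simp, simp)
        apply ((blast intro: gi), (use dw(4) in \<open>blast intro: gi\<close>), assumption)
        apply (use mh1 bu Cons in \<open>auto intro: grows_trans\<close>)
        done
      done
  qed
qed

lemma call_transfer:
  assumes "R a = Num p" "R b = Num q" "heapok M" "M 4 = Num B" "list_at tree_at M p X"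
      "list_at tree_at M q ts"
    "\<forall>b\<in>set X. avl b" "\<forall>b\<in>set ts. avl b" "ts \<noteq> []"
    "\<And>u s M'. grows M M' \<Longrightarrow> list_at tree_at M' s (transfer B ts X)
        \<Longrightarrow>
       u \<le> 1000 * (mh X + mh ts + length ts + 1) \<Longrightarrow> Q (3 + u) (R(x := Num s)) M'"
  shows "wp (Call x 9 [a, b]) Q R M"
  by (rule wp_Call_rets[OF wp_transfer[OF assms(3-9)], where k = 3]) (use assms(1,2,10) in auto)

lemma wp_walk:
  "heapok M \<Longrightarrow> list_at tree_at M s bs \<Longrightarrow>
      list_at tree_at M u ts \<Longrightarrow> oleaf_at M q vo \<Longrightarrow>
   F 0 = Num s \<Longrightarrow> F (Suc 0) = Num u \<Longrightarrow>
       F 2 = Num p \<Longrightarrow> F 3 = Num q \<Longrightarrow>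
   wp c_walk (rets M (\<lambda>M' s. \<exists>a b. pair_at M' s a b \<and>
       list_at tree_at M' a (rev (takeWhile (\<lambda>b. cutp p vo (tlast b)) bs) @ ts) \<and>
       list_at tree_at M' b (dropWhile (\<lambda>b. cutp p vo (tlast b)) bs))
     (100 * (length (takeWhile (\<lambda>b. cutp p vo (tlast b)) bs) + 1))) F M"
proof (induction bs arbitrary: M s u ts F)
  case Nil
  note h = Nil.prems(1)
  have "s = 0" using Nil.prems by (simp add: list_at.simps)
  thus ?case unfolding c_walk_def using Nil.prems(5-8)
    apply simp
    apply ((rule call_cons, simp, simp, rule h), simp)
    apply (use Nil.prems(3) in \<open>auto simp: list_at.simps intro: gi\<close>)
    done
next
  case (Cons b bs)
  note h = Cons.prems(1) and q = Cons.prems(4)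
  obtain a r where ar: "M s = Num a" "tree_at M a b" "M (s + 2) = Num r"
      "list_at tree_at M r bs" "0 < s"
    using Cons.prems(2) by (auto elim: list_at_Cons)
  have bk: "blk M s 2" using Cons.prems(2) by (simp add: list_at.simps)
  obtain g where g: "M (a + 6) = Num g" "leaf_at M g (tlast b)" using tree_at_fields[OF ar(2)]
      by metis
  show ?case
  proof (cases "cutp p vo (tlast b)")
    case False
    show ?thesis unfolding c_walk_def using Cons.prems(5-8) ar(1,3,5) g(1) False
      apply simp
      apply ((rule call_test[OF _ _ _ h g(2) q], simp, simp, simp), simp)
      apply ((rule call_cons, simp, simp, rule h), simp)
      apply (use Cons.prems(2,3) in \<open>blast intro: gi\<close>)
      done
  next
    case True
    show ?thesis unfolding c_walk_def using Cons.prems(5-8) ar(1,3,5) g(1) True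
      apply simp
      apply ((rule call_test[OF _ _ _ h g(2) q], simp, simp, simp), simp)
      apply ((rule call_cons, simp, simp, rule h), simp)
      subgoal for t1 t2 s2 M2
        apply (subst pres_eq[OF grows_pres[of M M2] bk], assumption, simp, simp)
        apply (simp, (rule wp_Call_rets[OF Cons.IH[of M2 r s2 "b # ts"], where k = 5]))
        apply ((blast intro: gi), (use ar(4) in \<open>blast intro: gi\<close>))
        apply (use ar(2) Cons.prems(3) in \<open>blast intro: gi pair_list_at\<close>)
        apply (use q in \<open>blast intro: gi2\<close>)
        apply ((simp, simp, simp, simp, simp, simp, simp), simp, (blast intro: grows_trans))
        done
      done
  qed
qed

lemma call_walk:
  assumes "R a = Num s" "R b = Num u" "R c = Num p" "R d = Num q" "heapok M"
      "list_at tree_at M s bs"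
    "list_at tree_at M u ts" "oleaf_at M q vo"
    "\<And>t s M' x y. grows M M' \<Longrightarrow> pair_at M' s x y \<Longrightarrow>
       list_at tree_at M' x (rev (takeWhile (\<lambda>b. cutp p vo (tlast b)) bs) @ ts)
           \<Longrightarrow>
       list_at tree_at M' y (dropWhile (\<lambda>b. cutp p vo (tlast b)) bs) \<Longrightarrow>
       t \<le> 100 * (length (takeWhile (\<lambda>b. cutp p vo (tlast b)) bs) + 1)
           \<Longrightarrow> Q (5 + t) (R(z := Num s)) M'"
  shows "wp (Call z 10 [a, b, c, d]) Q R M"
  by (rule wp_Call_rets[OF wp_walk[OF assms(5-8)], where k = 5]) (use assms(1-4,9) in auto)

lemma wp_chunks:
  "heapok M \<Longrightarrow> M 4 = Num B \<Longrightarrow>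
      0 < B \<Longrightarrow> M 14 = Num pp \<Longrightarrow>
      list_at leaf_at M pp ps \<Longrightarrow>
   half_table M (length ps) \<Longrightarrow> list_at tree_at M u ts \<Longrightarrow>
   F 0 = Num (length ps) \<Longrightarrow> F (Suc 0) = Num u \<Longrightarrow>
   wp c_chunks (\<lambda>t R' M'. \<exists>s. R' 0 = Num s \<and> gx {14} M M' \<and>
       list_at tree_at M' s (chunks B ps ts) \<and>
     t \<le> 300 * length ps + 10) F M"
proof (induction B ps ts arbitrary: M pp u F rule: chunks.induct)
  case (1 B ps ts)
  note h = "1.prems"(1)
  show ?case
  proof (cases "ps = []")
    case True
    hence "chunks B ps ts = ts" by (subst chunks.simps) simp
    thus ?thesis unfolding c_chunks_def using 1 True gx_refl[OF h] by simp
  next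
    case False
    define k where "k = min B (length ps)"
    have k: "1 \<le> k" "k \<le> length ps" using False "1.prems"(3)
        by (cases ps; auto simp: k_def)+
    have c: "chunks B ps ts = chunks B (drop k ps) (bld (take k ps) # ts)"
      using False "1.prems"(3) by (subst chunks.simps) (simp add: k_def)
    have nB: "\<not> (ps = [] \<or> B = 0)" using False "1.prems"(3) by simp
    note IH = "1.IH"[OF nB, folded k_def]
    have tab: "half_table M k" using "1.prems"(6) k by simp
    have kk: "(if B < length ps then B else length ps) = k" by (simp add: k_def)
    have w: "wp (seqs [Call 3 6 [2], Call 4 1 [3, 1], Sub 5 0 2, Call 0 11 [5, 4]])
       (\<lambda>t R' M'. \<exists>s. R' 0 = Num s \<and> gx {14} M M' \<and>
           list_at tree_at M' s (chunks B ps ts) \<and>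
         t + 10 \<le> 300 * length ps + 10) G M"
      if G: "G 0 = Num (length ps)" "G (Suc 0) = Num u" "G 2 = Num k" for G
      unfolding c using G
      apply simp
      apply ((rule call_build[OF _ h "1.prems"(4,5) tab k], simp), simp)
      subgoal for t1 s1 M1 pp1
        apply (rule call_cons, simp, simp, blast intro: gxD)
        apply simp
        subgoal for t2 s2 M2
          apply (simp add: wp_Call)
          apply ((rule wp_mono[OF IH[of M2 pp1 s2]]), (blast intro: gi))
          apply (use grows_eq[of M1 M2 4] gxD[of "{14}" M M1] "1.prems"(2) in force)
          apply ((rule "1.prems"(3)), (use grows_eq[of M1 M2 14] gxD[of "{14}" M M1] in force))
          apply (rule leaves_at_grows, assumption, assumption)
          apply (rule half_table_gx[OF gx_grows[of "{14}" M M1 M2]], assumption, assumption)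
          apply ((use "1.prems"(6) in simp), (simp, presburger))
          apply (rule pair_list_at, assumption, rule tree_at_grows, assumption, assumption)
          apply ((use "1.prems"(7) in \<open>blast intro: gi gx_at\<close>), simp, simp)
          apply ((elim exE conjE), simp, (intro conjI), (blast intro: gx_trans gx_grows))
          using k apply simp
          done
        done
      done
    show ?thesis unfolding c_chunks_def using "1.prems"(2,8,9) False kk k(1)
      apply (cases "B < length ps")
      apply (simp, (rule wp_mono[OF w[simplified]], simp, simp, simp), (erule wp_mono, force))
      apply (simp, (rule wp_mono[OF w[simplified]], simp, simp, simp), (erule wp_mono, force))
      done
  qed
qed

text \<open>The residue of \<open>j\<close> keeps the header cells apart from the heap and from the
  table of halves. Each pending element costs constant time, and by \<open>mh_transfer\<close> the
  joins are paid by the height of the result.\<close>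

lemma wp_flush:
  assumes h: "heapok M" and B: "M 4 = Num B" "0 < B" and j: "j mod 4 = 3"
    and M: "M j = Num sp" "M (j + 4) = Num pp" "M (j + 8) = Num (length ps)"
    and bs: "list_at tree_at M sp bs" and ps: "list_at leaf_at M pp ps"
        and tab: "half_table M (length ps)"
    and ok: "lst_ok B (bs, ps)" and F: "F 0 = Num j"
  shows "wp c_flush (\<lambda>t R' M'. \<exists>s. R' 0 = Num s \<and>
      gx {14, j, j + 4, j + 8} M M' \<and>
     list_at tree_at M' s (flush B (bs, ps)) \<and> M' j = Num s \<and>
         M' (j + 4) = Num 0 \<and> M' (j + 8) = Num 0 \<and>
     t \<le> 2000 * (length ps + mh (flush B (bs, ps)) + 1)) F M"
proof (cases "ps = []")
  case True
  have fl: "flush B (bs, ps) = bs" using True by (simp add: flush_def chunks.simps)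
  have pp: "pp = 0" using ps True by (simp add: list_at.simps)
  show ?thesis unfolding c_flush_def fl using F M True pp bs gx_refl[OF h] by simp
next
  case False
  define ts where "ts = chunks B ps []"
  have tsne: "ts \<noteq> []"
    using chunks_leaves[OF B(2), of ps "[]"] False by (auto simp: ts_def)
  have av: "\<forall>b\<in>set bs. avl b" "\<forall>b\<in>set ts. avl b"
    using ok chunks_ok[OF B(2), of ps "[]"] by (auto simp: ts_def lst_ok_def stk_ok_def tree_ok_def)
  have mh: "mh ts \<le> mh (flush B (bs, ps))" "mh bs \<le> mh (flush B (bs, ps))"
    using mh_transfer[OF av, of B] by (auto simp: flush_def ts_def)
  have len: "length ts \<le> length ps" using chunks_length[OF B(2), of ps "[]"]
      by (simp add: ts_def)
  have odd: "odd j" "odd (j + 4)" "odd (j + 8)" using j by presburger+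
  have ne: "j \<noteq> 14" "j + 4 \<noteq> 14" "j + 8 \<noteq> 14" "j \<noteq> 4"
      "j \<noteq> 0" using j by auto
  define M0 where "M0 = M(14 := Num pp)"
  have g0: "gx {14} M M0" unfolding M0_def using gx_refl[OF h] by (rule gx_upd) auto
  have nil: "list_at tree_at M0 0 []" by (simp add: list_at.simps)
  have "\<forall>k. 4 * k + 1 \<notin> {14::nat}" by (simp, presburger)
  hence tab0: "half_table M0 (length ps)" by (rule half_table_gx[OF g0 tab])
  have M04: "M0 4 = Num B" "M0 14 = Num pp" using B(1) by (auto simp: M0_def)
  show ?thesis unfolding c_flush_def using F M False ne
    apply (simp add: wp_Call M0_def[symmetric])
    apply (rule wp_mono[OF wp_chunks[OF gxD(2)[OF g0] M04(1) B(2) M04(2) gx_at(4)[OF g0 ps] tab0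
        nil]], simp, simp)
    apply (elim exE conjE)
    subgoal for t1 R1 M1 s1
      apply (subgoal_tac "gx {14} M M1")
      apply ((subgoal_tac "M1 j = Num sp"), (simp add: ts_def[symmetric]))
      apply ((rule call_transfer[where X = bs and ts = ts and B = B]), simp, simp)
      apply ((blast intro: gxD), (use gxD(3)[of "{14}" M M1 4] B(1) in simp))
      apply ((use bs in \<open>blast intro: gx_at\<close>), assumption, (rule av(1)))
      apply ((rule av(2)), (rule tsne), simp)
        subgoal for t2 s2 M2
          apply (intro conjI)
          apply ((rule gx_upd), (rule gx_upd), (rule gx_upd), (rule gx_mono[of "{14}"]))
          apply ((erule (1) gx_grows), blast, simp, (use odd in simp), simp, (use odd in simp))
          apply (simp, (use odd in simp), (rule trees_at_pres), (rule pres_upd), (rule pres_upd))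
          apply ((rule pres_upd), (rule pres_refl, blast intro: gi), (use odd in simp))
          apply ((use odd in simp), (use odd in simp), (simp add: flush_def ts_def))
          using mh len apply simp
          done
      apply (use gxD(3)[of "{14}" M M1 j] odd(1) ne M(1) in simp)
      apply (rule gx_trans[OF g0], assumption)
      done
    done
qed

definition olast :: "elem list \<Rightarrow> elem option" where
  "olast xs = (if xs = [] then None else Some (last xs))"

lemma wp_cut:
  assumes h: "heapok M" and B: "M 4 = Num B" and bs: "list_at tree_at M s bs"
      and q: "oleaf_at M q vo"
    and av: "\<forall>b\<in>set bs. avl b" and c: "cut B (cutp p vo) bs = (P, T)"
    and F: "F 0 = Num s" "F (Suc 0) = Num p" "F 2 = Num q"
  shows "wp c_cut (rets M (\<lambda>M' s. \<exists>a b. pair_at M' s a b \<and>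
      list_at tree_at M' a T \<and> list_at tree_at M' b P)
     (3000 * (mh bs + length T + 1))) F M"
proof -
  define T0 where "T0 = takeWhile (\<lambda>b. cutp p vo (tlast b)) bs"
  define rest where "rest = dropWhile (\<lambda>b. cutp p vo (tlast b)) bs"
  have bse: "bs = T0 @ rest" by (simp add: T0_def rest_def)
  have nil: "list_at tree_at M 0 []" by (simp add: list_at.simps)
  show ?thesis
  proof (cases "T0 = []")
    case True
    hence PT: "P = bs" "T = []" using c by (auto simp: cut_def T0_def[symmetric])
    show ?thesis unfolding c_cut_def using F
      apply simp
      apply (rule call_walk[OF _ _ _ _ h bs nil q], simp, simp, simp, simp)
      apply (simp add: T0_def[symmetric] rest_def[symmetric] True)
      subgoal for t1 s1 M1 x y
        apply (subgoal_tac "x = 0")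
        apply ((simp add: pair_at_def), (rule call_cons, simp, simp, blast intro: gi))
        apply (simp add: PT)
         apply (use bs in \<open>auto simp: list_at.simps intro: grows_trans gi\<close>)[1]
        apply (simp add: list_at.simps)
        done
      done
  next
    case False
    then obtain ts b where T0: "T0 = ts @ [b]" by (metis append_butlast_last_id)
    have P: "P = (case fst (split (cutp p vo) b) of None \<Rightarrow> rest | Some l \<Rightarrow>
        pushm B l rest)"
      and T: "T = snd (split (cutp p vo) b) # rev ts"
      using c by (auto simp: cut_def T0_def[symmetric] rest_def[symmetric] T0)
    have avb: "avl b" "\<forall>b\<in>set rest. avl b" using av bse T0 by auto
    have mhb: "ht b \<le> mh bs" "mh rest \<le> mh bs" unfolding bse T0 by auto
    have sc: "split_cost (cutp p vo) b \<le> 1 + 5 * mh bs"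
        using split_cost_le[OF avb(1), of "cutp p vo"] mhb by linarith
    show ?thesis unfolding c_cut_def using F
      apply simp
      apply (rule call_walk[OF _ _ _ _ h bs nil q], simp, simp, simp, simp)
      apply (simp add: T0_def[symmetric] rest_def[symmetric] T0)
      subgoal for t1 s1 M1 x y
        apply (erule list_at_Cons)
        subgoal for a1 q1
          apply (simp add: pair_at_def)
          apply ((rule call_split[where t = b and vo = vo]), simp, simp, simp, (blast intro: gi))
          apply (assumption, (use q in \<open>blast intro: gi2\<close>), (rule avb(1)))
          apply (clarsimp simp: split_at_def pair_at_def)
          subgoal for t2 s2 M2 a2 b2
            apply (rule call_cons, simp, simp, blast intro: gi)
            subgoal for t3 s3 M3
              apply (subgoal_tac "list_at tree_at M3 s3 T")
              apply (subgoal_tac "list_at tree_at M3 y rest")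
              apply ((cases "fst (split (cutp p vo) b)"), (simp add: otree_at_def))
              apply ((rule call_cons, simp, simp, blast intro: gi), (simp add: P pair_at_def))
              apply ((intro conjI), (blast intro: grows_trans), (blast intro: gi))
              apply ((blast intro: gi), (use sc T in simp), (simp add: otree_at_def))
              apply ((frule tree_at_pos[of M2 a2]), simp)
                subgoal for l
                  apply (rule call_pushm[where t = l and bs = rest and B = B])
                  apply (simp, simp, (blast intro: gi))
                  apply (subst grows_eq[of M M3 4], blast intro: grows_trans, rule h, simp, simp,
                      rule B)
                  apply (assumption, (blast intro: gi), (rule avb(2)))
                  apply ((use split_avl[OF avb(1), of "cutp p vo"] in simp), simp)
                  apply (rule call_cons, simp, simp, blast intro: gi)
                  apply ((simp add: P pair_at_def), (intro conjI), (blast intro: grows_trans))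
                  apply ((blast intro: gi), (blast intro: gi))
                  using split_avl[OF avb(1), of "cutp p vo"] sc mhb T apply simp
                  done
              apply (blast intro: gi)
              apply (unfold T)
              apply (rule pair_list_at, assumption, blast intro: gi, blast intro: gi)
              done
            done
          done
        done
      done
  qed
qed

section \<open>List headers and the cascade of cuts\<close>

text \<open>The fourth field caches the last leaf of the whole list, buffer included, so inspecting
  the end of a list takes constant time and does not force a flush.\<close>

definition hdr_at :: "mem \<Rightarrow> nat \<Rightarrow> lst \<Rightarrow> bool" where
  "hdr_at M j C \<longleftrightarrow> (\<exists>sp pp tp. M j = Num sp \<and>
      list_at tree_at M sp (fst C) \<and>
     M (j + 4) = Num pp \<and> list_at leaf_at M pp (snd C) \<and>
         M (j + 8) = Num (length (snd C)) \<and>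
     M (j + 12) = Num tp \<and> oleaf_at M tp (olast (elems C)))"

fun hdrs :: "mem \<Rightarrow> nat \<Rightarrow> lst list \<Rightarrow> bool" where
  "hdrs M j [] = True"
| "hdrs M j (C # Cs) \<longleftrightarrow> hdr_at M j C \<and> hdrs M (j + 16) Cs"

text \<open>The cells outside the heap that a cascade may change if the receiving list has its
  header at \<open>j\<close>: the iterator cell and the header cells from \<open>j\<close>
  on.\<close>

definition hx :: "nat \<Rightarrow> nat set" where
  "hx j = {14} \<union> {a. j \<le> a \<and> a mod 4 = 3}"

lemma hdr_at_gx:
  assumes "gx X M M'" "hdr_at M j C" "odd j" "{j, j + 4, j + 8, j + 12} \<inter> X = {}"
  shows "hdr_at M' j C"
proof -
  have "M' a = M a" if "a \<in> {j, j + 4, j + 8, j + 12}" for a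
  proof (rule gxD(3)[OF assms(1)])
    show "a \<notin> X" using that assms(4) by blast
    show "odd a \<or> a < 64" "a \<noteq> 0" using that assms(3) by (auto intro: odd_pos)
  qed
  thus ?thesis using assms(2) gx_at[OF assms(1)] unfolding hdr_at_def by auto
qed

lemma hdrs_gx:
  assumes "gx X M M'" "odd j" "\<forall>a\<in>X. even a \<or> a < j"
  shows "hdrs M j Cs \<Longrightarrow> hdrs M' j Cs"
  using assms(2,3)
proof (induction Cs arbitrary: j)
  case (Cons C Cs)
  have "{j, j + 4, j + 8, j + 12} \<inter> X = {}" using Cons.prems(2,3) by fastforce
  hence "hdr_at M' j C" using hdr_at_gx[OF assms(1)] Cons.prems by simp
  moreover have "hdrs M' (j + 16) Cs" using Cons.prems by (intro Cons.IH) auto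
  ultimately show ?case by simp
qed simp

lemma half_table_hx: "gx (hx j) M M' \<Longrightarrow>
    half_table M n \<Longrightarrow> half_table M' n"
  by (rule half_table_gx[of "hx j" M M']) (auto simp: hx_def, presburger+)

lemma call_cut:
  assumes "R a = Num s" "R b = Num p" "R c = Num q" "heapok M" "M 4 = Num B"
      "list_at tree_at M s bs"
    "oleaf_at M q vo" "\<forall>b\<in>set bs. avl b" "cut B (cutp p vo) bs = (P, T)"
    "\<And>t s M' x y. grows M M' \<Longrightarrow> M' s = Num x \<Longrightarrow> M' (s + 2) =
        Num y \<Longrightarrow> list_at tree_at M' x T \<Longrightarrow>
       list_at tree_at M' y P \<Longrightarrow> t \<le> 3000 * (mh bs + length T + 1)
           \<Longrightarrow> Q (4 + t) (R(z := Num s)) M'"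
  shows "wp (Call z 15 [a, b, c]) Q R M"
  by (rule wp_Call_rets[OF wp_cut[OF assms(4-9)],
      where k = 4]) (use assms(1-3,10) in \<open>auto simp: pair_at_def\<close>)

lemma cut_mh:
  assumes "\<forall>b\<in>set bs. avl b" "cut B Q bs = (P, T)"
  shows "mh T \<le> mh bs" "\<forall>t\<in>set T. avl t"
proof -
  have "mh T \<le> mh bs \<and> (\<forall>t\<in>set T. avl t)"
  proof (cases "takeWhile (\<lambda>b. Q (tlast b)) bs = []")
    case True
    thus ?thesis using assms(2) by (auto simp: cut_def)
  next
    case False
    then obtain ts b where T0: "takeWhile (\<lambda>b. Q (tlast b)) bs = ts @ [b]"
        by (metis append_butlast_last_id)
    have bs: "bs = (ts @ [b]) @ dropWhile (\<lambda>b. Q (tlast b)) bs" using T0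
        by (metis takeWhile_dropWhile_id)
    have T: "T = snd (split Q b) # rev ts" using assms(2) by (auto simp: cut_def T0 Let_def)
    have "set (ts @ [b]) \<subseteq> set bs" by (subst bs) auto
    hence av: "avl b" "\<forall>t\<in>set ts. avl t" using assms(1) by auto
    have "mh bs = max (mh (ts @ [b])) (mh (dropWhile (\<lambda>b. Q (tlast b)) bs))"
      by (subst bs) (rule mh_append)
    hence "mh (ts @ [b]) \<le> mh bs" by linarith
    thus ?thesis using split_avl[OF av(1), of Q] av T by auto
  qed
  thus "mh T \<le> mh bs" "\<forall>t\<in>set T. avl t" by auto
qed

lemma wp_cont:
  assumes "wp (seqs cs) (\<lambda>t R' M'. A R' M' \<and> B R' M' \<and>
      t \<le> n) R M" "seqs cs = c"
    "\<And>t R' M'. A R' M' \<Longrightarrow> B R' M' \<Longrightarrow>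
        t \<le> n \<Longrightarrow> Q t R' M'"
  shows "wp c Q R M"
  unfolding assms(2)[symmetric] by (rule wp_mono[OF assms(1)]) (use assms(3) in blast)

lemma olast_els: "olast (els P) = (if P = [] then None else Some (tlast (hd P)))"
  by (simp add: olast_def last_els)

lemma wp_ext:
  "heapok M \<Longrightarrow> M 4 = Num B \<Longrightarrow>
      0 < B \<Longrightarrow> j mod 4 = 3 \<Longrightarrow>
      M 8 = Num (j + 16 * length Cs) \<Longrightarrow>
   hdr_at M j (X, []) \<Longrightarrow> hdrs M (j + 16) Cs \<Longrightarrow>
       oleaf_at M q vo \<Longrightarrow> half_table M n \<Longrightarrow>
   \<forall>C\<in>set Cs. length (snd C) \<le> n \<and> lst_ok B C \<and>
       dec (elems C) \<Longrightarrow> stk_ok B X \<Longrightarrow>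
   F 0 = Num (j + 16) \<Longrightarrow> F (Suc 0) = Num p \<Longrightarrow>
       F 2 = Num q \<Longrightarrow>
   wp c_ext (\<lambda>t R' M'. gx (hx j) M M' \<and> hdrs M' j (ext B X Cs p vo) \<and>
       t \<le> 10000 * ext_cost B X Cs p vo) F M"
proof (induction Cs arbitrary: M j X p q vo F)
  case Nil
  thus ?case unfolding c_ext_def by (simp add: gx_refl)
next
  case (Cons C Cs)
  note h = Cons.prems(1) and B = Cons.prems(2,3) and j4 = Cons.prems(4) and M8 = Cons.prems(5)
    and X = Cons.prems(6) and q = Cons.prems(8) and tab = Cons.prems(9) and Xok = Cons.prems(11)
    and F = Cons.prems(12-14)
  define j' where "j' = j + 16"
  have jodd: "odd j" "odd j'" "j' mod 4 = 3" using j4 unfolding j'_def by presburger+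
  have jm: "(j' + 4) mod 4 = 3" "(j' + 8) mod 4 = 3" "(j' + 12) mod 4 = 3" "(j + 12) mod 4 = 3"
      "j \<le> j'"
    using j4 unfolding j'_def by presburger+
  have jne: "j \<noteq> 14" "j \<noteq> 10" "j \<noteq> 6" "j \<noteq> 2" "0 < j" using j4
      by presburger+
  obtain bs ps where C: "C = (bs, ps)" by fastforce
  have Cok: "length ps \<le> n" "lst_ok B C" "dec (elems C)" using Cons.prems(10) C by auto
  have Cs: "hdr_at M j' C" "hdrs M (j' + 16) Cs" using Cons.prems(7) unfolding j'_def
      by (simp_all add: add.assoc)
  obtain sp pp tp where Cm: "M j' = Num sp" "list_at tree_at M sp bs" "M (j' + 4) = Num pp"
    "list_at leaf_at M pp ps" "M (j' + 8) = Num (length ps)" "M (j' + 12) = Num tp"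
    "oleaf_at M tp (olast (elems C))"
    using Cs(1) unfolding hdr_at_def C by auto
  have tabp: "half_table M (length ps)" using tab Cok(1) by simp
  define fl where "fl = flush B C"
  obtain P T where PT: "cut B (cutp p vo) fl = (P, T)" by fastforce
  have flok: "stk_ok B fl" unfolding fl_def using flush_ok[OF Cok(2) B(2)] .
  have flav: "\<forall>b\<in>set fl. avl b" using flok by (auto simp: stk_ok_def tree_ok_def)
  have Xav: "\<forall>b\<in>set X. avl b" using Xok by (auto simp: stk_ok_def tree_ok_def)
  note st = ext_step[OF B(2) Cok(2,3) PT[unfolded fl_def]]
  note Tm = cut_mh[OF flav PT]
  obtain xp xt where Xm: "M j = Num xp" "list_at tree_at M xp X" "M (j + 4) = Num 0"
      "M (j + 8) = Num 0"
    "M (j + 12) = Num xt"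
    using X unfolding hdr_at_def by (auto simp: list_at.simps)
  define p' where "p' = pos (tfirst (hd T))"
  define vo' where "vo' = (if P = [] then None else Some (tlast (hd P)))"
  define Rs where "Rs = ext B X (C # Cs) p vo"
  have ext: "Rs = (if T = [] then (X, []) # (fl, []) # Cs
     else (transfer B T X, []) # ext B P Cs p' vo')"
    using PT by (simp add: Rs_def Let_def fl_def p'_def vo'_def)
  define K where "K = ext_cost B X (C # Cs) p vo"
  have cost: "K = 1 + length ps + mh fl + (if T = [] then 0
     else length T + mh X + ext_cost B P Cs p' vo')"
    using PT C by (simp add: K_def Let_def fl_def p'_def vo'_def)
  have fl_el: "els fl = elems C" unfolding fl_def using els_flush[OF B(2)] .
  \<comment> \<open>Everything after the flush and the cut. Its tail \<open>fin\<close> is shared by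
    the cases of an empty and a nonempty remainder \<open>P\<close>.\<close>
  have main: "wp (seqs [Load 6 5, ldf 7 5 2,
        ifz 6 Skip
          (seqs [Load 8 6, ldf 8 8 4, ldf 1 8 10, ifz 7 (Const 2 0) (seqs [Load 9 7, ldf 2 9 6]),
             subc 10 0 16, Load 11 10, Call 12 9 [11, 6], Load 13 12, ldf 13 13 6,
             Store 0 7, stf 0 12 2, Store 10 12, stf 10 12 13, addc 14 0 16, Call 15 13 [14, 1,
                 2]])])
       (\<lambda>t R' M'. gx (hx j) M M' \<and> hdrs M' j Rs \<and>
          t \<le> 100 + (if T = [] then 0 else 1000 * (mh X + mh T + length T + 1) + 10000 *
              ext_cost B P Cs p' vo')) G M2"
    if G: "G 0 = Num j'" "G 5 = Num s2" "M2 s2 = Num x" "M2 (s2 + 2) = Num y"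
      and L: "list_at tree_at M2 x T" "list_at tree_at M2 y P"
      and g: "gx {14, j', j' + 4, j' + 8} M M2" and fl: "M2 j' = Num s1" "list_at tree_at M2 s1 fl"
        "M2 (j' + 4) = Num 0" "M2 (j' + 8) = Num 0"
    for G s1 s2 x y M2
  proof -
    have h2: "heapok M2" using gxD(2)[OF g] .
    have gg: "gx (hx j) M M2"
      using g by (rule gx_mono) (use jodd(3) jm in \<open>auto simp: hx_def\<close>)
    have j'12: "M2 (j' + 12) = Num tp" using gxD(3)[OF g, of "j' + 12"] Cm(6) jodd by simp
    have Xm2: "M2 j = Num xp" "M2 (j + 4) = Num 0" "M2 (j + 8) = Num 0" "M2 (j + 12) = Num xt"
      using gxD(3)[OF g, of j] gxD(3)[OF g, of "j + 4"] gxD(3)[OF g, of "j + 8"] gxD(3)[OF g, of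
          "j + 12"] Xm jodd jne
      by (auto simp: j'_def intro: odd_pos)
    have Xl2: "list_at tree_at M2 xp X" using gx_at(3)[OF g Xm(2)] .
    have Cs2: "hdrs M2 (j' + 16) Cs" by (rule hdrs_gx[OF g _ _ Cs(2)]) (use jodd in auto)
    show ?thesis
    proof (cases "T = []")
      case True
      hence "x = 0" using L(1) by (simp add: list_at.simps)
      moreover have "hdr_at M2 j (X, [])"
          by (rule hdr_at_gx[OF g X]) (use jodd jne in \<open>auto simp: j'_def\<close>)
      moreover have "hdr_at M2 j' (fl, [])"
        unfolding hdr_at_def using fl j'12 gx_at(5)[OF g Cm(7)] fl_el by (simp add: list_at.simps)
      ultimately show ?thesis using G gg Cs2 True unfolding ext
        by (simp add: j'_def add.assoc)
    next
      case False
      then obtain R T' where T: "T = R # T'" by (cases T) auto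
      obtain a r where ar: "M2 x = Num a" "tree_at M2 a R" "0 < x"
        using L(1) T by (auto elim: list_at_Cons)
      obtain f where f: "M2 (a + 4) = Num f" "leaf_at M2 f (tfirst R)"
          using tree_at_fields[OF ar(2)] by metis
      have f10: "M2 (f + 10) = Num (pos (tfirst R))" using f(2) by (simp add: leaf_at_def)
      have M24: "M2 4 = Num B" using gxD(3)[OF g, of 4] B(1) jodd by (auto simp: j'_def)
      \<comment> \<open>The leaf pointer handed to the next round: the last leaf of the top block of
        \<open>P\<close>, or 0 if nothing is kept.\<close>
      have q': "\<exists>q'. oleaf_at M2 q' vo' \<and>
          (P = [] \<longrightarrow> y = 0 \<and> q' = 0) \<and>
         (P \<noteq> [] \<longrightarrow> 0 < y \<and> (\<exists>b. M2 y = Num b \<and>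
             M2 (b + 6) = Num q'))"
      proof (cases P)
        case Nil
        thus ?thesis using L(2) by (simp add: list_at.simps oleaf_at_def vo'_def)
      next
        case (Cons b P')
        then obtain d where d: "M2 y = Num d" "tree_at M2 d b" "0 < y" using L(2)
            by (auto elim: list_at_Cons)
        obtain gq where "M2 (d + 6) = Num gq" "leaf_at M2 gq (tlast b)"
            using tree_at_fields[OF d(2)] by metis
        thus ?thesis using Cons d by (auto simp: oleaf_at_def vo'_def)
      qed
      then obtain q' where q': "oleaf_at M2 q' vo'" "P = [] \<longrightarrow> y = 0 \<and> q' = 0"
         "P \<noteq> [] \<longrightarrow> 0 < y \<and> (\<exists>b. M2 y = Num b \<and>
             M2 (b + 6) = Num q')" by blast
      have sub: "j' - 16 = j" by (simp add: j'_def)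
      have fin: "wp (seqs [Load 13 12, ldf 13 13 6,
           Store 0 7, stf 0 12 2, Store 10 12, stf 10 12 13, addc 14 0 16, Call 15 13 [14, 1, 2]])
       (\<lambda>t R' M'. gx (hx j) M M' \<and> hdrs M' j Rs \<and>
          t \<le> 30 + 10000 * ext_cost B P Cs p' vo') K M3"
        if K: "K 0 = Num j'" "K 7 = Num y" "K (Suc 0) = Num p'" "K 2 = Num q'" "K 10 = Num j"
            "K 12 = Num s3"
          and g3: "grows M2 M3" and tr: "list_at tree_at M3 s3 (transfer B T X)" for K s3 M3
      proof -
        \<comment> \<open>The receiving list is nonempty, so there is a last leaf to be cached in
          its header.\<close>
        have "transfer B T X \<noteq> []" using False by (simp add: transfer_Nil_iff)
        then obtain e E where eE: "transfer B T X = e # E" by (cases "transfer B T X") auto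
        obtain d where d: "M3 s3 = Num d" "tree_at M3 d e" using tr eE by (auto elim: list_at_Cons)
        obtain tl where tl: "M3 (d + 6) = Num tl" "leaf_at M3 tl (tlast e)"
            using tree_at_fields[OF d(2)] by metis
        define M4 where "M4 = M3(j' := Num y, j' + 12 := Num q', j := Num s3, j + 12 := Num tl)"
        let ?Y = "{j', j' + 12, j, j + 12}"
        have h3: "heapok M3" using growsD(1)[OF g3] .
        have g4: "gx ?Y M3 M4" unfolding M4_def
          by (intro gx_upd gx_refl h3) (use jodd in auto)
        have g24: "gx ?Y M2 M4" using gx_trans[OF grows_gx[OF g3 h2] g4] .
        have gx4: "gx (hx j) M M4"
          by (rule gx_trans[OF gg gx_mono[OF g24]]) (use j4 jodd(3) jm in \<open>auto simp:
              hx_def\<close>)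
        have ne: "j \<noteq> j'" "j + 12 \<noteq> j'" "j \<noteq> j' + 12" by (auto simp: j'_def)
        have P4: "hdr_at M4 j' (P, [])"
        proof -
          have "M4 j' = Num y" "M4 (j' + 12) = Num q'" using ne by (auto simp: M4_def j'_def)
          moreover have "M4 (j' + 4) = Num 0" "M4 (j' + 8) = Num 0"
            using gxD(3)[OF g24, of "j' + 4"] gxD(3)[OF g24, of "j' + 8"] fl(3,4) jodd
                by (auto simp: j'_def)
          ultimately show ?thesis unfolding hdr_at_def
            using gx_at(3)[OF g24 L(2)] gx_at(5)[OF g24 q'(1)]
                by (simp add: list_at.simps olast_els vo'_def)
        qed
        have X4: "hdr_at M4 j (transfer B T X, [])"
        proof -
          have "M4 j = Num s3" "M4 (j + 12) = Num tl" by (auto simp: M4_def)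
          moreover have "M4 (j + 4) = Num 0" "M4 (j + 8) = Num 0"
            using gxD(3)[OF g24, of "j + 4"] gxD(3)[OF g24, of "j + 8"] Xm2 jodd
                by (auto simp: j'_def)
          ultimately show ?thesis unfolding hdr_at_def
            using gx_at(3)[OF g4 tr] gx_at(2)[OF g4 tl(2)] eE
            by (simp add: list_at.simps olast_def tlast_eq_last oleaf_at_def del: els_transfer)
        qed
        have M44: "M4 4 = Num B" "M4 8 = Num (j' + 16 * length Cs)"
          using gxD(3)[OF gx4, of 4] gxD(3)[OF gx4, of 8] B(1) M8 jodd by (auto simp: hx_def j'_def)
        have Cs4: "hdrs M4 (j' + 16) Cs"
          by (rule hdrs_gx[OF g24 _ _ Cs2]) (use jodd in \<open>auto simp: j'_def\<close>)
        have Csok: "\<forall>C\<in>set Cs. length (snd C) \<le> n \<and> lst_ok B C \<and>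
            dec (elems C)" using Cons.prems(10) by simp
        note IH = Cons.IH[OF gxD(2)[OF g4] M44(1) B(2) jodd(3) M44(2) P4 Cs4 gx_at(5)[OF g24 q'(1)]
            half_table_hx[OF gx4 tab] Csok st(1)]
        show ?thesis using K d(1) tl(1)
          apply (simp add: M4_def[symmetric] wp_Call)
          apply ((rule wp_mono[OF IH]), simp, simp, simp, (elim conjE))
          subgoal for t5 R5 M5
            apply (intro conjI)
            apply ((rule gx_trans[OF gx4]), (erule gx_mono))
            apply (simp add: hx_def j'_def subset_iff)
            apply ((use False in \<open>simp add: ext\<close>), (intro conjI))
            apply ((rule hdr_at_gx[OF _ X4], assumption), (rule jodd(1)))
              apply (use jodd in \<open>auto simp: hx_def j'_def\<close>)[1]
            apply (simp add: j'_def)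
            apply simp
            done
          done
      qed
      show ?thesis
      proof (cases "P = []")
        case True
        show ?thesis using G ar(1,3) f(1) f10 q'(2) True
          apply (simp add: False sub Xm2(1))
          apply (rule call_transfer[OF _ _ h2 M24 Xl2 L(1) Xav Tm(2) False], simp, simp)
          subgoal for t3 s3 M3
            apply (rule wp_cont[OF fin[of _ s3 M3]])
            apply (simp, simp, (simp add: T p'_def), simp, simp, simp, assumption, assumption)
            apply (simp, simp)
            done
          done
      next
        case Pne: False
        then obtain b where b: "0 < y" "M2 y = Num b" "M2 (b + 6) = Num q'" using q'(3) by blast
        show ?thesis using G ar(1,3) f(1) f10 b Pne
          apply (simp add: False sub Xm2(1))
          apply (rule call_transfer[OF _ _ h2 M24 Xl2 L(1) Xav Tm(2) False], simp, simp)
          subgoal for t3 s3 M3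
            apply (rule wp_cont[OF fin[of _ s3 M3]])
            apply (simp, simp, (simp add: T p'_def), simp, simp, simp, assumption, assumption)
            apply (simp, simp)
            done
          done
      qed
    qed
  qed
  have fl1: "wp c_flush (\<lambda>t R' M'. \<exists>s. R' 0 = Num s \<and>
      gx {14, j', j' + 4, j' + 8} M M' \<and>
     list_at tree_at M' s fl \<and> M' j' = Num s \<and> M' (j' + 4) = Num 0 \<and>
         M' (j' + 8) = Num 0 \<and>
     t \<le> 2000 * (length ps + mh fl + 1)) G M" if "G 0 = Num j'" for G
    unfolding fl_def C using that Cok(2)
    by (intro wp_flush[OF h B jodd(3) Cm(1,3,5,2,4) tabp]) (simp_all add: C)
  have nlt: "\<not> j + (16 + 16 * length Cs) < j'" by (simp add: j'_def)
  show ?case unfolding c_ext_def Rs_def[symmetric] K_def[symmetric] using F M8 nlt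
    apply (simp add: wp_Call j'_def[symmetric])
    apply ((rule wp_mono[OF fl1], simp), (elim exE conjE))
    subgoal for t1 R1 M1 s1
      apply simp
      apply ((rule call_cut[OF _ _ _ _ _ _ _ flav PT]), simp, simp, simp, (blast intro: gxD))
      apply (use gxD(3)[of "{14, j', j' + 4,
          j' + 8}" M M1 4] B(1) jodd in \<open>simp add: j'_def\<close>)
      apply (assumption, (use q in \<open>blast intro: gx_at\<close>))
      subgoal for t2 s2 M2 x y
        apply (rule wp_cont[OF main[of _ s2 M2 x y s1]])
        apply (simp, simp, assumption, assumption, assumption, assumption)
        apply (blast intro: gx_grows)
        apply (use grows_eq[of M1 M2 j'] jodd in \<open>force dest: gxD(2) intro: odd_pos\<close>)
        apply (blast intro: gi)
        apply (use grows_eq[of M1 M2 "j' + 4"] jodd in \<open>force dest: gxD(2)\<close>)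
        apply ((use grows_eq[of M1 M2 "j' + 8"] jodd in \<open>force dest: gxD(2)\<close>), simp)
        unfolding cost using Tm(1) apply (cases "T = []"; simp)
        done
      done
    done
qed

section \<open>The operations\<close>

lemma hdrs_nth: "hdrs M j Cs \<longleftrightarrow> (\<forall>i<length Cs. hdr_at M (j + 16 * i)
    (Cs ! i))"
proof (induction Cs arbitrary: j)
  case (Cons C Cs)
  show ?case unfolding hdrs.simps Cons.IH
    by (auto simp: nth_Cons less_Suc_eq_0_disj add.assoc split: nat.split)
qed simp

lemma hdr_tail:
  assumes "hdr_at M j C" "elems C \<noteq> []"
  obtains tp where "M (j + 12) = Num tp" "leaf_at M tp (last (elems C))"
    "M (tp + 8) = Key (key (last (elems C)))"
  using assms unfolding hdr_at_def by (auto simp: olast_def oleaf_at_def leaf_at_def)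

text \<open>With \<open>30 * k\<close> on the left, the cost is proportional to the distance
  travelled; in this form it telescopes against the position of the cursor.\<close>

lemma wp_scan:
  "hdrs M 19 Cs \<Longrightarrow> \<forall>C\<in>set Cs. elems C \<noteq> [] \<Longrightarrow> i <
      length Cs \<Longrightarrow> x \<le> key (last (elems (Cs ! i))) \<Longrightarrow>
   F 0 = Num (19 + 16 * i) \<Longrightarrow> F (Suc 0) = Key x \<Longrightarrow>
   wp c_scan (\<lambda>t R' M'. \<exists>k\<le>i. R' 0 = Num (19 + 16 * k) \<and>
       M' = M \<and> x \<le> key (last (elems (Cs ! k))) \<and>
     (0 < k \<longrightarrow> key (last (elems (Cs ! (k - 1)))) < x) \<and>
         t + 30 * k \<le> 30 * i + 30) F M"
proof (induction i arbitrary: F)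
  case 0
  thus ?case unfolding c_scan_def by simp
next
  case (Suc i)
  have "hdr_at M (19 + 16 * i) (Cs ! i)" using Suc.prems by (simp add: hdrs_nth)
  then obtain tp where tp: "M (19 + 16 * i + 12) = Num tp"
      "M (tp + 8) = Key (key (last (elems (Cs ! i))))"
    using Suc.prems by (auto elim: hdr_tail)
  have sub: "19 + 16 * Suc i - 16 = 19 + 16 * i" by simp
  have F: "F 0 = Num (35 + 16 * i)" "F (Suc 0) = Key x" using Suc.prems by simp_all
  have tp1: "M (31 + 16 * i) = Num tp" using tp(1) by (simp add: add.commute)
  show ?case
  proof (cases "key (last (elems (Cs ! i))) < x")
    case True
    show ?thesis unfolding c_scan_def using F tp1 tp(2) True Suc.prems(4)
      by (simp add: exI[of _ "Suc i"])
  next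
    case False
    have il: "i < length Cs" using Suc.prems by simp
    note IH = Suc.IH[OF Suc.prems(1,2) il, of "frame (F(2 := Num 19, 3 := Num (19 + 16 * i),
        50 := Num (tp + 8), 4 := Key (key (last (elems (Cs ! i)))))) [3, Suc 0]"]
    show ?thesis unfolding c_scan_def using F tp1 tp(2) False
      apply (simp add: wp_Call)
      apply ((rule wp_mono[OF IH]), simp, simp, simp, (elim exE conjE))
      subgoal for t R' M' k
        by (intro exI[of _ k]) auto
      done
  qed
qed

text \<open>Every append adds one entry to the table of halves:
  \<open>(N + 2) div 2 = N div 2 + 1\<close> is computed from the entry at \<open>4 * N + 1\<close>
  and stored at \<open>4 * N + 9\<close>.\<close>

definition c_app1 :: com where
  "c_app1 = seqs [ld 1 2, addc 1 1 1, ld 5 0, Add 2 1 1, Add 2 2 2, subc 3 2 3, Load 4 3,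
      addc 4 4 1, addc 3 2 5,
     st 2 1, Store 3 4, Const 6 0, Store 5 6, Const 6 1, stf 5 2 6, stf 5 4 5, stf 5 6 5, stf 5 8 0,
     stf 5 10 1, addc 6 5 12, st 0 6]"

text \<open>The leaf is allocated before its list is chosen; as the level is not stored, the same
  record represents the element for every \<open>l\<close>.\<close>

lemma wp_app1:
  assumes "heapok M" "M 2 = Num N" "half_table M (N + 1)" "F 0 = Key x"
  shows "wp c_app1 (\<lambda>t R' M'. \<exists>q. R' 0 = Key x \<and> R' 5 = Num q \<and>
      gx {2, 4 * N + 9} M M' \<and>
     (\<forall>l. leaf_at M' q (Elem x (N + 1) l)) \<and> M' 2 = Num (N + 1) \<and>
         half_table M' (N + 2) \<and> t \<le> 60) F M"
proof -
  define H where "H = hp M"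
  have H: "M 0 = Num H" "64 \<le> H" "even H" using assms(1) by (auto simp: heapok_def H_def)
  define M' where "M' = M(2 := Num (N + 1), 4 * N + 9 := Num (N div 2 + 1), H := Num 0,
      H + 2 := Num 1,
     H + 4 := Num H, H + 6 := Num H, H + 8 := Key x, H + 10 := Num (N + 1), 0 := Num (H + 12))"
  have hp': "hp M' = H + 12" by (simp add: hp_def M'_def)
  have odd: "odd (4 * N + 9)" by simp
  have neq: "4 * N + 9 \<noteq> H + k" "H \<noteq> 4 * N + 9" if "even k" for k
    using H(3) that odd by (metis even_add)+
  have out: "M' a = M a" if "a \<notin> {2, 4 * N + 9}" "a \<noteq> 0" "odd a \<or> a < H" for a
  proof -
    have "a \<noteq> H" "a \<noteq> H + 2" "a \<noteq> H + 4" "a \<noteq> H + 6"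
        "a \<noteq> H + 8" "a \<noteq> H + 10" using H(3) that(3) by auto
    thus ?thesis using that(1,2) by (simp add: M'_def)
  qed
  have p: "pres M M'" unfolding pres_def heapok_def hp' H_def[symmetric] using H out
      by (auto simp: M'_def)
  have g: "gx {2, 4 * N + 9} M M'" unfolding gx_def using p out H(2) by auto
  have l: "leaf_at M' H (Elem x (N + 1) l)" for l
    using H unfolding leaf_at_def blk_def hp' by (simp add: M'_def)
  have M2: "M' 2 = Num (N + 1)" "M' (4 * N + 9) = Num (N div 2 + 1)"
    using H neq[of 0] neq[of 2] neq[of 4] neq[of 6] neq[of 8] neq[of 10] by (simp_all add: M'_def)
  have tab: "half_table M' (N + 2)"
  proof (intro allI impI)
    fix k assume k: "k \<le> N + 2"
    show "M' (4 * k + 1) = Num (k div 2)"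
    proof (cases "k = N + 2")
      case True
      thus ?thesis using M2(2) by (simp add: add.commute)
    next
      case False
      hence "4 * k + 1 \<noteq> 2" "4 * k + 1 \<noteq> 4 * N + 9" by presburger+
      hence "M' (4 * k + 1) = M (4 * k + 1)" by (intro out) auto
      thus ?thesis using assms(3) k False by simp
    qed
  qed
  have "wp c_app1 (\<lambda>t R' K. R' 0 = Key x \<and> R' 5 = Num H \<and> K = M' \<and>
      t \<le> 60) F M"
  proof -
    have "M (4 * N + 1) = Num (N div 2)" using assms(3) by simp
    moreover have "Suc (N + N + (N + N)) = 4 * N + 1" by simp
    ultimately have "M (Suc (N + N + (N + N))) = Num (N div 2)" by (simp only:)
    thus ?thesis unfolding c_app1_def using H(1) assms(2,4)
      by (simp add: M'_def add.commute[of "4 * N" 9])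
  qed
  thus ?thesis by (rule wp_mono) (use g l M2(1) tab in blast)
qed

text \<open>\<open>pv\<close> records the list used by the preceding append
    and the value appended.\<close>

definition state_at :: "mem \<Rightarrow> nat \<Rightarrow> nat \<Rightarrow> lst list
    \<Rightarrow> (nat \<times> real) option \<Rightarrow> bool" where
  "state_at M N B Cs pv \<longleftrightarrow> heapok M \<and> M 2 = Num N \<and>
      M 4 = Num B \<and> M 6 = Num (length Cs) \<and>
     M 8 = Num (3 + 16 * length Cs) \<and> half_table M (N + 1) \<and> hdrs M 19 Cs \<and>
     (case pv of None \<Rightarrow> M 10 = Num 0
      | Some (k, v) \<Rightarrow> M 10 = Num (19 + 16 * k) \<and> k < length Cs \<and>
          M 12 = Key v \<and> v = key (last (elems (Cs ! k))))"

text \<open>If the new value does not exceed the preceding one, the list used last is already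
  suitable and the scan resumes there; otherwise it restarts at the right end, where
  \<open>n\<close> stands for a list yet to be opened.\<close>

fun start :: "(nat \<times> real) option \<Rightarrow> real \<Rightarrow> nat \<Rightarrow> nat"
    where
  "start None x n = n"
| "start (Some (k, v)) x n = (if v < x then n else k)"

text \<open>Register 11 records whether a new list has to be opened, and register 7 holds the header
  at which to continue. Header address 3 as the last header means that there is no list.\<close>

definition c_app2 :: com where
  "c_app2 = seqs [ld 7 8, ld 8 10, ifz 8 Skip (seqs [ld 9 12, Cond (Less 9 0) Skip (Move 7 8)]),
      Const 10 3, Const 11 1,
     Cond (Equal 7 10) Skip (seqs [ldf 12 7 12, ldf 12 12 8, Cond (Less 12 0) Skip (Const 11 0)])]"

lemma wp_app2:
  assumes s: "M 8 = Num (3 + 16 * length Cs)" "hdrs M 19 Cs"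
      "\<forall>C\<in>set Cs. elems C \<noteq> []"
    and pv: "case pv of None \<Rightarrow> M 10 = Num 0
      | Some (k, v) \<Rightarrow> M 10 = Num (19 + 16 * k) \<and> k < length Cs \<and>
          M 12 = Key v \<and> v = key (last (elems (Cs ! k)))"
    and F: "F 0 = Key x" "F 5 = Num q"
  shows "wp c_app2 (\<lambda>t R' M'. M' = M \<and> t \<le> 60 \<and> R' 0 = Key x \<and>
      R' 5 = Num q \<and>
     (R' 11 = Num 1 \<and> R' 7 = Num (3 + 16 * length Cs) \<and>
         (Cs \<noteq> [] \<longrightarrow> key (last (elems (last Cs))) < x) \<and>
        start pv x (length Cs) = length Cs \<or>
      R' 11 = Num 0 \<and> (\<exists>i<length Cs. R' 7 = Num (19 + 16 * i) \<and>
          x \<le> key (last (elems (Cs ! i))) \<and>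
        i \<le> start pv x (length Cs)))) F M"
proof -
  have tl: "\<exists>tp. M (31 + 16 * i) = Num tp \<and>
      M (tp + 8) = Key (key (last (elems (Cs ! i))))" if "i < length Cs" for i
  proof -
    have "hdr_at M (19 + 16 * i) (Cs ! i)" using s(2) that by (simp add: hdrs_nth)
    moreover have "elems (Cs ! i) \<noteq> []" using s(3) that by simp
    ultimately obtain tp where "M (19 + 16 * i + 12) = Num tp"
        "M (tp + 8) = Key (key (last (elems (Cs ! i))))"
      by (rule hdr_tail)
    thus ?thesis by (auto simp: add.commute)
  qed
  have top: ?thesis if st: "start pv x (length Cs) = length Cs"
      and 10: "M 10 = Num 0 \<or> (\<exists>k v. M 10 = Num (19 + 16 * k) \<and>
          M 12 = Key v \<and> v < x)"
  proof (cases "Cs = []")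
    case True
    show ?thesis unfolding c_app2_def using s(1) F 10 st True
      by (elim disjE exE conjE) simp_all
  next
    case False
    then obtain n where n: "length Cs = Suc n" by (cases Cs) auto
    obtain tp where tp: "M (31 + 16 * n) = Num tp" "M (tp + 8) = Key (key (last (elems (Cs ! n))))"
      using tl[of n] n by auto
    have l: "last Cs = Cs ! n" using False n by (simp add: last_conv_nth)
    show ?thesis unfolding c_app2_def using s(1) F 10 st tp n l
      apply (cases "key (last (elems (Cs ! n))) < x")
      apply ((elim disjE exE conjE), simp, simp, (elim disjE exE conjE), (simp add: exI[of _ n]))
      apply (simp add: exI[of _ n])
      done
  qed
  show ?thesis
  proof (cases pv)
    case None
    show ?thesis by (rule top) (use None pv in auto)
  next
    case (Some kv)
    obtain k v where kv: "kv = (k, v)" by fastforce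
    have k: "M 10 = Num (19 + 16 * k)" "k < length Cs" "M 12 = Key v"
        "v = key (last (elems (Cs ! k)))"
      using pv Some kv by auto
    show ?thesis
    proof (cases "v < x")
      case True
      show ?thesis by (rule top) (use True Some kv k in auto)
    next
      case False
      obtain tp where tp: "M (31 + 16 * k) = Num tp" "M (tp + 8) = Key v"
          using tl[OF k(2)] k(4) by auto
      show ?thesis unfolding c_app2_def using s(1) F k tp False Some kv
        by (simp add: exI[of _ k])
    qed
  qed
qed

definition c_app3 :: com where
  "c_app3 = ifz 11 (Call 7 14 [7, 0])
     (seqs [ld 13 6, addc 13 13 1, ld 15 4, st 6 13, addc 7 7 16, st 8 7, Const 14 0, Store 7 14,
         stf 7 4 14,
        stf 7 8 14, Cond (Less 15 13) (st 4 13) Skip])"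

definition c_app4 :: com where
  "c_app4 = seqs [ldf 16 7 4, ldf 18 7 8, addc 18 18 1, Call 17 1 [5, 16], stf 7 4 17,
      stf 7 8 18, stf 7 12 5,
     st 10 7, st 12 0]"

lemma wp_app4:
  assumes h: "heapok M" and j: "j mod 4 = 3" "19 \<le> j" and q: "leaf_at M q e"
    and M: "M j = Num sp" "list_at tree_at M sp bs" "M (j + 4) = Num pp" "list_at leaf_at M pp ps"
      "M (j + 8) = Num (length ps)"
    and F: "F 0 = Key x" "F 5 = Num q" "F 7 = Num j"
  shows "wp c_app4 (\<lambda>t R' M'. gx {j + 4, j + 8, j + 12, 10, 12} M M' \<and>
      hdr_at M' j (bs, e # ps) \<and>
     M' 10 = Num j \<and> M' 12 = Key x \<and> t \<le> 60) F M"
proof -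
  have jo: "odd j" using j(1) by presburger
  show ?thesis unfolding c_app4_def using F M(3,5)
    apply simp
    apply ((rule call_cons, simp, simp, rule h), simp)
    subgoal for t s M'
    proof -
      assume g: "grows M M'" and pr: "pair_at M' s q pp" and t: "t \<le> 12"
      let ?X = "{j + 4, j + 8, j + 12, 10, 12}"
      let ?M = "M'(j + 4 := Num s, j + 8 := Num (Suc (length ps)), j + 12 := Num q, 10 := Num j,
          12 := Key x)"
      have g1: "gx ?X M M'" using grows_gx[OF g h] .
      have g3: "gx ?X M' ?M" by (intro gx_upd gx_refl growsD(1)[OF g]) (use jo in auto)
      have g2: "gx ?X M ?M" using gx_trans[OF g1 g3] .
      have "list_at leaf_at M' s (e # ps)"
        using pr q M(4) g by (blast intro: pair_list_at gi)
      hence "list_at leaf_at ?M s (e # ps)" by (rule gx_at(4)[OF g3])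
      moreover have "?M j = Num sp" using gxD(3)[OF g2, of j] jo j(2) M(1) by auto
      moreover have "list_at tree_at ?M sp bs" using gx_at(3)[OF g2 M(2)] .
      moreover have "leaf_at ?M q e" using gx_at(2)[OF g2 q] .
      ultimately have "hdr_at ?M j (bs, e # ps)" unfolding hdr_at_def
        using j(2) by (simp add: elems_def olast_def oleaf_at_def)
      thus ?thesis using g2 j(2) t by simp
    qed
    done
qed

lemma hdr_at_other:
  assumes "gx X M M'" "X \<subseteq> {a. even a} \<union> {a. a mod 4 = 1} \<union> {j. 19 + 16 *
      k \<le> j \<and> j \<le> 19 + 16 * k + 12}" "i \<noteq> k"
    "hdr_at M (19 + 16 * i) C"
  shows "hdr_at M' (19 + 16 * i) C"
proof (rule hdr_at_gx[OF assms(1,4)])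
  show "odd (19 + 16 * i)" by presburger
  have "a \<notin> X" if a: "a \<in> {19 + 16 * i, 19 + 16 * i + 4, 19 + 16 * i + 8,
      19 + 16 * i + 12}" for a
  proof
    assume "a \<in> X"
    hence "a \<in> {a. even a} \<union> {a. a mod 4 = 1} \<union> {j. 19 + 16 * k \<le> j \<and> j
        \<le> 19 + 16 * k + 12}"
      using assms(2) by blast
    moreover have "a mod 4 = 3" using a by (auto; presburger)
    moreover from this have "odd a" by presburger
    moreover have "\<not> (19 + 16 * k \<le> a \<and> a \<le> 19 + 16 * k + 12)"
        using a assms(3) by (auto; presburger)
    ultimately show False by auto
  qed
  thus "{19 + 16 * i, 19 + 16 * i + 4, 19 + 16 * i + 8, 19 + 16 * i + 12} \<inter> X = {}" by blast
qed

definition appl :: "lst list \<Rightarrow> nat \<Rightarrow> elem \<Rightarrow> lst list" where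
  "appl Cs k e = (if k < length Cs then Cs[k := (fst (Cs ! k), e # snd (Cs ! k))] else Cs @ [([],
      [e])])"

definition c_append :: com where
  "c_append = seqs [c_app1, c_app2, c_app3, c_app4]"

lemma wp_append:
  assumes s: "state_at M N B Cs pv" and ne: "\<forall>C\<in>set Cs. elems C \<noteq> []"
      and B: "length Cs \<le> B"
    and F: "F 0 = Key x"
  shows "wp c_append (\<lambda>t R' M'. \<exists>k\<le>length Cs.
     state_at M' (N + 1) (max B (length (appl Cs k (Elem x (N + 1) (k + 1))))) (appl Cs k (Elem x
         (N + 1) (k + 1))) (Some (k, x)) \<and>
     (k < length Cs \<longrightarrow> x \<le> key (last (elems (Cs ! k)))) \<and>
     (0 < k \<longrightarrow> key (last (elems (Cs ! (k - 1)))) < x) \<and>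
     t + 30 * k \<le> 500 + 30 * start pv x (length Cs)) F M"
proof -
  note s = s[unfolded state_at_def]
  define e where "e = (\<lambda>k. Elem x (N + 1) (k + 1))"
  have e: "Elem x (N + 1) (k + 1) = e k" "key (e k) = x" for k by (simp_all add: e_def)
  \<comment> \<open>The final stage, common to opening a new list and extending an existing one; it
    only assumes a valid header for list \<open>k\<close>.\<close>
  have fin: "wp c_app4 (\<lambda>t R' M'.
     state_at M' (N + 1) B' (appl Cs k (e k)) (Some (k, x)) \<and> t \<le> 60) G M3"
    if k: "k \<le> length Cs" and h3: "heapok M3" and M3: "M3 2 = Num (N + 1)" "M3 4 = Num B'"
      "M3 6 = Num (length (appl Cs k (e k)))" "M3 8 = Num (3 + 16 * length (appl Cs k (e k)))"
      and tab: "half_table M3 (N + 2)"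
      and hd: "\<forall>i<length Cs. i \<noteq> k \<longrightarrow>
          hdr_at M3 (19 + 16 * i) (Cs ! i)"
      and cur: "M3 (19 + 16 * k) = Num sp" "list_at tree_at M3 sp bs"
          "M3 (19 + 16 * k + 4) = Num pp"
        "list_at leaf_at M3 pp ps" "M3 (19 + 16 * k + 8) = Num (length ps)"
      and q: "leaf_at M3 q (e k)"
      and ap: "appl Cs k (e k) ! k = (bs, e k # ps)"
      and G: "G 0 = Key x" "G 5 = Num q" "G 7 = Num (19 + 16 * k)" for k G M3 q sp pp bs ps B'
  proof -
    define j where "j = 19 + 16 * k"
    have jm: "j mod 4 = 3" "19 \<le> j" by (auto simp: j_def, presburger)
    have jo: "odd j" using jm by presburger
    let ?X = "{j + 4, j + 8, j + 12, 10, 12}"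
    have lap: "length (appl Cs k (e k)) = (if k < length Cs then length Cs else length Cs + 1)"
      by (simp add: appl_def)
    show ?thesis
    proof (rule wp_mono[OF wp_app4[OF h3 jm q cur[folded j_def] G(1,2) G(3)[folded j_def]]])
      fix t R' M' assume "gx ?X M3 M' \<and> hdr_at M' j (bs, e k # ps) \<and>
          M' 10 = Num j \<and> M' 12 = Key x \<and> t \<le> 60"
      hence g: "gx ?X M3 M'" and hj: "hdr_at M' j (bs, e k # ps)"
          and M': "M' 10 = Num j" "M' 12 = Key x" "t \<le> 60"
        by blast+
      have X: "?X \<subseteq> {a. even a} \<union> {a. a mod 4 = 1} \<union> {j. 19 + 16 * k \<le>
          j \<and> j \<le> 19 + 16 * k + 12}"
        by (auto simp: j_def)
      have eq: "M' a = M3 a" if "a \<in> {2, 4, 6, 8}" for a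
        using gxD(3)[OF g, of a] that jm(2) by auto
      have "hdr_at M' (19 + 16 * i) (appl Cs k (e k) ! i)" if i:
          "i < length (appl Cs k (e k))" for i
      proof (cases "i = k")
        case True
        thus ?thesis using hj ap by (simp add: j_def)
      next
        case False
        hence "i < length Cs" "appl Cs k (e k) ! i = Cs ! i"
          using i k by (auto simp: lap appl_def nth_append split: if_splits)
        thus ?thesis using hdr_at_other[OF g X False] hd False by simp
      qed
      hence "hdrs M' 19 (appl Cs k (e k))" by (simp add: hdrs_nth)
      moreover have "half_table M' (N + 2)"
      proof (rule half_table_gx[OF g tab], intro allI)
        fix l :: nat
        have "(4 * l + 1) mod 4 = 1" by presburger
        moreover have "(j + 4) mod 4 = 3" "(j + 8) mod 4 = 3" "(j + 12) mod 4 = 3" using jm(1)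
            by presburger+
        moreover have "(10::nat) mod 4 = 2" "(12::nat) mod 4 = 0" by simp_all
        ultimately show "4 * l + 1 \<notin> ?X"
          by (metis (no_types, lifting) insert_iff empty_iff one_eq_numeral_iff zero_neq_one
              semiring_norm(83,84) numeral_eq_one_iff)
      qed
      moreover have "last (elems (appl Cs k (e k) ! k)) = e k" unfolding ap by (simp add: elems_def)
      moreover have "k < length (appl Cs k (e k))" using k by (simp add: lap)
      ultimately show "state_at M' (N + 1) B' (appl Cs k (e k)) (Some (k, x)) \<and> t \<le> 60"
        unfolding state_at_def using gxD(2)[OF g] eq[of 2] eq[of 4] eq[of 6] eq[of 8] M3 M'
            by (simp add: j_def e(2))
    qed
  qed
  show ?thesis unfolding c_append_def e(1)
    apply simp
    apply ((rule wp_mono[OF wp_app1[where M = M and N = N and x = x]]), (use s in blast))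
    apply ((use s in blast), (use s in blast), (rule F), (elim exE conjE))
    subgoal for t1 R1 M1 q
    proof -
      assume R1: "R1 0 = Key x" "R1 5 = Num q" and g1: "gx {2, 4 * N + 9} M M1"
        and lq: "\<forall>l. leaf_at M1 q (Elem x (N + 1) l)" and M12: "M1 2 = Num (N + 1)"
        and tab1: "half_table M1 (N + 2)" and t1: "t1 \<le> 60"
      have eq1: "M1 a = M a" if "a \<in> {4, 6, 8, 10, 12}" for a
      proof -
        have "4 * N \<noteq> 3" "4 * N \<noteq> 1" by presburger+
        thus ?thesis using gxD(3)[OF g1, of a] that by auto
      qed
      have hd1: "hdrs M1 19 Cs" unfolding hdrs_nth
      proof (intro allI impI)
        fix i assume "i < length Cs"
        hence "hdr_at M (19 + 16 * i) (Cs ! i)" using s by (simp add: hdrs_nth)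
        moreover have "(4 * N + 9) mod 4 = 1" by presburger
        ultimately show "hdr_at M1 (19 + 16 * i) (Cs ! i)"
          by (intro hdr_at_other[OF g1, of "Suc i"]) auto
      qed
      have M1: "M1 4 = Num B" "M1 6 = Num (length Cs)" "M1 8 = Num (3 + 16 * length Cs)"
        using s eq1 by auto
      have pv1: "case pv of None \<Rightarrow> M1 10 = Num 0
        | Some (k, v) \<Rightarrow> M1 10 = Num (19 + 16 * k) \<and> k < length Cs \<and>
            M1 12 = Key v \<and> v = key (last (elems (Cs ! k)))"
        using s eq1[of 10] eq1[of 12] by (auto split: option.splits)
      have h1: "heapok M1" using gxD(2)[OF g1] .
      show ?thesis
        apply (simp only: wp_Seq)
        apply ((rule wp_mono[OF wp_app2[OF M1(3) hd1 ne pv1 R1]]), (elim conjE))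
        subgoal premises p for t2 R2 M2
          using p(5)
        proof (elim disjE conjE exE)
          assume n: "R2 11 = Num 1" "R2 7 = Num (3 + 16 * length Cs)"
              "Cs \<noteq> [] \<longrightarrow> key (last (elems (last Cs))) < x"
            "start pv x (length Cs) = length Cs"
          let ?k = "length Cs" and ?j = "19 + 16 * length Cs"
          have ap: "appl Cs ?k (e ?k) = Cs @ [([], [e ?k])]" by (simp add: appl_def)
          let ?X = "{6, 8, 4, ?j, ?j + 4, ?j + 8}"
          define M3 where "M3 = (let M3 = M1(6 := Num (?k + 1), 8 := Num ?j, ?j := Num 0,
              ?j + 4 := Num 0, ?j + 8 := Num 0)
             in if B < ?k + 1 then M3(4 := Num (?k + 1)) else M3)"
          have g3: "gx ?X M1 M3" unfolding M3_def Let_def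
            by (cases "B < ?k + 1") (auto intro!: gx_upd gx_refl h1)
          have X: "?X \<subseteq> {a. even a} \<union> {a. a mod 4 = 1} \<union> {j. 19 + 16 * ?k
              \<le> j \<and> j \<le> 19 + 16 * ?k + 12}" by auto
          have "wp c_app3 (\<lambda>t R' M'. R' 0 = Key x \<and> R' 5 = Num q \<and>
              R' 7 = Num ?j \<and> M' = M3 \<and> t \<le> 60) R2 M1"
            unfolding c_app3_def using n(1,2) p(3,4) M1
            by (cases "B < ?k + 1") (simp_all add: M3_def add.commute)
          hence w3: "wp c_app3 (\<lambda>t R' M'. R' 0 = Key x \<and> R' 5 = Num q \<and>
              R' 7 = Num ?j \<and> M' = M3 \<and> t \<le> 60) R2 M2"
            using p(1) by simp
          have M3v: "M3 2 = Num (N + 1)" "M3 4 = Num (max B (length (appl Cs ?k (e ?k))))"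
             "M3 6 = Num (length (appl Cs ?k (e ?k)))"
                 "M3 8 = Num (3 + 16 * length (appl Cs ?k (e ?k)))"
             "M3 ?j = Num 0" "M3 (?j + 4) = Num 0" "M3 (?j + 8) = Num 0"
            using M12 M1(1) by (auto simp: M3_def Let_def ap max_def)
          have tab3: "half_table M3 (N + 2)"
          proof (rule half_table_gx[OF g3 tab1], intro allI)
            fix l :: nat
            show "4 * l + 1 \<notin> ?X" by (simp, presburger)
          qed
          have hd3: "\<forall>i<length Cs. i \<noteq> ?k \<longrightarrow>
              hdr_at M3 (19 + 16 * i) (Cs ! i)"
            using hdr_at_other[OF g3 X] hd1 by (simp add: hdrs_nth)
          have l3: "leaf_at M3 q (e ?k)" using gx_at(2)[OF g3] lq unfolding e_def by blast
          have apk: "appl Cs ?k (e ?k) ! ?k = ([], e ?k # [])" by (simp add: ap)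
          have nil: "list_at tree_at M3 0 []" "list_at leaf_at M3 0 []"
              by (simp_all add: list_at.simps)
          have len0: "M3 (?j + 8) = Num (length ([]::elem list))" using M3v(7) by simp
          show ?thesis
            apply simp
            apply ((rule wp_mono[OF w3]), (elim conjE), simp)
            subgoal for t3 R3 M3'
              apply (rule wp_mono[OF fin[where k = ?k
                  and B' = "max B (length (appl Cs ?k (e ?k)))",
                  OF order.refl gxD(2)[OF g3] M3v(1-4) tab3 hd3 M3v(5) nil(1) M3v(6) nil(2) len0
                  l3 apk]])
              apply (simp, simp, simp, (rule exI[of _ ?k]))
              using t1 p(2) n(3,4) apply (auto simp: last_conv_nth)
              done
            done
        next
          fix i assume n: "R2 11 = Num 0" "i < length Cs" "R2 7 = Num (19 + 16 * i)"
              "x \<le> key (last (elems (Cs ! i)))"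
            "i \<le> start pv x (length Cs)"
          show ?thesis unfolding c_app3_def using n(1) p(1)
            apply (simp add: wp_Call)
            apply ((rule wp_mono[OF wp_scan[OF hd1 ne n(2,4)]]), (use n(3) in simp))
            apply ((use p(3) in simp), (elim exE conjE))
            subgoal premises pp for t3 R3 M3 k
            proof -
              have k: "k < length Cs" "k \<le> length Cs" using pp n(2) by auto
              have M3: "M3 = M1" using pp by blast
              obtain sp pt tp where C: "M1 (19 + 16 * k) = Num sp"
                  "list_at tree_at M1 sp (fst (Cs ! k))"
                "M1 (19 + 16 * k + 4) = Num pt" "list_at leaf_at M1 pt (snd (Cs ! k))"
                "M1 (19 + 16 * k + 8) = Num (length (snd (Cs ! k)))"
                using hd1 k(1) unfolding hdrs_nth hdr_at_def by blast
              have lap: "length (appl Cs k (e k)) = length Cs" using k by (simp add: appl_def)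
              have Bm: "max B (length (appl Cs k (e k))) = B" using B lap by simp
              have v: "M1 6 = Num (length (appl Cs k (e k)))"
                  "M1 8 = Num (3 + 16 * length (appl Cs k (e k)))"
                using M1 lap by auto
              have hd: "\<forall>i<length Cs. i \<noteq> k \<longrightarrow>
                  hdr_at M1 (19 + 16 * i) (Cs ! i)" using hd1 by (simp add: hdrs_nth)
              have ap: "appl Cs k (e k) ! k = (fst (Cs ! k), e k # snd (Cs ! k))" using k
                  by (simp add: appl_def)
              have le: "leaf_at M1 q (e k)" using lq unfolding e_def by blast
              note f = fin[OF k(2) h1 M12 M1(1) v tab1 hd C(1-5) le ap]
              show ?thesis unfolding M3
                apply (rule wp_mono[OF f])
                apply ((use p(3) in simp), (use p(4) in simp), (use pp in simp))
                apply (rule exI[of _ k])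
                unfolding Bm using k t1 p(2) n(5) pp apply auto
                done
            qed
            done
        qed
        done
    qed
    done
qed

lemma length_ext: "length (ext B X Cs p vo) = Suc (length Cs)"
  by (induction Cs arbitrary: X p vo) (auto simp: Let_def)

text \<open>The header at address 3 belongs to a dummy list that receives the copies of the
    minimum.\<close>

definition c_extract :: com where
  "c_extract = seqs [Const 1 0, st 10 1, st 3 1, st 7 1, st 11 1, st 15 1, Const 0 19, ld 2 31,
      Call 3 13 [0, 1, 2],
     ld 4 8, ldf 5 4 12, ifz 5 (seqs [ld 6 6, subc 6 6 1, subc 4 4 16, st 8 4, st 6 6]) Skip]"

lemma wp_extract:
  assumes s: "state_at M N B Cs pv" and ne: "Cs \<noteq> []"
    and ok: "\<forall>C\<in>set Cs. length (snd C) \<le> N \<and> lst_ok B C \<and>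
        dec (elems C) \<and> elems C \<noteq> []" and B: "0 < B"
    and vo: "vo = Some (last (elems (hd Cs)))" and Rs: "Rs = tl (ext B [] Cs 0 vo)"
  shows "wp c_extract (\<lambda>t R' M'. state_at M' N B (if elems (last Rs) = [] then butlast Rs
      else Rs) None \<and>
     t \<le> 10000 * ext_cost B [] Cs 0 vo + 100) F M"
proof -
  note s = s[unfolded state_at_def]
  define M0 where "M0 = M(10 := Num 0, 3 := Num 0, 7 := Num 0, 11 := Num 0, 15 := Num 0)"
  have g0: "gx {10, 3, 7, 11, 15} M M0" unfolding M0_def by (intro gx_upd gx_refl) (use s in auto)
  have h0: "heapok M0" using gxD(2)[OF g0] .
  have M0: "M0 2 = Num N" "M0 4 = Num B" "M0 6 = Num (length Cs)"
      "M0 8 = Num (3 + 16 * length Cs)" "M0 10 = Num 0"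
    using s by (auto simp: M0_def)
  have hd0: "hdrs M0 19 Cs" by (rule hdrs_gx[OF g0]) (use s in auto)
  have tab0: "half_table M0 (N + 1)"
  proof (rule half_table_gx[OF g0])
    show "half_table M (N + 1)" using s by blast
    show "\<forall>k. 4 * k + 1 \<notin> {10::nat, 3, 7, 11, 15}"
      by (simp, presburger)
  qed
  have X0: "hdr_at M0 3 ([], [])"
    unfolding hdr_at_def by (simp add: M0_def list_at.simps elems_def olast_def oleaf_at_def)
  obtain C Cs' where C: "Cs = C # Cs'" using ne by (cases Cs) auto
  have "hdr_at M0 19 C" "elems C \<noteq> []" using hd0 ok C by auto
  then obtain tp where tp: "M0 (19 + 12) = Num tp" "leaf_at M0 tp (last (elems C))"
      by (rule hdr_tail)
  have q0: "oleaf_at M0 tp vo" using tp(2) vo C by (simp add: oleaf_at_def)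
  have ok': "\<forall>C\<in>set Cs. length (snd C) \<le> N + 1 \<and> lst_ok B C \<and>
      dec (elems C)" using ok by auto
  have ext: "ext B [] Cs 0 vo = hd (ext B [] Cs 0 vo) # Rs" "length Rs = length Cs"
    using length_ext[of B "[]" Cs 0 vo] Rs by (cases "ext B [] Cs 0 vo"; simp)+
  define K where "K = ext_cost B [] Cs 0 vo"
  define Rf where "Rf = (if elems (last Rs) = [] then butlast Rs else Rs)"
  show ?thesis unfolding c_extract_def K_def[symmetric] Rf_def[symmetric] using tp(1)
    apply (simp add: wp_Call M0_def[symmetric])
    apply (rule wp_mono[OF wp_ext[OF h0 M0(2) B _ M0(4) X0 _ q0 tab0 ok' stk_ok_Nil, where p = 0]])
    apply (simp, (use hd0 in simp), simp, simp, simp, (elim conjE))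
    subgoal premises p for t1 R1 M1
    proof -
      have g1: "gx (hx 3) M0 M1" and hd1: "hdrs M1 3 (ext B [] Cs 0 vo)"
          and t1: "t1 \<le> 10000 * K"
        using p by (auto simp: K_def)
      have hd1': "hdrs M1 19 Rs" using hd1 by (subst (asm) ext(1)) simp
      have M1: "M1 2 = Num N" "M1 4 = Num B" "M1 6 = Num (length Cs)"
          "M1 8 = Num (3 + 16 * length Cs)" "M1 10 = Num 0"
        using gxD(3)[OF g1] M0 by (auto simp: hx_def)
      have tab1: "half_table M1 (N + 1)" using half_table_hx[OF g1 tab0] .
      have h1: "heapok M1" using gxD(2)[OF g1] .
      obtain n where n: "length Cs = Suc n" using ne by (cases Cs) auto
      have Rne: "Rs \<noteq> []" using ext(2) n by auto
      have lastR: "last Rs = Rs ! n" using Rne ext(2) n by (simp add: last_conv_nth)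
      have "hdr_at M1 (19 + 16 * n) (last Rs)" using hd1' ext(2) n lastR by (simp add: hdrs_nth)
      \<comment> \<open>The code recognises an empty last list by its null pointer in the last-leaf
        field.\<close>
      then obtain tl where tl: "M1 (19 + 16 * n + 12) = Num tl"
          "oleaf_at M1 tl (olast (elems (last Rs)))"
        unfolding hdr_at_def by blast
      have tl1: "M1 (31 + 16 * n) = Num tl" using tl(1) by (simp add: add.commute)
      show ?thesis
      proof (cases "elems (last Rs) = []")
        case True
        hence tl0: "tl = 0" using tl(2) by (simp add: olast_def oleaf_at_def)
        define M2 where "M2 = M1(8 := Num (3 + 16 * n), 6 := Num n)"
        have g2: "gx {8, 6} M1 M2" unfolding M2_def by (intro gx_upd gx_refl h1) auto
        have "hdrs M2 19 Rs" by (rule hdrs_gx[OF g2 _ _ hd1']) auto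
        hence "hdrs M2 19 (butlast Rs)" by (simp add: hdrs_nth nth_butlast)
        moreover have "half_table M2 (N + 1)"
          by (rule half_table_gx[OF g2 tab1]) (auto, presburger+)
        ultimately have "state_at M2 N B (butlast Rs) None"
          unfolding state_at_def using gxD(2)[OF g2] M1 ext(2) n by (simp add: M2_def)
        moreover have "Rf = butlast Rs" using True by (simp add: Rf_def)
        ultimately show ?thesis using M1 n tl1 tl0 t1 by (simp add: M2_def)
      next
        case False
        hence tl0: "0 < tl" using tl(2) leaf_at_pos by (auto simp: olast_def oleaf_at_def)
        have "state_at M1 N B Rs None" unfolding state_at_def using h1 M1 tab1 hd1' ext(2) by simp
        moreover have "Rf = Rs" using False by (simp add: Rf_def)
        ultimately show ?thesis using M1 n tl1 tl0 t1 by simp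
      qed
    qed
    done
qed

definition c_init :: com where
  "c_init = seqs [Const 1 64, st 0 1, Const 1 3, st 8 1]"

text \<open>The zeroed memory already contains the first two entries of the table of halves, those
  of 0 and 1.\<close>

lemma wp_init: "wp c_init (\<lambda>t R' M'. state_at M' 0 0 [] None \<and>
    t \<le> 10) zero_regs zero_mem"
  unfolding c_init_def
  by (simp add: state_at_def heapok_def hp_def zero_mem_def, presburger?)

section \<open>Amortised analysis\<close>

definition lis_ds :: lis_structure where
  "lis_ds = \<lparr>procs = prog, init_code = c_init, append_code = c_append,
      extract_code = c_extract, length_code = ld 0 6\<rparr>"

lemma wp_ex: "wp c Q R M \<Longrightarrow> \<exists>t R' M'. exec prog c (R, M) t (R',
    M') \<and> Q t R' M'"
  by (simp add: wp_def)

lemma contents_snoc: "contents (ops @ [p]) = apply_op p (contents ops)"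
  by (simp add: contents_def)

lemma legal_snoc: "legal (ops @ [p]) \<Longrightarrow> legal ops"
  unfolding legal_def by (metis append.assoc append_Cons)

lemma legal_extract: "legal (ops @ [ExtractMin]) \<Longrightarrow> contents ops \<noteq> []"
  unfolding legal_def by blast

definition appends :: "operation list \<Rightarrow> nat" where
  "appends ops = length (filter (\<lambda>p. p \<noteq> ExtractMin) ops)"

lemma lis_length_le: "lis_length L \<le> length L"
proof -
  have "lis_length L \<in> {length s |s. subseq s L \<and> sorted_wrt (<) s}"
    unfolding lis_length_def by (rule Max_in[OF finite_lis]) (auto intro!: exI[of _ "[]"])
  thus ?thesis by (auto dest: list_emb_length)
qed

lemma length_contents_le: "length (contents ops) \<le> appends ops"
proof (induction ops rule: rev_induct)
  case (snoc p ops)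
  thus ?case
    by (cases p) (auto simp: contents_snoc appends_def intro: order_trans[OF length_filter_le])
qed (simp add: contents_def)

lemma max_lis_in:
  obtains k where "k \<le> length ops" "max_lis ops = lis_length (contents (take k ops))"
proof -
  let ?S = "{lis_length (contents (take k ops)) | k. k \<le> length ops}"
  have "max_lis ops \<in> ?S" unfolding max_lis_def by (rule Max_in) auto
  thus ?thesis using that by blast
qed

lemma max_lis_ge: "k \<le> length ops \<Longrightarrow>
    lis_length (contents (take k ops)) \<le> max_lis ops"
  unfolding max_lis_def by (rule Max_ge) auto

lemma max_lis_le_appends: "max_lis ops \<le> appends ops"
proof -
  obtain k where k: "max_lis ops = lis_length (contents (take k ops))" by (rule max_lis_in)
  have "appends (take k ops) \<le> appends (take k ops @ drop k ops)"
      unfolding appends_def filter_append by simp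
  thus ?thesis using k lis_length_le[of "contents (take k ops)"] length_contents_le[of "take k ops"]
    by (simp only: append_take_drop_id)
qed

definition extract_bound :: "nat \<Rightarrow> real \<Rightarrow> real" where
  "extract_bound lam l = real lam * (1 + log 2 (min (real lam) (l / real lam)))"

fun cursor :: "(nat \<times> real) option \<Rightarrow> nat" where
  "cursor None = 0"
| "cursor (Some (k, v)) = k"

text \<open>Scaled by the 10000 machine steps per abstract step: \<open>ext_cost_le\<close> charges
  \<open>pot\<close> twice and \<open>pending\<close> once. The last term is the scanning distance
  available to the next append, at 30 steps per list.\<close>

definition potential :: "lst list \<Rightarrow> (nat \<times> real) option \<Rightarrow> real" where
  "potential Cs pv = 20000 * pot 1 (map elems Cs) + 10000 * real (pending Cs) + 30 * real (cursor
      pv)"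

definition represents :: "operation list \<Rightarrow> nat \<Rightarrow> nat \<Rightarrow> lst
    list \<Rightarrow> (nat \<times> real) option \<Rightarrow> elem list \<Rightarrow> bool" where
  "represents ops N B Cs pv L \<longleftrightarrow> cover L (map elems Cs) \<and>
      map key L = contents ops \<and>
     (\<forall>y\<in>set L. 0 < pos y \<and> pos y \<le> N) \<and>
         (\<forall>C\<in>set Cs. lst_ok B C) \<and> length Cs \<le> B \<and> N = appends ops \<and>
     length (concat (map elems Cs)) \<le> N \<and> map_option snd pv = last_val None ops"

text \<open>The 30500 per append are 500 steps of work, 20000 for one unit of \<open>pot\<close> and
  10000 for one pending element. A new run pays a scan over at most \<open>lam\<close> lists. The
  130000 are explained by \<open>extract_cost\<close>.\<close>

definition time_bound :: "operation list \<Rightarrow> nat \<Rightarrow> real \<Rightarrow> real"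
    where
  "time_bound ops lam l = 10 + 30500 * real (appends ops) + 30 * real lam * real (runs None ops) +
     130000 * real (count_list ops ExtractMin) * extract_bound lam l"

text \<open>Prefixes are measured against bounds \<open>lam\<close> and \<open>l\<close> for the
  whole execution, which are fixed before the induction over the operations uses them.\<close>

definition fits :: "operation list \<Rightarrow> nat \<Rightarrow> real \<Rightarrow> bool" where
  "fits ops lam l \<longleftrightarrow> (\<forall>k\<le>length ops. lis_length (contents (take k
      ops)) \<le> lam) \<and> 1 \<le> lam \<and>
     real lam \<le> l \<and> real (appends ops) \<le> l"

lemma fits_snoc:
  assumes "fits (ops @ [p]) lam l"
  shows "fits ops lam l"
proof -
  have "lis_length (contents (take k ops)) \<le> lam" if "k \<le> length ops" for k
  proof -
    have "lis_length (contents (take k (ops @ [p]))) \<le> lam"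
      using that by (intro assms[unfolded fits_def, THEN conjunct1, rule_format]) simp
    thus ?thesis using that by simp
  qed
  moreover have "appends ops \<le> appends (ops @ [p])" by (simp add: appends_def)
  ultimately show ?thesis using assms unfolding fits_def by auto
qed

lemma extract_bound_ge:
  assumes "1 \<le> lam" "real lam \<le> l"
  shows "real lam \<le> extract_bound lam l"
proof -
  have "1 \<le> min (real lam) (l / real lam)" using assms by auto
  hence "0 \<le> log 2 (min (real lam) (l / real lam))" by simp
  hence "real lam * 1 \<le> real lam * (1 + log 2 (min (real lam) (l / real lam)))"
    by (intro mult_left_mono) auto
  thus ?thesis by (simp add: extract_bound_def)
qed

lemma pot_append: "pot k (As @ Bs) = pot k As + pot (k + length As) Bs"
  by (induction As arbitrary: k) auto

lemma pot_update: "i < length Cs \<Longrightarrow>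
    pot k (Cs[i := Cs ! i @ [e]]) = pot k Cs + real (k + i) / real (lv e)"
proof (induction Cs arbitrary: i k)
  case (Cons C Cs)
  show ?case
  proof (cases i)
    case 0
    thus ?thesis by (simp add: algebra_simps)
  next
    case (Suc j)
    thus ?thesis using Cons.IH[of j "k + 1"] Cons.prems by simp
  qed
qed simp

lemma elems_appl:
  "map elems (appl Cs k e) =
    (if k < length Cs then (map elems Cs)[k := map elems Cs ! k @ [e]] else map elems Cs @ [[e]])"
  by (auto simp: appl_def map_update elems_def)

lemma pending_update: "k < length Cs \<Longrightarrow>
    pending (Cs[k := (b, e # snd (Cs ! k))]) = Suc (pending Cs)"
  by (induction Cs arbitrary: k) (auto split: nat.split)

lemma pending_appl: "k \<le> length Cs \<Longrightarrow> pending (appl Cs k e) = pending Cs + 1"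
  by (auto simp: appl_def pending_update)

lemma length_concat_update:
  "k < length Cs \<Longrightarrow> length (concat (Cs[k := Cs ! k @ [e]])) = Suc (length (concat
      Cs))"
  by (induction Cs arbitrary: k) (auto split: nat.split)

lemma represents_append:
  assumes r: "represents ops N B Cs pv L" and k: "k \<le> length Cs"
    and c: "k < length Cs \<longrightarrow> x \<le> key (last (elems (Cs ! k)))"
        "0 < k \<longrightarrow> key (last (elems (Cs ! (k - 1)))) < x"
    and e: "e = Elem x (N + 1) (k + 1)"
  shows "represents (ops @ [Append x]) (N + 1) (max B (length (appl Cs k e))) (appl Cs k e) (Some
      (k, x)) (L @ [e])"
proof -
  note r = r[unfolded represents_def]
  have rs: "cover L (map elems Cs)" "map key L = contents ops"
      "\<forall>y\<in>set L. 0 < pos y \<and> pos y \<le> N"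
    "\<forall>C\<in>set Cs. lst_ok B C" "length Cs \<le> B" "N = appends ops"
        "length (concat (map elems Cs)) \<le> N"
    using r by blast+
  have p: "\<forall>y\<in>set L. pos y < pos e" using rs(3) e by (simp add: less_Suc_eq_le)
  have cov: "cover (L @ [e]) (map elems (appl Cs k e))"
  proof (cases "k < length Cs")
    case True
    show ?thesis unfolding elems_appl using True
      by (simp only: if_True) (rule cover_append[OF rs(1) p], use True c e in simp_all)
  next
    case False
    hence k: "k = length Cs" using k by simp
    have "key (last (last (map elems Cs))) < x" if "Cs \<noteq> []"
      using c(2) k that by (simp add: last_map last_conv_nth)
    thus ?thesis unfolding elems_appl using False
      by (simp only: if_False) (rule cover_new[OF rs(1) p], use e in simp)
  qed
  have ok: "lst_ok (max B (length (appl Cs k e))) C" if "C \<in> set (appl Cs k e)" for C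
  proof -
    have kB: "k + 1 \<le> max B (length (appl Cs k e))" using k rs(5) by (simp add: appl_def)
    have old: "lst_ok (max B (length (appl Cs k e))) D" if "D \<in> set Cs" for D
      using rs(4) that by (simp add: lst_ok_mono[of B D])
    show ?thesis
    proof (cases "k < length Cs")
      case True
      hence "C = (fst (Cs ! k), e # snd (Cs ! k)) \<or> C \<in> set Cs"
        using \<open>C \<in> set (appl Cs k e)\<close> set_update_subset_insert[of Cs k
            "(fst (Cs ! k), e # snd (Cs ! k))"]
        by (auto simp: appl_def)
      thus ?thesis
      proof
        assume C: "C = (fst (Cs ! k), e # snd (Cs ! k))"
        have "lst_ok (max B (length (appl Cs k e))) (Cs ! k)" using old True by simp
        thus ?thesis using C kB e by (simp add: lst_ok_def)
      qed (rule old)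
    next
      case False
      hence "C = ([], [e]) \<or> C \<in> set Cs" using \<open>C \<in> set (appl Cs k e)\<close>
          by (auto simp: appl_def)
      thus ?thesis
      proof
        assume "C = ([], [e])"
        thus ?thesis using kB e by (simp add: lst_ok_def)
      qed (rule old)
    qed
  qed
  have len: "length (concat (map elems (appl Cs k e))) \<le> N + 1"
    unfolding elems_appl using rs(7) length_concat_update[of k "map elems Cs" e] by simp
  show ?thesis unfolding represents_def
    using cov ok len rs(2,3,6) e by (auto simp: contents_snoc appends_def last_val_append)
qed

lemma represents_extract:
  assumes r: "represents ops N B Cs pv L" and ne: "Cs \<noteq> []"
    and vo: "vo = Some (last (elems (hd Cs)))" and Rs: "Rs = tl (ext B [] Cs 0 vo)"
  shows "represents (ops @ [ExtractMin]) N B (if elems (last Rs) = [] then butlast Rs else Rs) None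
    (filter (\<lambda>x. key x \<noteq> key (last (elems (hd Cs)))) L)"
proof -
  note r = r[unfolded represents_def]
  note cv = r[THEN conjunct1, unfolded cover_def]
  obtain C Cs' where C: "Cs = C # Cs'" using ne by (cases Cs) auto
  have B: "0 < B" using r C by auto
  have ok: "\<forall>C\<in>set Cs. lst_ok B C \<and> dec (elems C)" using r cv by auto
  have e: "map elems (ext B [] Cs 0 vo) = shift [] (map elems Cs) 0 vo"
      "\<forall>C\<in>set (ext B [] Cs 0 vo). lst_ok B C"
    using ext_correct[OF B ok stk_ok_Nil, of 0 vo] by auto
  have R: "map elems Rs = tl (shift [] (elems C # map elems Cs') 0 (Some (last (elems C))))"
  proof -
    have "map elems Rs = tl (shift [] (map elems Cs) 0 vo)" unfolding Rs map_tl e(1) ..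
    thus ?thesis unfolding C vo by (simp del: shift.simps)
  qed
  have cov: "cover L (elems C # map elems Cs')" using r C by simp
  have pos: "\<forall>y\<in>set L. 0 < pos y" using r by auto
  note ce = cover_extract[OF cov pos R]
  have Rne: "Rs \<noteq> []" using ce(2) by auto
  let ?R = "if elems (last Rs) = [] then butlast Rs else Rs"
  have mR: "map elems ?R = (if last (map elems Rs) = [] then butlast (map elems Rs) else map elems
      Rs)"
    using Rne by (simp add: last_map map_butlast)
  have sub: "set ?R \<subseteq> set (ext B [] Cs 0 vo)"
  proof -
    have "set Rs \<subseteq> set (ext B [] Cs 0 vo)" unfolding Rs by (cases "ext B [] Cs 0 vo") auto
    thus ?thesis by (auto dest: in_set_butlastD)
  qed
  have "length ?R \<le> length Rs" by simp
  moreover have lR: "length Rs = length Cs" using ce(2) C by simp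
  ultimately have "length ?R \<le> B" using r by linarith
  moreover have "length (concat (map elems ?R)) \<le> length (concat (map elems Rs))"
    by (cases Rs rule: rev_cases) auto
  hence "length (concat (map elems ?R)) \<le> N" using ce(3) r C by simp
  moreover have "map key (filter (\<lambda>x. key x \<noteq> key (last (elems (hd Cs)))) L) =
      contents (ops @ [ExtractMin])"
  proof -
    have "Min (set (contents ops)) = key (last (elems (hd Cs)))"
      using cover_min[OF cov] r C by simp
    moreover have "contents ops = map key L" using r by simp
    ultimately show ?thesis by (simp add: contents_snoc filter_map o_def)
  qed
  moreover have "cover (filter (\<lambda>x. key x \<noteq> key (last (elems (hd Cs)))) L) (map
      elems ?R)"
    unfolding mR using ce(1) C by simp
  ultimately show ?thesis unfolding represents_def
    using r sub e(2) by (auto simp: appends_def last_val_append)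
qed

text \<open>The sum over the lists is at most \<open>3 + 2 * 4 = 11\<close> times
  \<open>extract_bound\<close>, the 4 coming from \<open>log_sum_le\<close>; the leading 1 makes it
  12. This gives 120000, and the rest of 130000 absorbs the constant 100.\<close>

lemma extract_cost:
  assumes r: "represents ops N B Cs pv L" and ne: "Cs \<noteq> []" and B: "B \<le> lam"
    and l: "1 \<le> lam" "real lam \<le> l" "real N \<le> l"
    and Rs: "Rs = tl (ext B [] Cs 0 vo)"
  shows "10000 * real (ext_cost B [] Cs 0 vo) + 100 + potential (if elems (last Rs) = [] then
      butlast Rs else Rs) None
    \<le> potential Cs pv + 130000 * extract_bound lam l"
proof -
  note r = r[unfolded represents_def]
  note cv = r[THEN conjunct1, unfolded cover_def]
  have B0: "0 < B" using r ne by (cases Cs) auto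
  have ok: "\<forall>C\<in>set Cs. lst_ok B C \<and> dec (elems C)" using r cv by auto
  note ec = ext_cost_le[OF B0 ok stk_ok_Nil, of 0 vo 0]
  let ?E = "ext B [] Cs 0 vo"
  obtain E0 where E: "?E = E0 # Rs" using length_ext[of B "[]" Cs 0 vo] Rs by (cases ?E) auto
  have Rne: "Rs \<noteq> []" using length_ext[of B "[]" Cs 0 vo] E ne by auto
  let ?R = "if elems (last Rs) = [] then butlast Rs else Rs"
  have bl: "Rs = butlast Rs @ [last Rs]" using Rne by simp
  have p1: "pot 1 (map elems ?R) \<le> pot 1 (map elems Rs)"
  proof -
    have "pot 1 (map elems Rs) = pot 1 (map elems (butlast Rs)) + pot (1 + length (butlast Rs))
        [elems (last Rs)]"
      by (subst bl) (simp add: pot_append del: append_butlast_last_id)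
    thus ?thesis using pot_nonneg[of "1 + length (butlast Rs)" "[elems (last Rs)]"] by simp
  qed
  have p2: "pending ?R \<le> pending Rs"
  proof -
    have "pending Rs = pending (butlast Rs) + pending [last Rs]"
      by (subst bl) (simp only: pending_simps)
    thus ?thesis by simp
  qed
  \<comment> \<open>The dummy list has index 0, so the copies of the minimum that move into it
    vanish from the potential.\<close>
  have P: "pot 0 (els [] # map elems Cs) = pot 1 (map elems Cs)"
      "pot 0 (map elems ?E) = pot 1 (map elems Rs)"
    using E by simp_all
  have pe: "pending ?E \<ge> pending Rs" using E by simp
  have len: "length Cs \<le> lam" using r B by linarith
  have hb0: "ht_bound B (length (els [])) = 0" by (simp add: ht_bound_def)
  have sum: "(\<Sum>C\<leftarrow>Cs. 3 + 2 * ht_bound B (length (elems C))) \<le> 11 *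
      extract_bound lam l"
  proof -
    have "(\<Sum>C\<leftarrow>Cs. 3 + 2 * ht_bound B (length (elems C))) =
        3 * real (length Cs) + 2 * (\<Sum>n\<leftarrow>map (\<lambda>C. length (elems C)) Cs.
            ht_bound B n)"
      by (induction Cs) (auto simp: algebra_simps)
    also have "(\<Sum>n\<leftarrow>map (\<lambda>C. length (elems C)) Cs. ht_bound B n) \<le> 4 *
        extract_bound lam l"
      unfolding extract_bound_def
    proof (rule log_sum_le)
      show "\<forall>n\<in>set (map (\<lambda>C. length (elems C)) Cs). 1 \<le> n" using cv
          by (auto simp: Suc_le_eq)
      have "sum_list (map (\<lambda>C. length (elems C)) Cs) = length (concat (map elems Cs))"
        by (simp add: length_concat o_def)
      thus "real (sum_list (map (\<lambda>C. length (elems C)) Cs)) \<le> l" using r l(3)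
          by linarith
    qed (use len B l in auto)
    finally have "(\<Sum>C\<leftarrow>Cs. 3 + 2 * ht_bound B (length (elems C))) \<le> 3 * real
        (length Cs) + 8 * extract_bound lam l"
      by simp
    thus ?thesis using extract_bound_ge[OF l(1,2)] len by linarith
  qed
  have F1: "1 \<le> extract_bound lam l" using extract_bound_ge[OF l(1,2)] l(1) by linarith
  define R' where "R' = ?R"
  have p3: "pot 1 (map elems R') \<le> pot 1 (map elems Rs)"
      "real (pending R') \<le> real (pending ?E)"
    using p1 p2 pe unfolding R'_def by (simp_all only: of_nat_le_iff order_trans)
  have "real (ext_cost B [] Cs 0 vo) + real (pending R') + 2 * pot 1 (map elems R')
      \<le> 12 * extract_bound lam l + real (pending Cs) + 2 * pot 1 (map elems Cs)"
    using ec sum p3 hb0 F1 unfolding P by argo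
  moreover have "cursor None = 0" "0 \<le> real (cursor pv)" by simp_all
  ultimately show ?thesis unfolding potential_def R'_def[symmetric] using F1 by simp
qed

lemma run_bound:
  assumes "legal ops"
  shows "\<exists>t M N B Cs pv L. run lis_ds ops t M \<and> state_at M N B Cs pv \<and>
      represents ops N B Cs pv L \<and>
    (\<forall>lam l. fits ops lam l \<longrightarrow> B \<le> lam \<and>
        real t + potential Cs pv \<le> time_bound ops lam l)"
  using assms
proof (induction ops rule: rev_induct)
  case Nil
  from wp_ex[OF wp_init] obtain t R M where e: "exec prog c_init (zero_regs, zero_mem) t (R, M)"
    and s: "state_at M 0 0 [] None" "t \<le> 10" by blast
  have "run lis_ds [] t M" using e by (intro run.Init[where R = R]) (simp add: lis_ds_def)
  moreover have "represents [] 0 0 [] None []"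
    by (simp add: represents_def cover_def contents_def appends_def)
  moreover have "real t + potential [] None \<le> time_bound [] lam l" for lam l
    using s(2) by (simp add: potential_def time_bound_def appends_def)
  ultimately show ?case using s(1) by blast
next
  case (snoc p ops)
  from snoc.IH[OF legal_snoc[OF snoc.prems]] obtain t M N B Cs pv L where
    run: "run lis_ds ops t M" and st: "state_at M N B Cs pv" and r: "represents ops N B Cs pv L" and
    tb: "\<forall>lam l. fits ops lam l \<longrightarrow> B \<le> lam \<and>
        real t + potential Cs pv \<le> time_bound ops lam l" by blast
  note r' = r[unfolded represents_def]
  have cv: "\<forall>C\<in>set Cs. elems C \<noteq> [] \<and> dec (elems C)" using r'
      unfolding cover_def by auto
  show ?case
  proof (cases p)
    case (Append x)
    have F: "(zero_regs(0 := Key x)) 0 = Key x" by simp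
    have ne: "\<forall>C\<in>set Cs. elems C \<noteq> []" using cv by blast
    from wp_ex[OF wp_append[where F = "zero_regs(0 := Key x)"
        and x = x, OF st ne _ F]] r' obtain u R M' k where
      e: "exec prog c_append (zero_regs(0 := Key x), M) u (R, M')" and k: "k \<le> length Cs" and
      s': "state_at M' (N + 1) (max B (length (appl Cs k (Elem x (N + 1) (k + 1))))) (appl Cs k
          (Elem x (N + 1) (k + 1))) (Some (k, x))"
      and c: "k < length Cs \<longrightarrow> x \<le> key (last (elems (Cs ! k)))"
          "0 < k \<longrightarrow> key (last (elems (Cs ! (k - 1)))) < x"
      and u: "u + 30 * k \<le> 500 + 30 * start pv x (length Cs)" by blast
    define e' where "e' = Elem x (N + 1) (k + 1)"
    let ?Cs = "appl Cs k e'" and ?B = "max B (length (appl Cs k e'))"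
    have run': "run lis_ds (ops @ [Append x]) (t + u) M'"
      using run e by (intro run.Append[where R = R]) (simp_all add: lis_ds_def)
    have rep: "represents (ops @ [Append x]) (N + 1) ?B ?Cs (Some (k, x)) (L @ [e'])"
      using represents_append[OF r k c e'_def] .
    have "?B \<le> lam \<and> real (t + u) + potential ?Cs (Some (k,
        x)) \<le> time_bound (ops @ [Append x]) lam l"
      if w: "fits (ops @ [Append x]) lam l" for lam l
    proof
      have wo: "fits ops lam l" using fits_snoc[OF w] .
      have "length ?Cs = lis_length (contents (ops @ [Append x]))"
        using lis_length_cover[of "L @ [e']" "map elems ?Cs"] rep by (simp add: represents_def)
      also have "\<dots> \<le> lam" using w unfolding fits_def by (metis order_refl take_all)
      finally show "?B \<le> lam" using tb wo by auto
      have po: "potential ?Cs (Some (k,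
          x)) = potential Cs pv + 30000 + 30 * real k - 30 * real (cursor pv)"
      proof -
        have "pot 1 (map elems ?Cs) = pot 1 (map elems Cs) + 1"
          unfolding elems_appl using k pot_update[of k "map elems Cs" 1 e']
          by (cases "k < length Cs") (auto simp: pot_append e'_def)
        thus ?thesis unfolding potential_def using pending_appl[OF k, of e'] by simp
      qed
      \<comment> \<open>An append that continues a run scans from the cursor; one that starts a run
        scans from the right end, and there are at most \<open>lam\<close> lists.\<close>
      have st: "real (start pv x (length Cs)) \<le> real (cursor pv) + real lam * (if starts_run
          (last_val None ops) x then 1 else 0)"
      proof -
        have lv: "last_val None ops = map_option snd pv" using r' by simp
        have "length Cs \<le> lam" using r' tb wo by fastforce
        thus ?thesis unfolding lv by (cases pv) auto
      qed
      have "real u + 30 * real k \<le> 500 + 30 * real (start pv x (length Cs))"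
        using u by (simp only: of_nat_le_iff[symmetric,
            where 'a = real] of_nat_add of_nat_mult of_nat_numeral)
      moreover have "real t + potential Cs pv \<le> time_bound ops lam l" using tb wo by blast
      moreover have "time_bound (ops @ [Append x]) lam l =
         time_bound ops lam l + 30500 + 30 * (real lam * (if starts_run (last_val None ops) x then
             1 else 0))"
        by (simp add: time_bound_def appends_def runs_append algebra_simps)
      ultimately show "real (t + u) + potential ?Cs (Some (k,
          x)) \<le> time_bound (ops @ [Append x]) lam l"
        unfolding po using st by simp
    qed
    thus ?thesis using run' s' rep unfolding Append e'_def by blast
  next
    case ExtractMin
    have ne: "Cs \<noteq> []"
    proof
      assume "Cs = []"
      hence "L = []" using r' by (simp add: cover_def)
      hence "contents ops = []" using r' by simp
      thus False using legal_extract[of ops] snoc.prems ExtractMin by simp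
    qed
    define vo where "vo = Some (last (elems (hd Cs)))"
    define Rs where "Rs = tl (ext B [] Cs 0 vo)"
    let ?R = "if elems (last Rs) = [] then butlast Rs else Rs"
    have B0: "0 < B" using r' ne by (cases Cs) auto
    \<comment> \<open>Keeps every buffer within the range of the table of halves, which reaches
      \<open>N + 1\<close>.\<close>
    have "length (snd C) \<le> N" if "C \<in> set Cs" for C
    proof -
      have "length (snd C) \<le> length (elems C)" by (simp add: elems_def)
      also have "\<dots> \<le> length (concat (map elems Cs))"
        using that by (induction Cs) auto
      finally show ?thesis using r' by linarith
    qed
    hence ok: "\<forall>C\<in>set Cs. length (snd C) \<le> N \<and> lst_ok B C \<and>
        dec (elems C) \<and> elems C \<noteq> []"
      using r' cv by blast
    from wp_ex[OF wp_extract[OF st ne ok B0 vo_def Rs_def]] obtain u R M' where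
      e: "exec prog c_extract (zero_regs, M) u (R, M')" and s': "state_at M' N B ?R None" and
      u: "u \<le> 10000 * ext_cost B [] Cs 0 vo + 100" by blast
    have run': "run lis_ds (ops @ [ExtractMin]) (t + u) M'"
      using run e by (intro run.ExtractMin[where R = R]) (simp_all add: lis_ds_def)
    have rep: "represents (ops @ [ExtractMin]) N B ?R None (filter (\<lambda>x. key x \<noteq> key
        (last (elems (hd Cs)))) L)"
      using represents_extract[OF r ne vo_def Rs_def] .
    have "B \<le> lam \<and> real (t + u) + potential ?R None \<le> time_bound (ops @
        [ExtractMin]) lam l"
      if w: "fits (ops @ [ExtractMin]) lam l" for lam l
    proof
      have wo: "fits ops lam l" using fits_snoc[OF w] .
      show B: "B \<le> lam" using tb wo by blast
      have l: "1 \<le> lam" "real lam \<le> l" "real N \<le> l" using wo r' by (auto simp: fits_def)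
      have "real u \<le> 10000 * real (ext_cost B [] Cs 0 vo) + 100"
        using u by (simp only: of_nat_le_iff[symmetric,
            where 'a = real] of_nat_add of_nat_mult of_nat_numeral)
      moreover have "real t + potential Cs pv \<le> time_bound ops lam l" using tb wo by blast
      moreover have "time_bound (ops @ [ExtractMin]) lam l = time_bound ops lam l + 130000 *
          extract_bound lam l"
        by (simp add: time_bound_def appends_def runs_append algebra_simps)
      ultimately show "real (t + u) + potential ?R None \<le> time_bound (ops @ [ExtractMin]) lam l"
        using extract_cost[OF r ne B l Rs_def] by simp
    qed
    thus ?thesis using run' s' rep unfolding ExtractMin by blast
  qed
qed

theorem theorem2:
  "\<exists>(D :: lis_structure) (C :: real). \<forall>ops. legal ops \<longrightarrow>
     (\<exists>t M. run D ops t M \<and>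
        (\<exists>u R. exec (procs D) (length_code D) (zero_regs, M) u (R, M) \<and>
               R 0 = Num (lis_length (contents ops)) \<and> real u \<le> C) \<and>
        (\<forall>d :: nat. contents ops = [] \<and> batched ops d \<and>
            max_lis ops \<ge> 1 \<longrightarrow>
           (let l = real (length (filter (\<lambda>p. p \<noteq> ExtractMin) ops));
                e = real (count_list ops ExtractMin);
                lam = real (max_lis ops)
            in real t \<le> C * (e * lam * (1 + log 2 (min lam (l / lam))) + l + real d * lam))))"
proof (rule exI[of _ lis_ds], rule exI[of _ 130000], intro allI impI)
  fix ops assume "legal ops"
  from run_bound[OF this] obtain t M N B Cs pv L where
    run: "run lis_ds ops t M" and st: "state_at M N B Cs pv" and r: "represents ops N B Cs pv L" and
    tb: "\<forall>lam l. fits ops lam l \<longrightarrow> B \<le> lam \<and>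
        real t + potential Cs pv \<le> time_bound ops lam l" by blast
  have "wp (ld 0 6) (\<lambda>u R M'. M' = M \<and> R 0 = Num (length Cs) \<and>
      real u \<le> 130000) zero_regs M"
    using st by (simp add: state_at_def)
  from wp_ex[OF this] obtain u R where
    e: "exec prog (ld 0 6) (zero_regs, M) u (R, M)" "R 0 = Num (length Cs)"
        "real u \<le> 130000" by blast
  have "lis_length (contents ops) = length Cs"
    using lis_length_cover[of L "map elems Cs"] r by (simp add: represents_def)
  hence len: "\<exists>u R. exec (procs lis_ds) (length_code lis_ds) (zero_regs, M) u (R, M) \<and>
      R 0 = Num (lis_length (contents ops)) \<and> real u \<le> 130000"
    using e by (auto simp: lis_ds_def)
  have bound: "real t \<le> 130000 * (real (count_list ops ExtractMin) * real (max_lis ops) *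
      (1 + log 2 (min (real (max_lis ops)) (real (appends ops) / real (max_lis ops)))) +
      real (appends ops) + real d * real (max_lis ops))"
    if b: "batched ops d" and m: "max_lis ops \<ge> 1" for d
  proof -
    have "fits ops (max_lis ops) (real (appends ops))"
      unfolding fits_def using max_lis_ge max_lis_le_appends[of ops] m by auto
    hence 1: "real t + potential Cs pv \<le> time_bound ops (max_lis ops) (real (appends ops))"
        using tb by blast
    have 2: "0 \<le> potential Cs pv" unfolding potential_def using pot_nonneg by simp
    \<comment> \<open>At least one append has happened, so the linear term absorbs the cost 10 of
      initialisation.\<close>
    have 3: "1 \<le> real (appends ops)" using m max_lis_le_appends[of ops] by linarith
    have 4: "real (max_lis ops) * real (runs None ops) \<le> real d * real (max_lis ops)"
      using batched_runs[OF b, of None]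
          by (subst mult.commute[of "real d"]) (intro mult_left_mono, simp_all)
    have 5: "0 \<le> real d * real (max_lis ops)" by simp
    define Z where "Z = real (count_list ops ExtractMin) * real (max_lis ops) *
      (1 + log 2 (min (real (max_lis ops)) (real (appends ops) / real (max_lis ops))))"
    have 6: "time_bound ops (max_lis ops) (real (appends ops)) =
        10 + 30500 * real (appends ops) + 30 * (real (max_lis ops) * real (runs None ops)) +
            130000 * Z"
      unfolding time_bound_def extract_bound_def Z_def by (simp only: mult.assoc)
    have gen: "T \<le> 130000 * (Z + a + y)"
      if "0 \<le> y" "b = 10 + 30500 * a + 30 * x + 130000 * Z" "T + P \<le> b" "0 \<le> P"
          "1 \<le> a" "x \<le> y"
      for T P a b x y Z :: real
    proof -
      have "T \<le> 10 + 30500 * a + 30 * x + 130000 * Z" using that(2-4) by linarith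
      moreover have "10 + 30500 * a \<le> 130000 * a" using that(5) by linarith
      moreover have "30 * x \<le> 130000 * y" using that(1,6) by linarith
      ultimately show ?thesis by (simp add: distrib_left)
    qed
    show ?thesis unfolding Z_def[symmetric] by (rule gen[OF 5 6 1 2 3 4])
  qed
  show "\<exists>t M. run lis_ds ops t M \<and>
        (\<exists>u R. exec (procs lis_ds) (length_code lis_ds) (zero_regs, M) u (R, M) \<and>
               R 0 = Num (lis_length (contents ops)) \<and> real u \<le> 130000) \<and>
        (\<forall>d :: nat. contents ops = [] \<and> batched ops d \<and>
            max_lis ops \<ge> 1 \<longrightarrow>
           (let l = real (length (filter (\<lambda>p. p \<noteq> ExtractMin) ops));
                e = real (count_list ops ExtractMin);
                lam = real (max_lis ops)
            in real t \<le> 130000 * (e * lam * (1 + log 2 (min lam (l / lam))) + l + real d *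
                lam)))"
    using run len bound unfolding Let_def appends_def by blast
qed

end
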